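(* Let $n\ge1$ be an integer not divisible by $p$. Then the regulator $\operatorname{Reg}(\underline A(n))$ of the $n$th Carlitz twist is an isomorphism of $K_\infty$-vector spaces.
   Context: $\mathbb{F}$ is a finite field with $q$ elements and characteristic $p$; $\theta,t$ are independent indeterminates. $\mathbb{F}((1/\theta))$ is the base field at infinity; $\mathbb{F}((1/\theta))\langle t\rangle$ is the Tate algebra (power series in $t$ with coefficients tending to $0$), and for $f=\sum a_it^i$ put $f^{(1)}=\sum a_i^qt^i$. The coefficient field is $K_\infty=\mathbb{F}((1/t))$, with $\mathbb{F}[t]\subset K_\infty$. The Anderson–Thakur function is $\omega(t)=\lambda_\theta\prod_{i\ge0}(1-t/\theta^{q^i})^{-1}$ with $\lambda_\theta^{q-1}=-\theta$. Set $B^+=\mathbb{F}[t]\,\omega(t)^n$ if $(q-1)\mid n$ and $B^+=0$ otherwise. Regulator of $\underline A(n)$ (the $t$-motive over $\mathbb{F}[\theta]$ with module $\mathbb{F}[\theta,t]$ and Frobenius map $(t-\theta)^{-n}$). Its source is $\operatorname{Ext}^{1,\mathrm{reg}}_{A,\infty}(\mathbb{1},\underline A(n))\otimes_{\mathbb{F}[t]}K_\infty$, where the integral $t$-motivic cohomology $\operatorname{Ext}^{1,\mathrm{reg}}_{A,\infty}(\mathbb{1},\underline A(n))$ is canonically $$\frac{\{\xi\in\mathbb{F}((1/\theta))\langle t\rangle:\ \xi^{(1)}-(t-\theta)^n\xi\in\mathbb{F}[\theta,t]\}}{B^++\mathbb{F}[\theta,t]}.$$ Its target, a space of extensions of Hodge–Pink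 structures, is canonically $$\frac{(t-\theta)^{-n}\,\mathbb{F}((1/\theta))[[t-\theta]]}{B^+\otimes_{\mathbb{F}[t]}K_\infty+\mathbb{F}((1/\theta))[[t-\theta]]},$$ where $K_\infty=\mathbb{F}((1/t))$ acts through the expansion at $t=\theta$, $\mathbb{F}((1/t))\to\mathbb{F}((1/\theta))[[t-\theta]]$, $t\mapsto\theta+(t-\theta)$. Each $\xi\in\mathbb{F}((1/\theta))\langle t\rangle$ satisfying $\xi^{(1)}-(t-\theta)^n\xi\in\mathbb{F}[\theta,t]$ extends to a meromorphic function of $t$ with a pole of order at most $n$ at $t=\theta$ (and $\omega^n$ likewise), and under these identifications $\operatorname{Reg}(\underline A(n))$ is the $K_\infty$-linear map induced by sending the class of $\xi$ to the class of its Laurent expansion at $t=\theta$. *)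

theory Defs
  imports
    "HOL-Algebra.Module"
    "HOL-Algebra.AbelCoset"
    "HOL-Algebra.Free_Abelian_Groups"
    "HOL-Algebra.Algebraic_Closure_Type"
    "HOL-Library.Cardinality"
begin

section \<open>Quotient modules, extension of scalars, and induced maps\<close>

text \<open>The fields \<open>mult\<close> and \<open>one\<close> of the record type \<open>module\<close> play no role in the locale \<open>module\<close>;
  they are filled with \<open>undefined\<close> below.\<close>

definition quot_module :: "('r, 'm) module \<Rightarrow> 'm set \<Rightarrow> ('r, 'm set) module" where
  "quot_module M N =
     \<lparr>carrier = a_rcosets\<^bsub>M\<^esub> N, monoid.mult = undefined, one = undefined,
      zero = N, add = set_add M,
      module.smult = (\<lambda>r C. \<Union>x\<in>C. N +>\<^bsub>M\<^esub> (r \<odot>\<^bsub>M\<^esub> x))\<rparr>"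

text \<open>For a ring homomorphism \<open>\<phi>\<close> from \<open>R\<close> to \<open>K\<close> and an \<open>R\<close>-module \<open>M\<close>, the \<open>K\<close>-module
  \<open>M \<otimes>\<^sub>R K\<close>: the free abelian group on the pairs \<open>(x, a)\<close> modulo the subgroup generated by the
  bilinearity relations, with \<open>K\<close> acting on the right factor.\<close>

definition tensor_relations ::
  "'r ring \<Rightarrow> ('r \<Rightarrow> 'k) \<Rightarrow> 'k ring \<Rightarrow> ('r, 'm) module \<Rightarrow> ('m \<times> 'k \<Rightarrow>\<^sub>0 int) set" where
  "tensor_relations R \<phi> K M =
     {frag_of (x \<oplus>\<^bsub>M\<^esub> y, a) - frag_of (x, a) - frag_of (y, a) | x y a.
        x \<in> carrier M \<and> y \<in> carrier M \<and> a \<in> carrier K} \<union>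
     {frag_of (x, a \<oplus>\<^bsub>K\<^esub> b) - frag_of (x, a) - frag_of (x, b) | x a b.
        x \<in> carrier M \<and> a \<in> carrier K \<and> b \<in> carrier K} \<union>
     {frag_of (r \<odot>\<^bsub>M\<^esub> x, a) - frag_of (x, \<phi> r \<otimes>\<^bsub>K\<^esub> a) | r x a.
        r \<in> carrier R \<and> x \<in> carrier M \<and> a \<in> carrier K}"

definition base_change ::
  "'r ring \<Rightarrow> ('r \<Rightarrow> 'k) \<Rightarrow> 'k ring \<Rightarrow> ('r, 'm) module \<Rightarrow> ('k, ('m \<times> 'k \<Rightarrow>\<^sub>0 int) set) module" where
  "base_change R \<phi> K M =
     (let G = free_Abelian_group (carrier M \<times> carrier K);
          N = generate G (tensor_relations R \<phi> K M)
      in \<lparr>carrier = carrier (G Mod N), monoid.mult = undefined, one = undefined,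
          zero = \<one>\<^bsub>G Mod N\<^esub>, add = monoid.mult (G Mod N),
          module.smult = (\<lambda>c C. \<Union>u\<in>C. N #>\<^bsub>G\<^esub> frag_extend (\<lambda>(x, a). frag_of (x, c \<otimes>\<^bsub>K\<^esub> a)) u)\<rparr>)"

text \<open>The map induced on cosets by a map that is constant on every coset.\<close>

definition quot_lift :: "('m \<Rightarrow> 'b) \<Rightarrow> 'm set \<Rightarrow> 'b" where
  "quot_lift f C = the_elem (f ` C)"

text \<open>The \<open>K\<close>-linear map \<open>M \<otimes>\<^sub>R K \<rightarrow> N\<close>, \<open>x \<otimes> a \<mapsto> a \<odot> f x\<close>, induced by an \<open>R\<close>-linear map \<open>f\<close>
  from \<open>M\<close> to a \<open>K\<close>-module \<open>N\<close>.\<close>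

definition base_change_lift ::
  "('k, 'b) module \<Rightarrow> ('m \<Rightarrow> 'b) \<Rightarrow> ('m \<times> 'k \<Rightarrow>\<^sub>0 int) set \<Rightarrow> 'b" where
  "base_change_lift N f =
     quot_lift (\<lambda>u. finsum N
        (\<lambda>(x, a). add_pow N (Poly_Mapping.lookup u (x, a)) (a \<odot>\<^bsub>N\<^esub> f x)) (Poly_Mapping.keys u))"

definition module_iso :: "'k ring \<Rightarrow> ('k, 'a) module \<Rightarrow> ('k, 'b) module \<Rightarrow> ('a \<Rightarrow> 'b) set" where
  "module_iso K M N = {h \<in> iso (add_monoid M) (add_monoid N).
     \<forall>c\<in>carrier K. \<forall>x\<in>carrier M. h (c \<odot>\<^bsub>M\<^esub> x) = c \<odot>\<^bsub>N\<^esub> h x}"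


section \<open>Series in \<open>t\<close> over the base field at infinity\<close>

text \<open>The type \<open>'a fls\<close> is used both for \<open>\<bbbF>((1/\<theta>))\<close>, where \<open>fls_X = 1/\<theta>\<close>, and for
  \<open>K\<^sub>\<infinity> = \<bbbF>((1/t))\<close>, where \<open>fls_X = 1/t\<close>. Its metric is the \<open>1/\<theta>\<close>-adic one.
  An element of \<open>'a fls fps\<close> is a power series in \<open>t\<close> or, after expansion at \<open>t = \<theta>\<close>, in \<open>t - \<theta>\<close>;
  an element of \<open>'a fls fls\<close> is a Laurent series in \<open>t - \<theta>\<close>.\<close>

abbreviation theta :: "'a::field fls" where
  "theta \<equiv> fls_X_inv"

definition inf_of_poly :: "'a::field poly \<Rightarrow> 'a fls" where
  "inf_of_poly p = poly (map_poly fls_const p) fls_X_inv"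

definition tate_algebra :: "'a::field fls fps set" where
  "tate_algebra = {f. (\<lambda>i. fps_nth f i) \<longlonglongrightarrow> 0}"

definition poly_theta_t :: "'a::field fls fps set" where
  "poly_theta_t = range (\<lambda>P :: 'a poly poly. fps_of_poly (map_poly inf_of_poly P))"

definition series_of_poly_t :: "'a::field poly \<Rightarrow> 'a fls fps" where
  "series_of_poly_t a = fps_of_poly (map_poly fls_const a)"

definition frob_twist :: "'a::field fls fps \<Rightarrow> 'a fls fps" where
  "frob_twist f = Abs_fps (\<lambda>i. fps_nth f i ^ CARD('a))"

abbreviation t_minus_theta :: "'a::field fls fps" where
  "t_minus_theta \<equiv> fps_X - fps_const theta"

text \<open>The built-in metric of \<open>'a fls fps\<close> ignores the topology of the coefficients, so limits of
  series are taken coefficientwise in \<open>\<bbbF>((1/\<theta>))\<close>.\<close>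

definition coeffwise_lim :: "(nat \<Rightarrow> 'a::field fls fps) \<Rightarrow> 'a fls fps" where
  "coeffwise_lim S = Abs_fps (\<lambda>j. lim (\<lambda>N. fps_nth (S N) j))"


section \<open>The Anderson--Thakur function\<close>

text \<open>The root \<open>\<lambda>\<^sub>\<theta>\<close> of \<open>-\<theta>\<close> need not lie in \<open>\<bbbF>((1/\<theta>))\<close>, so \<open>\<omega>\<close> has coefficients in an algebraic
  closure; it is the product of \<open>\<lambda>\<^sub>\<theta>\<close> and a series over \<open>\<bbbF>((1/\<theta>))\<close>.\<close>

definition omega_product :: "'a::field fls fps" where
  "omega_product =
     coeffwise_lim (\<lambda>N. \<Prod>i<N. inverse (1 - fps_const (inverse (theta ^ (CARD('a) ^ i))) * fps_X))"

definition series_to_ac :: "'a::field fls fps \<Rightarrow> 'a fls alg_closure fps" where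
  "series_to_ac f = Abs_fps (\<lambda>i. to_ac (fps_nth f i))"

definition omega :: "'a::field fls alg_closure \<Rightarrow> 'a fls alg_closure fps" where
  "omega lam = fps_const lam * series_to_ac omega_product"

definition B_plus :: "'a::field fls alg_closure \<Rightarrow> nat \<Rightarrow> 'a fls fps set" where
  "B_plus lam n =
     (if (CARD('a) - 1) dvd n
      then {f. \<exists>a. series_to_ac f = series_to_ac (series_of_poly_t a) * omega lam ^ n}
      else {0})"


section \<open>Expansions at \<open>t = \<theta>\<close>\<close>

text \<open>Substitution of \<open>t = \<theta> + (t - \<theta>)\<close> in a power series in \<open>t\<close> that converges on a disc of
  radius greater than \<open>|\<theta>|\<close>.\<close>

definition taylor_at_theta :: "'a::field fls fps \<Rightarrow> 'a fls fps" where
  "taylor_at_theta g =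
     coeffwise_lim (\<lambda>N. \<Sum>i<N. fps_const (fps_nth g i) * (fps_const theta + fps_X) ^ i)"

text \<open>Laurent expansion of (the meromorphic continuation of) \<open>f\<close>, when \<open>(t - \<theta>)\<^sup>n f\<close> converges on a
  disc of radius greater than \<open>|\<theta>|\<close>, i.e. the pole of \<open>f\<close> at \<open>\<theta>\<close> has order at most \<open>n\<close>.\<close>

definition laurent_at_theta :: "nat \<Rightarrow> 'a::field fls fps \<Rightarrow> 'a fls fls" where
  "laurent_at_theta n f =
     fls_X_intpow (- int n) * fps_to_fls (taylor_at_theta (t_minus_theta ^ n * f))"

text \<open>The embedding of \<open>\<bbbF>((1/t))\<close> into \<open>\<bbbF>((1/\<theta>))[[t - \<theta>]]\<close>, where
  \<open>\<Sum>\<^sub>k c\<^sub>k t\<^sup>-\<^sup>k \<mapsto> \<Sum>\<^sub>k c\<^sub>k (\<theta> + (t - \<theta>))\<^sup>-\<^sup>k\<close>.\<close>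

definition expand_at_theta :: "'a::field fls \<Rightarrow> 'a fls fps" where
  "expand_at_theta c =
     coeffwise_lim (\<lambda>N. \<Sum>k = - int N..int N.
        fps_const (fls_const (fls_nth c k)) * (fps_const theta + fps_X) powi (- k))"


section \<open>The regulator of the Carlitz twist\<close>

abbreviation Ft :: "'a::field poly ring" where
  "Ft \<equiv> ring_of_type_algebra"

abbreviation K_infty :: "'a::field fls ring" where
  "K_infty \<equiv> ring_of_type_algebra"

definition ext_numerator :: "nat \<Rightarrow> ('a::field poly, 'a fls fps) module" where
  "ext_numerator n =
     \<lparr>carrier = {\<xi> \<in> tate_algebra. frob_twist \<xi> - t_minus_theta ^ n * \<xi> \<in> poly_theta_t},
      monoid.mult = undefined, one = undefined, zero = 0, add = (+),
      module.smult = (\<lambda>a \<xi>. series_of_poly_t a * \<xi>)\<rparr>"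

definition ext_denominator :: "'a::field fls alg_closure \<Rightarrow> nat \<Rightarrow> 'a fls fps set" where
  "ext_denominator lam n = {b + r | b r. b \<in> B_plus lam n \<and> r \<in> poly_theta_t}"

definition ext_reg ::
  "'a::field fls alg_closure \<Rightarrow> nat \<Rightarrow> ('a poly, 'a fls fps set) module" where
  "ext_reg lam n = quot_module (ext_numerator n) (ext_denominator lam n)"

definition hodge_pink_numerator :: "nat \<Rightarrow> ('a::field fls, 'a fls fls) module" where
  "hodge_pink_numerator n =
     \<lparr>carrier = range (\<lambda>g. fls_X_intpow (- int n) * fps_to_fls g),
      monoid.mult = undefined, one = undefined, zero = 0, add = (+),
      module.smult = (\<lambda>c h. fps_to_fls (expand_at_theta c) * h)\<rparr>"

text \<open>Since \<open>B\<^sup>+\<close> is cyclic over \<open>\<bbbF>[t]\<close>, every element of \<open>B\<^sup>+ \<otimes> K\<^sub>\<infinity>\<close> is a pure tensor.\<close>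

definition hodge_pink_denominator :: "'a::field fls alg_closure \<Rightarrow> nat \<Rightarrow> 'a fls fls set" where
  "hodge_pink_denominator lam n =
     {fps_to_fls (expand_at_theta c) * laurent_at_theta n b + fps_to_fls g | c b g.
        b \<in> B_plus lam n}"

definition ext_hodge_pink ::
  "'a::field fls alg_closure \<Rightarrow> nat \<Rightarrow> ('a fls, 'a fls fls set) module" where
  "ext_hodge_pink lam n = quot_module (hodge_pink_numerator n) (hodge_pink_denominator lam n)"

definition regulator_source ::
  "'a::field fls alg_closure \<Rightarrow> nat \<Rightarrow> ('a fls, ('a fls fps set \<times> 'a fls \<Rightarrow>\<^sub>0 int) set) module" where
  "regulator_source lam n = base_change Ft inf_of_poly K_infty (ext_reg lam n)"

definition regulator ::
  "'a::field fls alg_closure \<Rightarrow> nat \<Rightarrow> ('a fls fps set \<times> 'a fls \<Rightarrow>\<^sub>0 int) set \<Rightarrow> 'a fls fls set" where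
  "regulator lam n =
     base_change_lift (ext_hodge_pink lam n)
       (quot_lift (\<lambda>\<xi>. hodge_pink_denominator lam n +>\<^bsub>hodge_pink_numerator n\<^esub> laurent_at_theta n \<xi>))"

end

(* Let L = F((1/theta)). For f in F[theta,t] of degree less than n in theta there is a unique xi
   with coefficients of negative degree in theta such that xi^(1) - (t - theta)^n xi = f, and
   subtracting from an arbitrary xi its polynomial part in theta brings it into this form. Hence,
   modulo F[theta,t] and before dividing by B^+, the integral motivic cohomology is free over F[t]
   on the solutions xi_d for f = (t - theta)^d, d < n. Since (t - theta)^n xi_d is
   xi_d^(1) - (t - theta)^d and xi_d^(1) is small, the polar parts of the xi_d at t = theta are a small
   perturbation of the K_infty-basis (t - theta)^(d - n) of (t - theta)^(-n) L[[t - theta]] / L[[t - theta]],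
   and so form a basis themselves. Dividing by B^+ imposes the same relations on both sides: a generator
   of B^+ is itself a combination of the xi_d over F[t] modulo F[theta,t]. *)

theory Submission
  imports
    Defs
    "HOL-Algebra.Sylow"
    "Jordan_Normal_Form.Determinant"
begin

no_notation Matrix.vec_index (infixl "$" 100)
no_notation Matrix.index_mat (infixl "$$" 100)
unbundle fps_syntax

section \<open>Valuations and limits of Laurent series\<close>

text \<open>Smallness has to be measured so that it survives both the substitution
  \<open>t = \<theta> + X\<close> and multiplication by \<open>K_infty\<close>. The Gauss valuation
  that gives the variable the size of \<open>theta\<close> does this: \<open>theta\<close> and
  \<open>theta_plus_X\<close> both have valuation -1, and the expansion of an element of
  \<open>K_infty\<close> has at least the valuation of that element, with the element itself as
  constant term. Hence power series modulo \<open>X^n\<close> have dimension \<open>n\<close> over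
  \<open>K_infty\<close>, and leading-term arguments can be run with coefficients in that field.
  Independence of the polar parts is such an argument; that they span then follows because a square
  matrix with trivial kernel is invertible.

  A basic solution is only known to be bounded on \<open>|t| < |\<theta>|\<close>. It passes
  \<open>\<theta>\<close> by way of its equation: Frobenius at least doubles positive valuations, so
  the twist converges at \<open>\<theta>\<close>.

  The tensor product is a quotient of formal sums by relations, so no basis of the source is at
  hand. Formal sums are brought to the shape \<open>\<Sum> e_d \<otimes> c_d\<close>, and
  independence in the target then shows which of these are relations.\<close>

definition val_ge :: "'a::zero fls \<Rightarrow> int \<Rightarrow> bool" where
  "val_ge x m \<longleftrightarrow> (\<forall>k<m. x $$ k = 0)"

text \<open>Lower bounds replace the valuation itself because \<open>fls_subdegree 0 = 0\<close>
  would make 0 an exception everywhere.\<close>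

lemma val_ge_iff_subdegree: "val_ge x m \<longleftrightarrow> x = 0 \<or> m \<le> fls_subdegree x"
  unfolding val_ge_def
  by (metis fls_eq0_below_subdegree fls_zero_nth linorder_not_less nth_fls_subdegree_nonzero order_less_le_trans)

lemma val_ge_0 [simp]: "val_ge 0 m"
  by (simp add: val_ge_def)

lemma val_ge_subdegree [simp]: "val_ge x (fls_subdegree x)"
  by (simp add: val_ge_iff_subdegree)

lemma val_ge_mono: "val_ge x m \<Longrightarrow> k \<le> m \<Longrightarrow> val_ge x k"
  by (simp add: val_ge_def)

lemma val_ge_add: "val_ge x m \<Longrightarrow> val_ge y m \<Longrightarrow> val_ge (x + y :: 'a::monoid_add fls) m"
  by (simp add: val_ge_def)

lemma val_ge_diff: "val_ge x m \<Longrightarrow> val_ge y m \<Longrightarrow> val_ge (x - y :: 'a::group_add fls) m"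
  by (simp add: val_ge_def)

lemma val_ge_uminus [simp]: "val_ge (- x :: 'a::group_add fls) m \<longleftrightarrow> val_ge x m"
  by (simp add: val_ge_def)

lemma val_ge_sum: "(\<And>i. i \<in> I \<Longrightarrow> val_ge (f i) m) \<Longrightarrow> val_ge (\<Sum>i\<in>I. f i :: 'a::comm_monoid_add fls) m"
  by (induction I rule: infinite_finite_induct) (auto intro: val_ge_add)

lemma val_ge_mult:
  assumes "val_ge (x :: 'a::field fls) m" "val_ge y k"
  shows "val_ge (x * y) (m + k)"
  using assms unfolding val_ge_iff_subdegree by (cases "x = 0"; cases "y = 0") auto

lemma val_ge_power:
  "val_ge x m \<Longrightarrow> val_ge (x ^ k :: 'a::field fls) (int k * m)"
proof (induction k)
  case 0
  then show ?case by (simp add: val_ge_iff_subdegree)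
next
  case (Suc k)
  then show ?case using val_ge_mult[of x m "x ^ k" "int k * m"] by (simp add: algebra_simps)
qed

lemma val_ge_const [simp]: "val_ge (fls_const c) 0"
  by (simp add: val_ge_def)

lemma val_ge_one [simp]: "val_ge (1 :: 'a::{zero,one} fls) 0"
  by (simp add: val_ge_def)

lemma val_ge_theta [simp]: "val_ge (theta :: 'a::field fls) (- 1)"
  by (simp add: val_ge_def)

lemma eq_0_if_val_ge_all: "(\<And>m. val_ge x (int m)) \<Longrightarrow> x = 0"
proof (rule fls_eqI)
  fix k assume "\<And>m. val_ge x (int m)"
  from this[of "nat (k + 1)"] show "x $$ k = 0 $$ k" by (simp add: val_ge_def)
qed

text \<open>The \<open>+ 1\<close> comes from the strict inequality, as distances are powers of 2. A
  negative subdegree means a distance above 1, and then both sides are false.\<close>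

lemma dist_fls_less_iff:
  "dist (x :: 'a::group_add fls) y < inverse (2 ^ m) \<longleftrightarrow> val_ge (x - y) (int m + 1)"
proof (cases "x = y \<or> fls_subdegree (x - y) < 0")
  case True
  have "\<not> (2::real) ^ k < inverse (2 ^ m)" for k :: nat
  proof -
    have "inverse (2 ^ m) \<le> (1::real)" by (simp add: inverse_le_1_iff)
    moreover have "(1::real) \<le> 2 ^ k" by simp
    ultimately show ?thesis by linarith
  qed
  with True show ?thesis
    by (auto simp: dist_fls_def val_ge_iff_subdegree)
next
  case False
  hence "dist x y = inverse (2 ^ nat (fls_subdegree (x - y)))"
    by (simp add: dist_fls_def)
  with False show ?thesis
    by (auto simp: val_ge_iff_subdegree nat_less_iff zless_nat_eq_int_zless)
qed

section \<open>Limits in the \<open>1/theta\<close>-adic topology\<close>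

lemma tendsto_fls_iff:
  "S \<longlonglongrightarrow> l \<longleftrightarrow> (\<forall>m. \<forall>\<^sub>F i in sequentially. val_ge (S i - l :: 'a::group_add fls) m)"
proof
  assume S: "S \<longlonglongrightarrow> l"
  show "\<forall>m. \<forall>\<^sub>F i in sequentially. val_ge (S i - l) m"
  proof
    fix m
    have "\<forall>\<^sub>F i in sequentially. dist (S i) l < inverse (2 ^ nat m)"
      using S by (rule tendstoD) simp
    thus "\<forall>\<^sub>F i in sequentially. val_ge (S i - l) m"
      unfolding dist_fls_less_iff by eventually_elim (auto elim: val_ge_mono)
  qed
next
  assume S: "\<forall>m. \<forall>\<^sub>F i in sequentially. val_ge (S i - l) m"
  show "S \<longlonglongrightarrow> l"
  proof (rule tendstoI)
    fix e :: real assume "e > 0"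
    then obtain m where m: "inverse (2 ^ m) < e"
      using real_arch_pow_inv[of e "1/2"] by (auto simp: power_one_over inverse_eq_divide)
    have "\<forall>\<^sub>F i in sequentially. val_ge (S i - l) (int m + 1)" using S by blast
    thus "\<forall>\<^sub>F i in sequentially. dist (S i) l < e"
      unfolding dist_fls_less_iff[symmetric] by eventually_elim (use m in simp)
  qed
qed

lemma val_ge_lim:
  assumes "S \<longlonglongrightarrow> (l :: 'a::group_add fls)" "\<And>i. val_ge (S i) m"
  shows "val_ge l m"
proof -
  from assms(1) have "\<forall>\<^sub>F i in sequentially. val_ge (S i - l) m"
    by (simp add: tendsto_fls_iff)
  then obtain i where "val_ge (S i - l) m"
    by (auto simp: eventually_sequentially)
  with assms(2)[of i] show ?thesis by (simp add: val_ge_def)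
qed

lemma tendsto_mult_left_fls:
  assumes "S \<longlonglongrightarrow> (l :: 'a::field fls)"
  shows "(\<lambda>i. c * S i) \<longlonglongrightarrow> c * l"
  unfolding tendsto_fls_iff
proof
  fix m
  have "\<forall>\<^sub>F i in sequentially. val_ge (S i - l) (m - fls_subdegree c)"
    using assms by (simp add: tendsto_fls_iff)
  thus "\<forall>\<^sub>F i in sequentially. val_ge (c * S i - c * l) m"
  proof eventually_elim
    case (elim i)
    from val_ge_mult[OF val_ge_subdegree elim, of c] show ?case
      by (simp add: algebra_simps)
  qed
qed

lemma tendsto_add_fls:
  assumes "S \<longlonglongrightarrow> (l :: 'a::ab_group_add fls)" "Y \<longlonglongrightarrow> k"
  shows "(\<lambda>i. S i + Y i) \<longlonglongrightarrow> l + k"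
  unfolding tendsto_fls_iff
proof
  fix m
  have "\<forall>\<^sub>F i in sequentially. val_ge (S i - l) m" "\<forall>\<^sub>F i in sequentially. val_ge (Y i - k) m"
    using assms by (simp_all add: tendsto_fls_iff)
  thus "\<forall>\<^sub>F i in sequentially. val_ge (S i + Y i - (l + k)) m"
    by eventually_elim (use val_ge_add in \<open>force simp: algebra_simps\<close>)
qed

lemma tendsto_sum_fls:
  "(\<And>j. j \<in> J \<Longrightarrow> S j \<longlonglongrightarrow> (l j :: 'a::ab_group_add fls))
    \<Longrightarrow> (\<lambda>i. \<Sum>j\<in>J. S j i) \<longlonglongrightarrow> (\<Sum>j\<in>J. l j)"
  by (induction J rule: infinite_finite_induct) (auto intro: tendsto_add_fls)

text \<open>In an ultrametric, successive differences tending to 0 already make a Cauchy sequence.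
  Each coefficient stabilises, and the limit collects the stable values.\<close>

lemma fls_convergentI:
  fixes S :: "nat \<Rightarrow> 'a::ab_group_add fls"
  assumes "\<And>m. \<forall>\<^sub>F N in sequentially. val_ge (S (Suc N) - S N) m"
  shows "convergent S"
proof -
  have "\<exists>N0. \<forall>N\<ge>N0. val_ge (S N - S N0) m" for m
  proof -
    from assms[of m] obtain N0 where N0: "\<And>N. N \<ge> N0 \<Longrightarrow> val_ge (S (Suc N) - S N) m"
      by (auto simp: eventually_sequentially)
    have "val_ge (S N - S N0) m" if "N \<ge> N0" for N
      using that
    proof (induction N rule: dec_induct)
      case (step N)
      from val_ge_add[OF N0[OF step(1)] step.IH] show ?case by simp
    qed simp
    thus ?thesis by blast
  qed
  then obtain N0 where N0: "\<And>m N. N \<ge> N0 m \<Longrightarrow> val_ge (S N - S (N0 m)) m"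
    by metis
  have stable: "S N $$ k = S (N0 m) $$ k" if "N \<ge> N0 m" "k < m" for N m k
    using N0[OF that(1)] that(2) by (simp add: val_ge_def)
  define l where "l = Abs_fls (\<lambda>k. S (N0 (k + 1)) $$ k)"
  have l: "l $$ k = S (N0 (k + 1)) $$ k" for k
    unfolding l_def
  proof (rule nth_Abs_fls_lower_bound, intro allI impI)
    \<comment> \<open>\<open>N0 0\<close> controls all negative degrees at once, so the pole order
      of \<open>S (N0 0)\<close> bounds that of the limit.\<close>
    fix k assume k: "k < min 0 (fls_subdegree (S (N0 0)))"
    let ?M = "max (N0 0) (N0 (k + 1))"
    have "S (N0 (k + 1)) $$ k = S ?M $$ k" "S (N0 0) $$ k = S ?M $$ k"
      using stable[of "k + 1" ?M k] stable[of 0 ?M k] k by simp_all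
    thus "S (N0 (k + 1)) $$ k = 0" using k by simp
  qed
  have "val_ge (S N - l) m" if "N \<ge> N0 m" for N m
    unfolding val_ge_def
  proof (intro allI impI)
    fix k assume k: "k < m"
    let ?M = "max (N0 m) (N0 (k + 1))"
    have "S (N0 (k + 1)) $$ k = S ?M $$ k" "S (N0 m) $$ k = S ?M $$ k" "S N $$ k = S (N0 m) $$ k"
      using stable[of "k + 1" ?M k] stable[of m ?M k] stable[of m N k] k that by simp_all
    thus "(S N - l) $$ k = 0" by (simp add: l)
  qed
  hence "S \<longlonglongrightarrow> l"
    unfolding tendsto_fls_iff eventually_sequentially by blast
  thus ?thesis by (auto simp: convergent_def)
qed


section \<open>Coefficientwise convergence\<close>

definition coeffwise_tendsto :: "(nat \<Rightarrow> 'a::field fls fps) \<Rightarrow> 'a fls fps \<Rightarrow> bool" where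
  "coeffwise_tendsto S f \<longleftrightarrow> (\<forall>j. (\<lambda>N. S N $ j) \<longlonglongrightarrow> f $ j)"

lemma coeffwise_lim_eq: "coeffwise_tendsto S f \<Longrightarrow> coeffwise_lim S = f"
  by (rule fps_ext) (simp add: coeffwise_lim_def coeffwise_tendsto_def limI)

lemma coeffwise_tendsto_unique: "coeffwise_tendsto S f \<Longrightarrow> coeffwise_tendsto S g \<Longrightarrow> f = g"
  using coeffwise_lim_eq by metis

lemma coeffwise_tendsto_Suc: "coeffwise_tendsto (\<lambda>N. S (Suc N)) f \<longleftrightarrow> coeffwise_tendsto S f"
proof -
  have "(\<lambda>N. S (Suc N) $ j) \<longlonglongrightarrow> f $ j \<longleftrightarrow> (\<lambda>N. S N $ j) \<longlonglongrightarrow> f $ j" for j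
    using filterlim_sequentially_Suc[of "\<lambda>N. S N $ j"] .
  thus ?thesis by (simp add: coeffwise_tendsto_def)
qed

lemma coeffwise_tendsto_add:
  "coeffwise_tendsto S f \<Longrightarrow> coeffwise_tendsto R g \<Longrightarrow> coeffwise_tendsto (\<lambda>N. S N + R N) (f + g)"
  by (simp add: coeffwise_tendsto_def tendsto_add_fls)

lemma coeffwise_tendsto_const: "coeffwise_tendsto (\<lambda>N. f) f"
  by (simp add: coeffwise_tendsto_def)

lemma coeffwise_tendsto_mult_left:
  "coeffwise_tendsto S f \<Longrightarrow> coeffwise_tendsto (\<lambda>N. c * S N) (c * f)"
  by (auto simp: coeffwise_tendsto_def fps_mult_nth intro!: tendsto_sum_fls tendsto_mult_left_fls)

lemma coeffwise_tendsto_ex: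
  assumes "\<And>j m. \<forall>\<^sub>F N in sequentially. val_ge ((S (Suc N) - S N) $ j) m"
  shows "\<exists>f. coeffwise_tendsto S f"
proof -
  have "convergent (\<lambda>N. S N $ j)" for j
    using assms[of j] by (intro fls_convergentI) simp
  then obtain l where "\<And>j. (\<lambda>N. S N $ j) \<longlonglongrightarrow> l j"
    unfolding convergent_def by metis
  hence "coeffwise_tendsto S (Abs_fps l)" by (simp add: coeffwise_tendsto_def)
  thus ?thesis ..
qed


section \<open>Two valuations on series with coefficients in the base field at infinity\<close>

text \<open>The valuation of the supremum norm on the unit disc in \<open>t\<close>. The bound
  \<open>1\<close> says that all coefficients have negative degree in \<open>theta\<close>, the
  bound \<open>1 - int n\<close> that a polynomial has degree less than \<open>n\<close> in
  \<open>theta\<close>.\<close>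

definition sup_val_ge :: "'a::field fls fps \<Rightarrow> int \<Rightarrow> bool" where
  "sup_val_ge f m \<longleftrightarrow> (\<forall>j. val_ge (f $ j) m)"

text \<open>The Gauss valuation for which the variable has the same size as \<open>\<theta>\<close>.\<close>

definition gauss_val_ge :: "'a::field fls fps \<Rightarrow> int \<Rightarrow> bool" where
  "gauss_val_ge f m \<longleftrightarrow> (\<forall>j. val_ge (f $ j) (m + int j))"

lemma sup_val_ge_mono: "sup_val_ge f m \<Longrightarrow> k \<le> m \<Longrightarrow> sup_val_ge f k"
  by (auto simp: sup_val_ge_def elim: val_ge_mono)

lemma sup_val_ge_add: "sup_val_ge f m \<Longrightarrow> sup_val_ge g m \<Longrightarrow> sup_val_ge (f + g) m"
  by (auto simp: sup_val_ge_def intro: val_ge_add)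

lemma sup_val_ge_diff: "sup_val_ge f m \<Longrightarrow> sup_val_ge g m \<Longrightarrow> sup_val_ge (f - g) m"
  by (auto simp: sup_val_ge_def intro: val_ge_diff)

lemma sup_val_ge_mult: "sup_val_ge f m \<Longrightarrow> sup_val_ge g k \<Longrightarrow> sup_val_ge (f * g) (m + k)"
  by (auto simp: sup_val_ge_def fps_mult_nth intro!: val_ge_sum val_ge_mult)

lemma sup_val_ge_1 [simp]: "sup_val_ge 1 0"
  by (simp add: sup_val_ge_def)

lemma sup_val_ge_power: "sup_val_ge f m \<Longrightarrow> sup_val_ge (f ^ k) (int k * m)"
proof (induction k)
  case (Suc k)
  then show ?case using sup_val_ge_mult[of f m "f ^ k" "int k * m"] by (simp add: algebra_simps)
qed simp

lemma sup_val_ge_sum: "(\<And>i. i \<in> I \<Longrightarrow> sup_val_ge (f i) m) \<Longrightarrow> sup_val_ge (\<Sum>i\<in>I. f i) m"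
  by (auto simp: sup_val_ge_def fps_sum_nth intro: val_ge_sum)

lemma gauss_val_ge_mono: "gauss_val_ge f m \<Longrightarrow> k \<le> m \<Longrightarrow> gauss_val_ge f k"
  unfolding gauss_val_ge_def by (meson add_right_mono val_ge_mono)

lemma gauss_val_ge_add: "gauss_val_ge f m \<Longrightarrow> gauss_val_ge g m \<Longrightarrow> gauss_val_ge (f + g) m"
  by (auto simp: gauss_val_ge_def intro: val_ge_add)

lemma gauss_val_ge_uminus [simp]: "gauss_val_ge (- f) m \<longleftrightarrow> gauss_val_ge f m"
  by (auto simp: gauss_val_ge_def)

lemma gauss_val_ge_0 [simp]: "gauss_val_ge 0 m"
  by (simp add: gauss_val_ge_def)

lemma gauss_val_ge_mult:
  assumes "gauss_val_ge f m" "gauss_val_ge g k"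
  shows "gauss_val_ge (f * g) (m + k)"
  unfolding gauss_val_ge_def fps_mult_nth
proof (intro allI val_ge_sum)
  fix j i :: nat assume "i \<in> {0..j}"
  moreover have "val_ge (f $ i * g $ (j - i)) ((m + int i) + (k + int (j - i)))"
    using assms by (intro val_ge_mult) (auto simp: gauss_val_ge_def)
  ultimately show "val_ge (f $ i * g $ (j - i)) (m + k + int j)"
    by (simp add: algebra_simps of_nat_diff)
qed

lemma gauss_val_ge_1 [simp]: "gauss_val_ge 1 0"
  by (auto simp: gauss_val_ge_def)

lemma gauss_val_ge_power: "gauss_val_ge f m \<Longrightarrow> gauss_val_ge (f ^ k) (int k * m)"
proof (induction k)
  case (Suc k)
  then show ?case using gauss_val_ge_mult[of f m "f ^ k" "int k * m"] by (simp add: algebra_simps)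
qed simp

lemma gauss_val_ge_sum:
  "(\<And>i. i \<in> I \<Longrightarrow> gauss_val_ge (f i) m) \<Longrightarrow> gauss_val_ge (\<Sum>i\<in>I. f i) m"
  by (auto simp: gauss_val_ge_def fps_sum_nth intro: val_ge_sum)

lemma gauss_val_ge_const: "val_ge c m \<Longrightarrow> gauss_val_ge (fps_const c) m"
  by (auto simp: gauss_val_ge_def)

lemma gauss_val_ge_X [simp]: "gauss_val_ge fps_X (- 1)"
  by (auto simp: gauss_val_ge_def fps_X_def)

lemma gauss_val_ge_lim:
  "coeffwise_tendsto S f \<Longrightarrow> (\<And>N. gauss_val_ge (S N) m) \<Longrightarrow> gauss_val_ge f m"
  unfolding coeffwise_tendsto_def gauss_val_ge_def by (blast intro: val_ge_lim)

section \<open>The Frobenius twist\<close>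

text \<open>Needed to apply the freshman's dream with exponent q. If a prime \<open>r\<close> other
  than the characteristic divided q, a Sylow \<open>r\<close>-subgroup of the additive group would
  contain some \<open>x \<noteq> 0\<close> killed by a power of \<open>r\<close>, and the
  characteristic would divide that power.\<close>

lemma finite_field_card_eq_CHAR_power:
  "\<exists>k. CARD('a::{field, finite}) = CHAR('a) ^ k"
proof (rule ccontr)
  assume *: "\<nexists>k. CARD('a) = CHAR('a) ^ k"
  have prime_CHAR: "prime CHAR('a)"
    using prime_CHAR_semidom[where ?'a = 'a] finite_imp_CHAR_pos[where ?'a = 'a] by simp
  define A where "A = add_monoid (ring_of_type_algebra :: 'a ring)"
  interpret A: group A
    unfolding A_def using abelian_group.a_group ring.is_abelian_group ring_from_type_algebra by metis
  have A_simps: "carrier A = UNIV" "x \<otimes>\<^bsub>A\<^esub> y = x + y" "\<one>\<^bsub>A\<^esub> = 0" for x y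
    by (simp_all add: A_def ring_of_type_algebra_def)
  have pow: "x [^]\<^bsub>A\<^esub> k = of_nat k * x" for x and k :: nat
    by (induction k) (simp_all add: A_simps algebra_simps)
  have card_pos: "CARD('a) > 0" by simp
  obtain r where r: "prime r" "r dvd CARD('a)" "r \<noteq> CHAR('a)"
  proof -
    have "\<exists>r\<in>prime_factors CARD('a). r \<noteq> CHAR('a)"
    proof (rule ccontr)
      assume "\<not> ?thesis"
      hence "prime_factors CARD('a) \<subseteq> {CHAR('a)}" by blast
      hence "(\<Prod>r\<in>prime_factors CARD('a). r ^ multiplicity r CARD('a))
              = (\<Prod>r\<in>{CHAR('a)}. r ^ multiplicity r CARD('a))"
        using card_pos by (intro prod.mono_neutral_left)
          (auto simp: prime_factors_multiplicity prime_CHAR)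
      moreover have "CARD('a) = (\<Prod>r\<in>prime_factors CARD('a). r ^ multiplicity r CARD('a))"
        using prod_prime_factors[of "CARD('a)"] card_pos by simp
      ultimately show False using * by auto
    qed
    with that show ?thesis by (auto simp: in_prime_factors_iff)
  qed
  obtain m where m: "CARD('a) = r ^ multiplicity r CARD('a) * m"
    using multiplicity_dvd[of r "CARD('a)"] by (elim dvdE)
  obtain H where H: "subgroup H A" "card H = r ^ multiplicity r CARD('a)"
    using sylow_thm[OF r(1) A.group_axioms, of "multiplicity r CARD('a)" m] m
    by (auto simp: Coset.order_def A_simps)
  have "multiplicity r CARD('a) > 0"
    using r card_pos by (simp add: prime_multiplicity_gt_zero_iff)
  hence "card H > 1"
    using H(2) one_less_power[OF prime_gt_1_nat[OF r(1)]] by (simp del: One_nat_def)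
  then obtain x where x: "x \<in> H" "x \<noteq> 0"
    by (metis card_le_Suc0_iff_eq card.infinite linorder_not_less not_one_less_zero One_nat_def)
  have "x [^]\<^bsub>A\<lparr>carrier := H\<rparr>\<^esub> Coset.order (A\<lparr>carrier := H\<rparr>) = \<one>\<^bsub>A\<lparr>carrier := H\<rparr>\<^esub>"
    using x(1) H(1) by (intro group.pow_order_eq_1 A.subgroup_imp_group) auto
  hence "of_nat (card H) * x = 0"
    by (simp add: Coset.order_def pow A_simps A.nat_pow_consistent[of x _ H, symmetric])
  hence "CHAR('a) dvd r ^ multiplicity r CARD('a)"
    using x(2) H(2) of_nat_eq_0_iff_char_dvd[where ?'a = 'a, of "card H"] by simp
  hence "CHAR('a) dvd r" using prime_CHAR prime_dvd_power by blast
  with r(1,3) prime_CHAR show False using primes_dvd_imp_eq by blast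
qed

text \<open>Multiplication by \<open>x\<close> permutes the nonzero elements; comparing their
  products gives the claim. It makes the twist fix F[t].\<close>

lemma finite_field_card_power_eq: "(x :: 'a::{field, finite}) ^ CARD('a) = x"
proof (cases "x = 0")
  case False
  have "x * (\<Prod>y\<in>UNIV-{0}. x * y) = x * x ^ (CARD('a) - 1) * \<Prod>(UNIV-{0})"
    by (simp add: prod.distrib mult_ac)
  also have "x * x ^ (CARD('a) - 1) = x ^ Suc (CARD('a) - 1)"
    by (rule power_Suc[symmetric])
  also have "Suc (CARD('a) - 1) = CARD('a)" by simp
  also have "(\<Prod>y\<in>UNIV-{0}. x * y) = (\<Prod>y\<in>UNIV-{0}. y)"
    by (rule prod.reindex_bij_witness[of _ "\<lambda>y. y / x" "\<lambda>y. x * y"]) (use False in auto)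
  finally show ?thesis by simp
qed simp

lemma card_field_ge_2: "CARD('a::{field, finite}) \<ge> 2"
proof -
  have "card {0, 1 :: 'a} \<le> CARD('a)" by (rule card_mono) auto
  thus ?thesis by simp
qed

lemma fls_power_card_sum:
  "(\<Sum>i\<in>I. f i :: 'a::{field, finite} fls) ^ CARD('a) = (\<Sum>i\<in>I. f i ^ CARD('a))"
proof -
  have "prime CHAR('a fls)"
    using prime_CHAR_semidom[where ?'a = 'a] finite_imp_CHAR_pos[where ?'a = 'a] by simp
  moreover obtain k where "CARD('a) = CHAR('a fls) ^ k"
    using finite_field_card_eq_CHAR_power[where ?'a = 'a] by auto
  ultimately show ?thesis by (rule freshmans_dream_sum')
qed

lemma fls_power_card_add: "(x + y :: 'a::{field, finite} fls) ^ CARD('a) = x ^ CARD('a) + y ^ CARD('a)"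
proof -
  have "prime CHAR('a fls)"
    using prime_CHAR_semidom[where ?'a = 'a] finite_imp_CHAR_pos[where ?'a = 'a] by simp
  moreover obtain k where "CARD('a) = CHAR('a fls) ^ k"
    using finite_field_card_eq_CHAR_power[where ?'a = 'a] by auto
  ultimately show ?thesis by (rule freshmans_dream')
qed

section \<open>The twist as a continuous ring endomorphism\<close>

lemma frob_twist_nth [simp]: "frob_twist f $ j = (f $ j) ^ CARD('a)" for f :: "'a::field fls fps"
  by (simp add: frob_twist_def)

lemma frob_twist_add: "frob_twist (f + g) = frob_twist f + frob_twist g"
  for f g :: "'a::{field, finite} fls fps"
  by (rule fps_ext) (simp add: fls_power_card_add)

lemma frob_twist_0 [simp]: "frob_twist 0 = (0 :: 'a::{field, finite} fls fps)"
  by (rule fps_ext) (simp add: zero_power)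

lemma frob_twist_diff: "frob_twist (f - g) = frob_twist f - frob_twist g"
  for f g :: "'a::{field, finite} fls fps"
  using frob_twist_add[of "f - g" g] by simp

lemma frob_twist_mult: "frob_twist (f * g) = frob_twist f * frob_twist g"
  for f g :: "'a::{field, finite} fls fps"
  by (rule fps_ext) (simp add: fps_mult_nth fls_power_card_sum power_mult_distrib)

lemma frob_twist_const: "frob_twist (fps_const c) = fps_const (c ^ CARD('a))"
  for c :: "'a::{field, finite} fls"
  by (rule fps_ext) (simp add: zero_power)

lemma frob_twist_1 [simp]: "frob_twist 1 = (1 :: 'a::{field, finite} fls fps)"
  using frob_twist_const[of 1] by simp

lemma frob_twist_X [simp]: "frob_twist fps_X = (fps_X :: 'a::{field, finite} fls fps)"
  by (rule fps_ext) (simp add: fps_X_def zero_power)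

lemma frob_twist_power: "frob_twist (f ^ k) = frob_twist f ^ k"
  for f :: "'a::{field, finite} fls fps"
  by (induction k) (simp_all add: frob_twist_mult)

lemma frob_twist_inverse:
  fixes f :: "'a::{field, finite} fls fps"
  assumes "f $ 0 \<noteq> 0"
  shows "frob_twist (inverse f) = inverse (frob_twist f)"
proof -
  have "frob_twist f * frob_twist (inverse f) = 1"
    using assms by (simp add: inverse_mult_eq_1' flip: frob_twist_mult)
  thus ?thesis using fps_inverse_unique by metis
qed

lemma frob_twist_series_of_poly_t [simp]:
  "frob_twist (series_of_poly_t a) = series_of_poly_t (a :: 'a::{field, finite} poly)"
  by (rule fps_ext)
    (simp add: series_of_poly_t_def coeff_map_poly finite_field_card_power_eq flip: fls_const_power)

lemma coeffwise_tendsto_frob_twist: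
  assumes "coeffwise_tendsto S (f :: 'a::{field, finite} fls fps)"
  shows "coeffwise_tendsto (\<lambda>N. frob_twist (S N)) (frob_twist f)"
  unfolding coeffwise_tendsto_def tendsto_fls_iff
proof (intro allI)
  fix j m
  \<comment> \<open>The absolute value ensures that multiplying the bound by q does not lower
    it.\<close>
  have "\<forall>\<^sub>F N in sequentially. val_ge (S N $ j - f $ j) \<bar>m\<bar>"
    using assms by (simp add: coeffwise_tendsto_def tendsto_fls_iff)
  thus "\<forall>\<^sub>F N in sequentially. val_ge (frob_twist (S N) $ j - frob_twist f $ j) m"
  proof eventually_elim
    case (elim N)
    have "m \<le> int CARD('a) * \<bar>m\<bar>"
      using mult_right_mono[of 1 "int CARD('a)" "\<bar>m\<bar>"] card_field_ge_2[where ?'a = 'a] by simp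
    moreover have "frob_twist (S N) $ j - frob_twist f $ j = (S N $ j - f $ j) ^ CARD('a)"
      using arg_cong[OF frob_twist_diff[of "S N" f], of "\<lambda>h. h $ j"] by simp
    ultimately show ?case using val_ge_power[OF elim] val_ge_mono by metis
  qed
qed

lemma val_ge_power_card:
  assumes "val_ge (x :: 'a::{field, finite} fls) m" "m \<ge> 0"
  shows "val_ge (x ^ CARD('a)) (2 * m)"
  using assms card_field_ge_2[where ?'a = 'a]
  by (intro val_ge_mono[OF val_ge_power[OF assms(1)]] mult_right_mono) auto

text \<open>Frobenius at least doubles the bound \<open>m + int j\<close>, and
  \<open>2 * (m + int j) \<ge> m + 1 + int j\<close> as soon as \<open>m \<ge> 1\<close>. This gain
  of 1 drives the iteration that produces the basic solutions.\<close>

lemma gauss_val_ge_frob_twist: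
  assumes "gauss_val_ge (f :: 'a::{field, finite} fls fps) m" "m \<ge> 1"
  shows "gauss_val_ge (frob_twist f) (m + 1)"
  unfolding gauss_val_ge_def
proof
  fix j
  have "val_ge ((f $ j) ^ CARD('a)) (2 * (m + int j))"
    using assms by (intro val_ge_power_card) (auto simp: gauss_val_ge_def)
  thus "val_ge (frob_twist f $ j) (m + 1 + int j)"
    using assms(2) by (auto elim!: val_ge_mono)
qed


section \<open>Substitution of \<open>t = \<theta> + (t - \<theta>)\<close>\<close>

abbreviation theta_plus_X :: "'a::field fls fps" where
  "theta_plus_X \<equiv> fps_const theta + fps_X"

text \<open>Convergence on the closed disc \<open>|t| \<le> |\<theta>|\<close>. As
  \<open>theta_plus_X\<close> has Gauss valuation -1, this is what makes the terms of the
  substituted series tend to 0.\<close>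

definition taylor_convergent :: "'a::field fls fps \<Rightarrow> bool" where
  "taylor_convergent g \<longleftrightarrow> (\<forall>m. \<forall>\<^sub>F i in sequentially. val_ge (g $ i) (m + int i))"

definition taylor_partial :: "'a::field fls fps \<Rightarrow> nat \<Rightarrow> 'a fls fps" where
  "taylor_partial g N = (\<Sum>i<N. fps_const (g $ i) * theta_plus_X ^ i)"

lemma gauss_val_ge_theta_plus_X [simp]: "gauss_val_ge theta_plus_X (- 1)"
  by (intro gauss_val_ge_add gauss_val_ge_const) simp_all

lemma gauss_val_ge_taylor_term:
  "val_ge c (m + int i) \<Longrightarrow> gauss_val_ge (fps_const c * theta_plus_X ^ i) m"
  using gauss_val_ge_mult[OF gauss_val_ge_const gauss_val_ge_power[OF gauss_val_ge_theta_plus_X, of i], of c "m + int i"]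
  by simp

lemma coeffwise_tendsto_taylor:
  assumes "taylor_convergent g"
  shows "coeffwise_tendsto (taylor_partial g) (taylor_at_theta g)"
proof -
  have "\<exists>f. coeffwise_tendsto (taylor_partial g) f"
  proof (rule coeffwise_tendsto_ex)
    fix j m
    have "\<forall>\<^sub>F N in sequentially. val_ge (g $ N) (m + int N)"
      using assms by (simp add: taylor_convergent_def)
    thus "\<forall>\<^sub>F N in sequentially. val_ge ((taylor_partial g (Suc N) - taylor_partial g N) $ j) m"
    proof eventually_elim
      case (elim N)
      from gauss_val_ge_taylor_term[OF elim]
      have "val_ge ((fps_const (g $ N) * theta_plus_X ^ N) $ j) (m + int j)"
        unfolding gauss_val_ge_def ..
      moreover have "taylor_partial g (Suc N) - taylor_partial g N = fps_const (g $ N) * theta_plus_X ^ N"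
        by (simp add: taylor_partial_def)
      ultimately show ?case by (metis (no_types, lifting) val_ge_mono le_add_same_cancel1 of_nat_0_le_iff)
    qed
  qed
  then obtain f where f: "coeffwise_tendsto (taylor_partial g) f" ..
  moreover have "taylor_at_theta g = f"
    using coeffwise_lim_eq[OF f] by (simp add: taylor_at_theta_def taylor_partial_def[abs_def])
  ultimately show ?thesis by simp
qed

lemma taylor_at_theta_eqI:
  "taylor_convergent g \<Longrightarrow> coeffwise_tendsto (taylor_partial g) f \<Longrightarrow> taylor_at_theta g = f"
  using coeffwise_tendsto_taylor coeffwise_tendsto_unique by blast

lemma taylor_convergent_add:
  assumes "taylor_convergent f" "taylor_convergent g"
  shows "taylor_convergent (f + g)"
  unfolding taylor_convergent_def
proof
  fix m
  from assms have "\<forall>\<^sub>F i in sequentially. val_ge (f $ i) (m + int i)" "\<forall>\<^sub>F i in sequentially. val_ge (g $ i) (m + int i)"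
    unfolding taylor_convergent_def by blast+
  thus "\<forall>\<^sub>F i in sequentially. val_ge ((f + g) $ i) (m + int i)"
    by eventually_elim (simp add: val_ge_add)
qed

lemma taylor_at_theta_add:
  assumes "taylor_convergent f" "taylor_convergent g"
  shows "taylor_at_theta (f + g) = taylor_at_theta f + taylor_at_theta g"
proof (rule taylor_at_theta_eqI)
  have "taylor_partial (f + g) = (\<lambda>N. taylor_partial f N + taylor_partial g N)"
    by (auto simp: taylor_partial_def sum.distrib[symmetric] ring_distribs fun_eq_iff simp flip: fps_const_add)
  thus "coeffwise_tendsto (taylor_partial (f + g)) (taylor_at_theta f + taylor_at_theta g)"
    using assms by (simp add: coeffwise_tendsto_add coeffwise_tendsto_taylor)
qed (use assms in \<open>rule taylor_convergent_add\<close>)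

lemma taylor_convergent_const_mult:
  assumes "taylor_convergent f"
  shows "taylor_convergent (fps_const c * f)"
  unfolding taylor_convergent_def
proof
  fix m
  from assms have "\<forall>\<^sub>F i in sequentially. val_ge (f $ i) (m - fls_subdegree c + int i)"
    unfolding taylor_convergent_def by blast
  thus "\<forall>\<^sub>F i in sequentially. val_ge ((fps_const c * f) $ i) (m + int i)"
  proof eventually_elim
    case (elim i)
    from val_ge_mult[OF val_ge_subdegree elim, of c] show ?case by (simp add: algebra_simps)
  qed
qed

lemma taylor_at_theta_const_mult:
  assumes "taylor_convergent f"
  shows "taylor_at_theta (fps_const c * f) = fps_const c * taylor_at_theta f"
proof (rule taylor_at_theta_eqI)
  have "taylor_partial (fps_const c * f) = (\<lambda>N. fps_const c * taylor_partial f N)"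
    by (auto simp: taylor_partial_def sum_distrib_left fun_eq_iff mult_ac simp flip: fps_const_mult)
  thus "coeffwise_tendsto (taylor_partial (fps_const c * f)) (fps_const c * taylor_at_theta f)"
    using assms by (simp add: coeffwise_tendsto_mult_left coeffwise_tendsto_taylor)
qed (use assms in \<open>rule taylor_convergent_const_mult\<close>)

lemma taylor_convergent_X_mult:
  assumes "taylor_convergent f"
  shows "taylor_convergent (fps_X * f)"
  unfolding taylor_convergent_def
proof
  fix m
  from assms have "\<forall>\<^sub>F i in sequentially. val_ge (f $ i) (m + 1 + int i)"
    unfolding taylor_convergent_def by blast
  hence "\<forall>\<^sub>F i in sequentially. val_ge ((fps_X * f) $ Suc i) (m + int (Suc i))"
    by eventually_elim (simp add: algebra_simps)
  thus "\<forall>\<^sub>F i in sequentially. val_ge ((fps_X * f) $ i) (m + int i)"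
    using eventually_sequentially_Suc[of "\<lambda>i. val_ge ((fps_X * f) $ i) (m + int i)"] by blast
qed

lemma taylor_at_theta_X_mult:
  assumes "taylor_convergent f"
  shows "taylor_at_theta (fps_X * f) = theta_plus_X * taylor_at_theta f"
proof (rule taylor_at_theta_eqI)
  have "taylor_partial (fps_X * f) (Suc N) = theta_plus_X * taylor_partial f N" for N
    by (simp only: taylor_partial_def sum.lessThan_Suc_shift sum_distrib_left)
       (auto intro!: sum.cong simp: mult_ac)
  moreover have "coeffwise_tendsto (\<lambda>N. theta_plus_X * taylor_partial f N) (theta_plus_X * taylor_at_theta f)"
    using assms by (intro coeffwise_tendsto_mult_left coeffwise_tendsto_taylor)
  ultimately have "coeffwise_tendsto (\<lambda>N. taylor_partial (fps_X * f) (Suc N)) (theta_plus_X * taylor_at_theta f)"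
    by simp
  thus "coeffwise_tendsto (taylor_partial (fps_X * f)) (theta_plus_X * taylor_at_theta f)"
    by (simp only: coeffwise_tendsto_Suc)
qed (use assms in \<open>rule taylor_convergent_X_mult\<close>)

lemma taylor_convergent_0 [simp]: "taylor_convergent 0"
  by (simp add: taylor_convergent_def)

lemma taylor_convergent_1 [simp]: "taylor_convergent 1"
  unfolding taylor_convergent_def eventually_sequentially
proof (intro allI exI impI)
  fix m and i :: nat assume "i \<ge> 1"
  thus "val_ge ((1 :: 'a fls fps) $ i) (m + int i)" by simp
qed

lemma taylor_at_theta_1 [simp]: "taylor_at_theta 1 = (1 :: 'a::field fls fps)"
proof (rule taylor_at_theta_eqI)
  have "taylor_partial 1 (Suc N) = (1 :: 'a fls fps)" for N
    by (simp only: taylor_partial_def sum.lessThan_Suc_shift) simp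
  hence "coeffwise_tendsto (\<lambda>N. taylor_partial 1 (Suc N)) (1 :: 'a fls fps)"
    using coeffwise_tendsto_const[of "1 :: 'a fls fps"] by simp
  thus "coeffwise_tendsto (taylor_partial 1) (1 :: 'a fls fps)"
    by (simp only: coeffwise_tendsto_Suc)
qed simp

lemma taylor_at_theta_uminus:
  "taylor_convergent f \<Longrightarrow> taylor_convergent (- f) \<and> taylor_at_theta (- f) = - taylor_at_theta f"
proof -
  have *: "fps_const (- 1) * g = - g" for g :: "'a fls fps"
    by (metis fps_const_1_eq_1 fps_const_neg mult_minus1)
  assume "taylor_convergent f"
  from taylor_convergent_const_mult[OF this, of "- 1"] taylor_at_theta_const_mult[OF this, of "- 1"]
  show ?thesis unfolding * by blast
qed

lemma taylor_convergent_diff: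
  "taylor_convergent f \<Longrightarrow> taylor_convergent g \<Longrightarrow> taylor_convergent (f - g)"
  using taylor_convergent_add[of f "- g"] taylor_at_theta_uminus[of g] by simp

lemma taylor_at_theta_diff:
  "taylor_convergent f \<Longrightarrow> taylor_convergent g \<Longrightarrow>
    taylor_at_theta (f - g) = taylor_at_theta f - taylor_at_theta g"
  using taylor_at_theta_add[of f "- g"] taylor_at_theta_uminus[of g] by simp

lemma taylor_at_theta_0 [simp]: "taylor_at_theta 0 = (0 :: 'a::field fls fps)"
  using taylor_at_theta_diff[of "1 :: 'a fls fps" 1] by simp

text \<open>Substitution turns \<open>t - \<theta>\<close> into \<open>X\<close>. Only products with
  polynomials in \<open>t\<close> ever have to be expanded, and these reduce to multiplication by
  constants and by \<open>fps_X\<close>.\<close>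

lemma taylor_t_minus_theta_power_mult:
  assumes "taylor_convergent f"
  shows "taylor_convergent (t_minus_theta ^ k * f) \<and>
    taylor_at_theta (t_minus_theta ^ k * f) = fps_X ^ k * taylor_at_theta f"
proof (induction k)
  case (Suc k)
  let ?g = "t_minus_theta ^ k * f"
  have eq: "t_minus_theta ^ Suc k * f = fps_X * ?g - fps_const theta * ?g"
    by (simp add: algebra_simps)
  from Suc have "taylor_convergent ?g" by blast
  note conv = taylor_convergent_X_mult[OF this] taylor_convergent_const_mult[OF this, of theta]
    and vals = taylor_at_theta_X_mult[OF this] taylor_at_theta_const_mult[OF this, of theta]
  show ?case
    unfolding eq taylor_at_theta_diff[OF conv] vals using taylor_convergent_diff[OF conv] Suc
    by (simp add: algebra_simps)
qed (use assms in simp)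

text \<open>The reason for this Gauss valuation: \<open>t\<close> and \<open>theta_plus_X\<close>
  both have valuation at least -1, so the substitution loses nothing.\<close>

lemma gauss_val_ge_taylor_at_theta:
  assumes "taylor_convergent f" "gauss_val_ge f m"
  shows "gauss_val_ge (taylor_at_theta f) m"
proof (rule gauss_val_ge_lim[OF coeffwise_tendsto_taylor[OF assms(1)]])
  show "gauss_val_ge (taylor_partial f N) m" for N
    unfolding taylor_partial_def using assms(2)
    by (intro gauss_val_ge_sum gauss_val_ge_taylor_term) (simp add: gauss_val_ge_def)
qed

text \<open>The hypothesis gives boundedness for \<open>|t| < |\<theta>|\<close> only. After the
  twist the valuations are at least \<open>2 * (m + int i)\<close>, which outgrows
  \<open>int i\<close>, so the series converges at \<open>\<theta>\<close>.\<close>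

lemma taylor_convergent_frob_twist:
  assumes "gauss_val_ge (f :: 'a::{field, finite} fls fps) m"
  shows "taylor_convergent (frob_twist f)"
  unfolding taylor_convergent_def eventually_sequentially
proof (intro allI exI impI)
  fix k and i :: nat assume "i \<ge> nat (\<bar>k\<bar> + 2 * \<bar>m\<bar>)"
  hence i: "m + int i \<ge> 0" "k + int i \<le> 2 * (m + int i)" by auto
  from assms have "val_ge (f $ i) (m + int i)" unfolding gauss_val_ge_def ..
  from val_ge_power_card[OF this i(1)] i(2) show "val_ge (frob_twist f $ i) (k + int i)"
    by (auto elim: val_ge_mono)
qed

section \<open>The embedding of \<open>K\<^sub>\<infinity>\<close>\<close>

text \<open>Power series do not form a field; integer powers of units are transported to Laurent
  series, where the exponent laws are available.\<close>

lemma fps_to_fls_power_int: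
  fixes f :: "'b::field fps"
  assumes "f $ 0 \<noteq> 0"
  shows "fps_to_fls (f powi k) = fps_to_fls f powi k"
proof (cases "k \<ge> 0")
  case False
  have "fps_to_fls f * fps_to_fls (inverse f) = 1"
    using inverse_mult_eq_1'[OF assms] by (metis fls_times_fps_to_fls fps_one_to_fls)
  hence "fps_to_fls (inverse f) = inverse (fps_to_fls f)"
    using inverse_unique by metis
  with False show ?thesis by (simp add: power_int_def fps_to_fls_power)
qed (simp add: power_int_def fps_to_fls_power)

lemma fps_power_int_add:
  fixes f :: "'b::field fps"
  assumes "f $ 0 \<noteq> 0"
  shows "f powi (k + l) = f powi k * f powi l"
proof -
  have "fps_to_fls f \<noteq> 0" using assms by auto
  hence "fps_to_fls (f powi (k + l)) = fps_to_fls (f powi k * f powi l)"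
    using assms by (simp add: fps_to_fls_power_int fls_times_fps_to_fls power_int_add)
  thus ?thesis by simp
qed

text \<open>The binomial coefficient of \<open>- k\<close> over \<open>j\<close>, read in the field.
  Taken as a coefficient of a power series, it satisfies Vandermonde's identity by the exponent
  law.\<close>

definition neg_binom :: "int \<Rightarrow> nat \<Rightarrow> 'a::field" where
  "neg_binom k j = ((1 + fps_X) powi (- k)) $ j"

lemma neg_binom_0_right [simp]: "neg_binom k 0 = 1"
  by (simp add: neg_binom_def power_int_def fps_power_zeroth)

lemma neg_binom_0 [simp]: "neg_binom 0 j = (if j = 0 then 1 else 0)"
  by (simp add: neg_binom_def)

lemma neg_binom_minus_1 [simp]: "neg_binom (- 1) j = (if j \<le> 1 then 1 else 0)"
  by (auto simp: neg_binom_def fps_X_def)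

lemma neg_binom_add: "neg_binom (k + l) j = (\<Sum>i=0..j. neg_binom k i * neg_binom l (j - i) :: 'a::field)"
  using arg_cong[OF fps_power_int_add[of "1 + fps_X :: 'a fps" "- k" "- l"], of "\<lambda>f. f $ j"]
  by (simp add: neg_binom_def fps_mult_nth)

text \<open>The substitution of \<open>X / \<theta>\<close> for \<open>X\<close>, by which powers of
  \<open>theta_plus_X\<close>, that is of \<open>\<theta> (1 + X / \<theta>)\<close>, come from
  powers of \<open>1 + X\<close>.\<close>

definition scale_X :: "'a::field fps \<Rightarrow> 'a fls fps" where
  "scale_X g = Abs_fps (\<lambda>j. fls_const (g $ j) * fls_X ^ j)"

lemma scale_X_mult: "scale_X (f * g) = scale_X f * scale_X g"
proof (rule fps_ext)
  fix j
  have "fls_const (f $ i * g $ (j - i)) * fls_X ^ j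
      = fls_const (f $ i) * fls_X ^ i * (fls_const (g $ (j - i)) * fls_X ^ (j - i))" if "i \<le> j" for i
  proof -
    have "fls_X ^ j = fls_X ^ i * (fls_X ^ (j - i) :: 'a fls)"
      using that by (simp flip: power_add)
    thus ?thesis by (simp add: mult_ac flip: fls_const_mult_const)
  qed
  moreover have "fls_const (\<Sum>i=0..j. f $ i * g $ (j - i)) = (\<Sum>i=0..j. fls_const (f $ i * g $ (j - i)))"
    by (rule fls_eqI) (simp add: fls_nth_sum)
  ultimately show "scale_X (f * g) $ j = (scale_X f * scale_X g) $ j"
    by (simp add: scale_X_def fps_mult_nth sum_distrib_right)
qed

lemma scale_X_1 [simp]: "scale_X 1 = 1"
  by (rule fps_ext) (simp add: scale_X_def)

lemma scale_X_power: "scale_X (f ^ k) = scale_X f ^ k"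
  by (induction k) (simp_all add: scale_X_mult)

lemma scale_X_power_int:
  fixes f :: "'a::field fps"
  assumes "f $ 0 \<noteq> 0"
  shows "scale_X (f powi k) = scale_X f powi k"
proof (cases "k \<ge> 0")
  case False
  have "scale_X f * scale_X (inverse f) = 1"
    using inverse_mult_eq_1'[OF assms] by (metis scale_X_mult scale_X_1)
  hence "scale_X (inverse f) = inverse (scale_X f)"
    using fps_inverse_unique by metis
  with False show ?thesis by (simp add: power_int_def scale_X_power)
qed (simp add: power_int_def scale_X_power)

lemma theta_plus_X_power_int_nth:
  "(theta_plus_X powi (- k) :: 'a::field fls fps) $ j = fls_const (neg_binom k j) * fls_X_intpow (k + int j)"
proof -
  let ?f = "1 + fps_X :: 'a fps"
  have theta_X: "theta * fls_X = (1 :: 'a fls)"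
    by (subst fls_inverse_X[symmetric]) simp
  have "scale_X ?f = 1 + fps_const fls_X * fps_X"
    by (rule fps_ext) (auto simp: scale_X_def fps_X_def)
  hence "fps_const theta * scale_X ?f = fps_const theta + fps_const (theta * fls_X) * fps_X"
    by (simp only: distrib_left mult_1_right fps_const_mult[symmetric] mult.assoc)
  hence "theta_plus_X = fps_const theta * scale_X ?f"
    by (simp only: theta_X fps_const_1_eq_1 mult_1_left)
  moreover have nz: "scale_X ?f $ 0 \<noteq> 0" by (simp add: scale_X_def)
  moreover have "fps_to_fls ((fps_const theta * scale_X ?f) powi (- k))
      = fps_to_fls (fps_const theta * scale_X ?f) powi (- k)"
    by (rule fps_to_fls_power_int) (use nz in simp)
  ultimately have "fps_to_fls (theta_plus_X powi (- k))
      = (fls_const theta * fps_to_fls (scale_X ?f)) powi (- k)"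
    by (simp add: fls_times_fps_to_fls)
  also have "\<dots> = fls_const (theta powi (- k)) * fps_to_fls (scale_X ?f powi (- k))"
    by (simp only: power_int_mult_distrib fls_const_power_int fps_to_fls_power_int[OF nz])
  also have "scale_X ?f powi (- k) = scale_X (?f powi (- k))"
    by (subst scale_X_power_int) simp_all
  also have "theta powi (- k) = (fls_X powi k :: 'a fls)"
    by (simp only: fls_inverse_X[symmetric] power_int_inverse power_int_minus inverse_inverse_eq)
  finally have "fps_to_fls (theta_plus_X powi (- k))
      = fps_to_fls (fps_const (fls_X powi k) * scale_X (?f powi (- k)))"
    by (simp only: fls_times_fps_to_fls fps_const_to_fls)
  hence "theta_plus_X powi (- k) = fps_const (fls_X powi k) * scale_X (?f powi (- k))"
    by (simp only: fps_to_fls_eq_iff)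
  hence "(theta_plus_X powi (- k) :: 'a fls fps) $ j = fls_const (neg_binom k j) * (fls_X powi k * fls_X powi (int j))"
    by (simp only: scale_X_def fps_mult_left_const_nth fps_nth_Abs_fps neg_binom_def power_int_of_nat mult_ac)
  also have "fls_X powi k * fls_X powi (int j) = (fls_X powi (k + int j) :: 'a fls)"
    by (rule power_int_add[symmetric]) simp
  finally show ?thesis by (simp only: fls_X_power_int)
qed

text \<open>Coefficient \<open>j\<close> of the expansion is the Hasse derivative of order
  \<open>j\<close> of \<open>c\<close> with respect to \<open>theta\<close>: it sends
  \<open>\<theta>^(-k)\<close> to \<open>neg_binom k j\<close> times \<open>\<theta>^(-k-j)\<close>.
  The algebraic properties of the embedding are read off from this formula.\<close>

lemma expand_at_theta_nth:
  "expand_at_theta c $ j $$ m = neg_binom (m - int j) j * c $$ (m - int j)"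
proof -
  define E where "E = Abs_fps (\<lambda>j. Abs_fls (\<lambda>m. neg_binom (m - int j) j * c $$ (m - int j)))"
  have E: "E $ j $$ m = neg_binom (m - int j) j * c $$ (m - int j)" for j m
    unfolding E_def fps_nth_Abs_fps
    by (rule nth_Abs_fls_lower_bound[of "fls_subdegree c"]) auto
  define P where "P = (\<lambda>N. \<Sum>k = - int N..int N. fps_const (fls_const (c $$ k)) * theta_plus_X powi (- k))"
  have P: "P N $ j $$ m = (if m - int j \<in> {- int N..int N} then neg_binom (m - int j) j * c $$ (m - int j) else 0)"
    for N j m
  proof -
    have "P N $ j $$ m = (\<Sum>k = - int N..int N. c $$ k * (neg_binom k j * (if m + (- k - int j) = 0 then 1 else 0)))"
      by (simp add: P_def fps_sum_nth fls_nth_sum theta_plus_X_power_int_nth)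
    also have "\<dots> = (\<Sum>k = - int N..int N. if k = m - int j then c $$ k * neg_binom k j else 0)"
      by (rule sum.cong) auto
    finally show ?thesis by (simp add: mult_ac)
  qed
  have "coeffwise_tendsto P E"
    unfolding coeffwise_tendsto_def tendsto_fls_iff eventually_sequentially
  proof (intro allI exI impI)
    \<comment> \<open>Exponents of at least \<open>M\<close> do not matter, and below
      \<open>- \<bar>fls_subdegree c\<bar>\<close> the coefficients of \<open>c\<close> vanish, so
      the window from \<open>- int N\<close> to \<open>int N\<close> misses nothing.\<close>
    fix j M and N :: nat assume N: "nat (\<bar>M\<bar> + \<bar>fls_subdegree c\<bar>) \<le> N"
    show "val_ge (P N $ j - E $ j) M"
      unfolding val_ge_def
    proof (intro allI impI)
      fix m assume "m < M"
      hence "m - int j \<in> {- int N..int N} \<or> m - int j < fls_subdegree c"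
        using N by auto
      thus "(P N $ j - E $ j) $$ m = 0"
        by (auto simp: P E)
    qed
  qed
  hence "expand_at_theta c = E"
    unfolding expand_at_theta_def P_def[symmetric] by (rule coeffwise_lim_eq)
  thus ?thesis by (simp add: E)
qed

text \<open>Taking \<open>j\<close> Hasse derivatives divides by \<open>\<theta>^j\<close>, which is
  exactly the weight of \<open>X^j\<close>.\<close>

lemma gauss_val_ge_expand_at_theta: "val_ge c m \<Longrightarrow> gauss_val_ge (expand_at_theta c) m"
  by (auto simp: gauss_val_ge_def val_ge_def expand_at_theta_nth)

text \<open>Setting \<open>t = \<theta>\<close> turns \<open>1/t\<close> into
  \<open>1/\<theta>\<close>, and both are \<open>fls_X\<close>; on the shared type the residue map
  is therefore the identity. All triangular arguments over \<open>K_infty\<close> rest on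
  this.\<close>

lemma expand_at_theta_nth_0 [simp]: "expand_at_theta c $ 0 = c"
  by (rule fls_eqI) (simp add: expand_at_theta_nth)

lemma expand_at_theta_add: "expand_at_theta (c + d) = expand_at_theta c + expand_at_theta d"
  by (intro fps_ext fls_eqI) (simp add: expand_at_theta_nth ring_distribs)

lemma expand_at_theta_0 [simp]: "expand_at_theta 0 = 0"
  by (intro fps_ext fls_eqI) (simp add: expand_at_theta_nth)

lemma expand_at_theta_diff: "expand_at_theta (c - d) = expand_at_theta c - expand_at_theta d"
  by (intro fps_ext fls_eqI) (simp add: expand_at_theta_nth ring_distribs)

lemma expand_at_theta_sum: "expand_at_theta (\<Sum>i\<in>I. f i) = (\<Sum>i\<in>I. expand_at_theta (f i))"
  by (induction I rule: infinite_finite_induct) (simp_all add: expand_at_theta_add)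

lemma expand_at_theta_const [simp]: "expand_at_theta (fls_const a) = fps_const (fls_const a)"
  by (intro fps_ext fls_eqI) (auto simp: expand_at_theta_nth)

lemma expand_at_theta_1 [simp]: "expand_at_theta 1 = 1"
  using expand_at_theta_const[of 1] by simp

lemma expand_at_theta_theta [simp]: "expand_at_theta theta = theta_plus_X"
proof (intro fps_ext fls_eqI)
  fix j m
  show "expand_at_theta theta $ j $$ m = theta_plus_X $ j $$ m"
  proof (cases "m - int j = - 1")
    case True
    hence "expand_at_theta theta $ j $$ m = (if j \<le> 1 then 1 else 0)"
      by (simp add: expand_at_theta_nth)
    with True show ?thesis by (cases j) (auto simp: fps_X_def)
  qed (auto simp: expand_at_theta_nth fps_X_def)
qed

text \<open>With bounds that need not be sharp, the summation range can be chosen uniformly, even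
  when a factor is 0.\<close>

lemma fls_times_nth_val_ge:
  fixes x y :: "'a::field fls"
  assumes "val_ge x a" "val_ge y b"
  shows "(x * y) $$ m = (\<Sum>i=a..m - b. x $$ i * y $$ (m - i))"
proof (cases "x = 0 \<or> y = 0")
  case False
  hence "a \<le> fls_subdegree x" "b \<le> fls_subdegree y"
    using assms by (auto simp: val_ge_iff_subdegree)
  thus ?thesis
    unfolding fls_times_nth(2) by (intro sum.mono_neutral_left) auto
qed auto

text \<open>This is the Leibniz rule for Hasse derivatives; after interchanging the sums it becomes
  Vandermonde's identity \<open>neg_binom_add\<close>.\<close>

lemma expand_at_theta_mult: "expand_at_theta (c * d) = expand_at_theta c * expand_at_theta d"
proof (intro fps_ext fls_eqI)
  fix j m
  define A B where "A = fls_subdegree c" and "B = fls_subdegree d"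
  have AB: "val_ge c A" "val_ge d B" by (simp_all add: A_def B_def)
  have "(expand_at_theta c * expand_at_theta d) $ j $$ m
      = (\<Sum>i=0..j. (expand_at_theta c $ i * expand_at_theta d $ (j - i)) $$ m)"
    by (simp add: fps_mult_nth fls_nth_sum)
  also have "\<dots> = (\<Sum>i=0..j. \<Sum>a=A..m - B - int j. c $$ a * d $$ (m - int j - a) *
                      (neg_binom a i * neg_binom (m - int j - a) (j - i)))"
  proof (rule sum.cong)
    fix i assume i: "i \<in> {0..j}"
    have "val_ge (expand_at_theta c $ i) (A + int i)" "val_ge (expand_at_theta d $ (j - i)) (B + int (j - i))"
      using AB[THEN gauss_val_ge_expand_at_theta] by (simp_all add: gauss_val_ge_def)
    hence "(expand_at_theta c $ i * expand_at_theta d $ (j - i)) $$ m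
      = (\<Sum>a=A + int i..m - (B + int (j - i)). expand_at_theta c $ i $$ a * expand_at_theta d $ (j - i) $$ (m - a))"
      by (rule fls_times_nth_val_ge)
    \<comment> \<open>Shifting by \<open>int i\<close> makes the range independent of
      \<open>i\<close>, so that the two sums can be interchanged.\<close>
    also have "\<dots> = (\<Sum>a=A..m - B - int j. expand_at_theta c $ i $$ (a + int i) * expand_at_theta d $ (j - i) $$ (m - (a + int i)))"
      by (rule sum.reindex_bij_witness[of _ "\<lambda>a. a + int i" "\<lambda>a. a - int i"])
         (use i in \<open>auto simp: of_nat_diff\<close>)
    also have "\<dots> = (\<Sum>a=A..m - B - int j. c $$ a * d $$ (m - int j - a) *
                      (neg_binom a i * neg_binom (m - int j - a) (j - i)))"
    proof (rule sum.cong)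
      fix a
      have "m - (a + int i) - int (j - i) = m - int j - a" using i by (simp add: of_nat_diff)
      thus "expand_at_theta c $ i $$ (a + int i) * expand_at_theta d $ (j - i) $$ (m - (a + int i)) =
            c $$ a * d $$ (m - int j - a) * (neg_binom a i * neg_binom (m - int j - a) (j - i))"
        by (simp only: expand_at_theta_nth) simp
    qed simp
    finally show "(expand_at_theta c $ i * expand_at_theta d $ (j - i)) $$ m = \<dots>" .
  qed simp
  also have "\<dots> = (\<Sum>a=A..m - B - int j. c $$ a * d $$ (m - int j - a) * neg_binom (m - int j) j)"
  proof (subst sum.swap, rule sum.cong)
    fix a
    show "(\<Sum>i=0..j. c $$ a * d $$ (m - int j - a) * (neg_binom a i * neg_binom (m - int j - a) (j - i)))
      = c $$ a * d $$ (m - int j - a) * neg_binom (m - int j) j"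
      using neg_binom_add[of a "m - int j - a" j, where ?'a = 'a] by (simp add: sum_distrib_left)
  qed simp
  also have "\<dots> = neg_binom (m - int j) j * (c * d) $$ (m - int j)"
    unfolding fls_times_nth_val_ge[OF AB]
    by (simp add: sum_distrib_left algebra_simps)
  finally show "expand_at_theta (c * d) $ j $$ m = (expand_at_theta c * expand_at_theta d) $ j $$ m"
    by (simp add: expand_at_theta_nth)
qed

section \<open>Multiplication by F[t] and its expansion\<close>

lemma inf_of_poly_0 [simp]: "inf_of_poly 0 = 0"
  by (simp add: inf_of_poly_def)

lemma inf_of_poly_pCons: "inf_of_poly (pCons a p) = fls_const a + theta * inf_of_poly p"
  by (simp add: inf_of_poly_def map_poly_pCons)

lemma series_of_poly_t_pCons:
  "series_of_poly_t (pCons a p) = fps_const (fls_const a) + fps_X * series_of_poly_t p"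
  by (simp add: series_of_poly_t_def map_poly_pCons fps_of_poly_pCons mult.commute)

lemma series_of_poly_t_0 [simp]: "series_of_poly_t 0 = 0"
  by (simp add: series_of_poly_t_def)

text \<open>The source of linearity of the regulator: the action of F[t] on series in
  \<open>t\<close> becomes, after expansion, its action through \<open>K_infty\<close>.\<close>

lemma taylor_series_of_poly_t_mult:
  assumes "taylor_convergent f"
  shows "taylor_convergent (series_of_poly_t a * f) \<and>
    taylor_at_theta (series_of_poly_t a * f) = expand_at_theta (inf_of_poly a) * taylor_at_theta f"
proof (induction a)
  case 0
  show ?case by simp
next
  case (pCons a p)
  let ?g = "series_of_poly_t p * f"
  have eq: "series_of_poly_t (pCons a p) * f = fps_const (fls_const a) * f + fps_X * ?g"
    by (simp add: series_of_poly_t_pCons algebra_simps)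
  have conv: "taylor_convergent (fps_const (fls_const a) * f)" "taylor_convergent (fps_X * ?g)"
    using assms pCons by (auto intro: taylor_convergent_const_mult taylor_convergent_X_mult)
  show ?case
    unfolding eq taylor_at_theta_add[OF conv]
    using taylor_convergent_add[OF conv] pCons assms
    unfolding taylor_at_theta_const_mult[OF assms] taylor_at_theta_X_mult[OF pCons(2)[THEN conjunct1]]
    by (simp add: inf_of_poly_pCons expand_at_theta_add expand_at_theta_mult ring_distribs mult_ac)
qed

section \<open>Laurent expansions\<close>

definition laurent_convergent :: "nat \<Rightarrow> 'a::field fls fps \<Rightarrow> bool" where
  "laurent_convergent n f \<longleftrightarrow> taylor_convergent (t_minus_theta ^ n * f)"

lemma laurent_add:
  assumes "laurent_convergent n f" "laurent_convergent n g"
  shows "laurent_convergent n (f + g) \<and>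
    laurent_at_theta n (f + g) = laurent_at_theta n f + laurent_at_theta n g"
  using assms taylor_convergent_add taylor_at_theta_add
  unfolding laurent_convergent_def laurent_at_theta_def by (metis distrib_left fps_to_fls_plus)

lemma laurent_diff:
  assumes "laurent_convergent n f" "laurent_convergent n g"
  shows "laurent_convergent n (f - g) \<and>
    laurent_at_theta n (f - g) = laurent_at_theta n f - laurent_at_theta n g"
  using assms taylor_convergent_diff taylor_at_theta_diff
  unfolding laurent_convergent_def laurent_at_theta_def by (metis right_diff_distrib fps_to_fls_minus)

lemma laurent_series_of_poly_t_mult:
  assumes "laurent_convergent n f"
  shows "laurent_convergent n (series_of_poly_t a * f) \<and>
    laurent_at_theta n (series_of_poly_t a * f) = fps_to_fls (expand_at_theta (inf_of_poly a)) * laurent_at_theta n f"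
  using taylor_series_of_poly_t_mult[OF assms[unfolded laurent_convergent_def], of a]
  by (simp add: laurent_convergent_def laurent_at_theta_def fls_times_fps_to_fls mult_ac)

lemma laurent_eq_taylor:
  assumes "taylor_convergent f"
  shows "laurent_convergent n f \<and> laurent_at_theta n f = fps_to_fls (taylor_at_theta f)"
proof -
  have "fls_X_intpow (- int n) * fps_to_fls (fps_X ^ n * g) = fps_to_fls g" for g :: "'a fls fps"
    by (simp add: fls_times_fps_to_fls fps_to_fls_power fls_X_power_times_conv_shift
        fls_shifted_times_simps)
  thus ?thesis
    using taylor_t_minus_theta_power_mult[OF assms, of n]
    by (simp add: laurent_convergent_def laurent_at_theta_def)
qed

section \<open>Polynomials in \<open>\<theta>\<close> and \<open>t\<close>\<close>

lemma inf_of_poly_nth: "inf_of_poly p $$ k = (if k \<le> 0 then coeff p (nat (- k)) else 0)"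
proof (induction p arbitrary: k)
  case (pCons a p)
  have "inf_of_poly (pCons a p) $$ k = (if k = 0 then a else 0) + inf_of_poly p $$ (k + 1)"
    by (simp add: inf_of_poly_pCons fls_X_inv_times_conv_shift)
  also have "\<dots> = (if k \<le> 0 then coeff (pCons a p) (nat (- k)) else 0)"
  proof (cases "k < 0")
    case True
    hence "nat (- k) = Suc (nat (- (k + 1)))" by simp
    with True show ?thesis by (simp add: pCons)
  qed (auto simp: pCons)
  finally show ?case .
qed simp

lemma inf_of_poly_inj: "inf_of_poly p = inf_of_poly q \<longleftrightarrow> p = q"
proof
  assume eq: "inf_of_poly p = inf_of_poly q"
  show "p = q"
  proof (rule poly_eqI)
    fix i show "coeff p i = coeff q i"
      using arg_cong[OF eq, of "\<lambda>x. x $$ (- int i)"] by (simp add: inf_of_poly_nth)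
  qed
qed simp

lemma inf_of_poly_add: "inf_of_poly (p + q) = inf_of_poly p + inf_of_poly q"
  by (rule fls_eqI) (simp add: inf_of_poly_nth)

lemma inf_of_poly_mult: "inf_of_poly (p * q) = inf_of_poly p * inf_of_poly q"
proof (induction p)
  case (pCons a p)
  have "inf_of_poly (smult a q) = fls_const a * inf_of_poly q"
    by (rule fls_eqI) (simp add: inf_of_poly_nth)
  with pCons show ?case
    by (simp add: inf_of_poly_add inf_of_poly_pCons algebra_simps)
qed simp

lemma inf_of_poly_1 [simp]: "inf_of_poly 1 = 1"
  by (simp add: inf_of_poly_def)

lemma mem_range_inf_of_poly_iff: "x \<in> range inf_of_poly \<longleftrightarrow> (\<forall>k>0. x $$ k = 0)"
proof
  assume x: "\<forall>k>0. x $$ k = 0"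
  define p where "p = Abs_poly (\<lambda>i. x $$ (- int i))"
  have "coeff p = (\<lambda>i. x $$ (- int i))"
    unfolding p_def by (rule coeff_Abs_poly[of "nat (- fls_subdegree x)"]) auto
  hence "inf_of_poly p = x"
    by (intro fls_eqI) (use x in \<open>simp add: inf_of_poly_nth\<close>)
  thus "x \<in> range inf_of_poly" by auto
qed (auto simp: inf_of_poly_nth)

text \<open>Membership becomes a condition on single coefficients: being a polynomial in
  \<open>theta\<close> means having no terms of positive degree in \<open>1/theta\<close>.\<close>

lemma mem_poly_theta_t_iff:
  "f \<in> poly_theta_t \<longleftrightarrow> (\<forall>i. f $ i \<in> range inf_of_poly) \<and> (\<forall>\<^sub>F i in sequentially. f $ i = 0)"
proof
  assume "f \<in> poly_theta_t"
  then obtain P where P: "f = fps_of_poly (map_poly inf_of_poly P)" by (auto simp: poly_theta_t_def)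
  have "\<forall>i>degree P. f $ i = 0" by (simp add: P coeff_map_poly coeff_eq_0)
  hence "\<forall>\<^sub>F i in sequentially. f $ i = 0"
    unfolding eventually_sequentially by (metis Suc_le_eq)
  thus "(\<forall>i. f $ i \<in> range inf_of_poly) \<and> (\<forall>\<^sub>F i in sequentially. f $ i = 0)"
    by (simp add: P coeff_map_poly)
next
  assume f: "(\<forall>i. f $ i \<in> range inf_of_poly) \<and> (\<forall>\<^sub>F i in sequentially. f $ i = 0)"
  define p where "p = (\<lambda>i. SOME q. f $ i = inf_of_poly q)"
  have p: "f $ i = inf_of_poly (p i)" for i
    unfolding p_def by (rule someI_ex) (use f in blast)
  obtain N where N: "\<And>i. i \<ge> N \<Longrightarrow> f $ i = 0"
    using f by (auto simp: eventually_sequentially)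
  have "p i = 0" if "i > N" for i
    using N[of i] p[of i] that inf_of_poly_inj[of "p i" 0] by simp
  hence "coeff (Abs_poly p) = p" by (rule coeff_Abs_poly)
  hence "f = fps_of_poly (map_poly inf_of_poly (Abs_poly p))"
    by (intro fps_ext) (simp add: p coeff_map_poly)
  thus "f \<in> poly_theta_t" by (auto simp: poly_theta_t_def)
qed

lemma map_poly_inf_of_poly_mult:
  "map_poly inf_of_poly (P * Q) = map_poly inf_of_poly P * map_poly inf_of_poly Q"
proof (induction P)
  case (pCons a P)
  have *: "map_poly inf_of_poly (R + S) = map_poly inf_of_poly R + map_poly inf_of_poly S"
    "map_poly inf_of_poly (smult c R) = smult (inf_of_poly c) (map_poly inf_of_poly R)" for R S c
    by (auto intro!: poly_eqI simp: coeff_map_poly inf_of_poly_add inf_of_poly_mult)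
  from pCons show ?case by (simp add: * map_poly_pCons)
qed simp

lemma poly_theta_t_mult: "f \<in> poly_theta_t \<Longrightarrow> g \<in> poly_theta_t \<Longrightarrow> f * g \<in> poly_theta_t"
proof -
  assume "f \<in> poly_theta_t" "g \<in> poly_theta_t"
  then obtain P Q where "f = fps_of_poly (map_poly inf_of_poly P)" "g = fps_of_poly (map_poly inf_of_poly Q)"
    by (auto simp: poly_theta_t_def)
  hence "f * g = fps_of_poly (map_poly inf_of_poly (P * Q))"
    by (simp add: map_poly_inf_of_poly_mult fps_of_poly_mult)
  thus ?thesis by (auto simp: poly_theta_t_def)
qed

lemma poly_theta_t_diff: "f \<in> poly_theta_t \<Longrightarrow> g \<in> poly_theta_t \<Longrightarrow> f - g \<in> poly_theta_t"
  unfolding mem_poly_theta_t_iff mem_range_inf_of_poly_iff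
  by (auto elim: eventually_elim2)

lemma poly_theta_t_0 [simp]: "0 \<in> poly_theta_t"
  by (simp add: mem_poly_theta_t_iff mem_range_inf_of_poly_iff)

lemma poly_theta_t_add: "f \<in> poly_theta_t \<Longrightarrow> g \<in> poly_theta_t \<Longrightarrow> f + g \<in> poly_theta_t"
  using poly_theta_t_diff[of f "0 - g"] poly_theta_t_diff[of 0 g] by simp

lemma poly_theta_t_const_iff: "fps_const x \<in> poly_theta_t \<longleftrightarrow> x \<in> range inf_of_poly"
proof
  assume "x \<in> range inf_of_poly"
  moreover have "\<forall>i\<ge>1. fps_const x $ i = 0" by simp
  ultimately show "fps_const x \<in> poly_theta_t"
    unfolding mem_poly_theta_t_iff eventually_sequentially by (auto simp: mem_range_inf_of_poly_iff)
next
  assume "fps_const x \<in> poly_theta_t"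
  hence "fps_const x $ 0 \<in> range inf_of_poly" unfolding mem_poly_theta_t_iff by blast
  thus "x \<in> range inf_of_poly" by simp
qed

lemma poly_theta_t_1 [simp]: "1 \<in> poly_theta_t"
  using poly_theta_t_const_iff[of 1] by (simp add: mem_range_inf_of_poly_iff)

lemma poly_theta_t_X [simp]: "fps_X \<in> poly_theta_t"
proof -
  have "\<forall>i\<ge>2. (fps_X :: 'a fls fps) $ i = 0" by (simp add: fps_X_def)
  thus ?thesis
    unfolding mem_poly_theta_t_iff eventually_sequentially by (auto simp: mem_range_inf_of_poly_iff fps_X_def)
qed

lemma poly_theta_t_t_minus_theta_power [simp]: "t_minus_theta ^ k \<in> poly_theta_t"
proof -
  have "t_minus_theta \<in> poly_theta_t"
    by (intro poly_theta_t_diff) (auto simp: poly_theta_t_const_iff mem_range_inf_of_poly_iff)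
  thus ?thesis by (induction k) (auto intro: poly_theta_t_mult)
qed

lemma series_of_poly_t_in_poly_theta_t [simp]: "series_of_poly_t a \<in> poly_theta_t"
proof (induction a)
  case (pCons c p)
  thus ?case unfolding series_of_poly_t_pCons
    by (intro poly_theta_t_add poly_theta_t_mult) (auto simp: poly_theta_t_const_iff mem_range_inf_of_poly_iff)
qed simp

lemma frob_twist_poly_theta_t:
  fixes f :: "'a::{field, finite} fls fps"
  assumes "f \<in> poly_theta_t"
  shows "frob_twist f \<in> poly_theta_t"
proof -
  have "inf_of_poly p ^ k = inf_of_poly (p ^ k)" for p :: "'a poly" and k
    by (induction k) (simp_all add: inf_of_poly_mult)
  moreover have "\<forall>\<^sub>F i in sequentially. (f $ i) ^ CARD('a) = 0"
    using assms unfolding mem_poly_theta_t_iff by (auto elim: eventually_mono simp: zero_power)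
  ultimately show ?thesis
    using assms unfolding mem_poly_theta_t_iff by (auto simp: image_iff) metis
qed

lemma taylor_convergent_poly_theta_t:
  assumes "f \<in> poly_theta_t"
  shows "taylor_convergent f"
  using assms unfolding taylor_convergent_def mem_poly_theta_t_iff
  by (auto elim: eventually_mono)

lemma series_of_poly_t_nth [simp]: "series_of_poly_t a $ j = fls_const (coeff a j)"
  by (simp add: series_of_poly_t_def coeff_map_poly)

lemma series_of_poly_t_add: "series_of_poly_t (a + b) = series_of_poly_t a + series_of_poly_t b"
  by (rule fps_ext) (simp add: fls_plus_const)

lemma series_of_poly_t_mult: "series_of_poly_t (a * b) = series_of_poly_t a * series_of_poly_t b"
proof (induction a)
  case (pCons c p)
  have "series_of_poly_t (smult c b) = fps_const (fls_const c) * series_of_poly_t b"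
    by (rule fps_ext) (simp add: fls_const_mult_const)
  moreover have "series_of_poly_t (pCons 0 (p * b)) = fps_X * series_of_poly_t (p * b)"
    by (simp add: series_of_poly_t_pCons)
  ultimately show ?case
    using pCons by (simp add: series_of_poly_t_add series_of_poly_t_pCons ring_distribs mult_ac)
qed simp

lemma series_of_poly_t_1 [simp]: "series_of_poly_t 1 = 1"
  by (rule fps_ext) simp

lemma sup_val_ge_series_of_poly_t [simp]: "sup_val_ge (series_of_poly_t a) 0"
  by (simp add: sup_val_ge_def)

section \<open>The Tate algebra as a module over F[t]\<close>

lemma tate_algebra_iff: "f \<in> tate_algebra \<longleftrightarrow> (\<forall>m. \<forall>\<^sub>F i in sequentially. val_ge (f $ i) m)"
  by (simp add: tate_algebra_def tendsto_fls_iff)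

lemma poly_theta_t_subset_tate_algebra: "poly_theta_t \<subseteq> tate_algebra"
  unfolding tate_algebra_iff mem_poly_theta_t_iff subset_iff
  by (auto elim: eventually_mono)

lemma tate_algebra_add:
  assumes "f \<in> tate_algebra" "g \<in> tate_algebra"
  shows "f + g \<in> tate_algebra"
  unfolding tate_algebra_iff
proof
  fix m
  from assms have "\<forall>\<^sub>F i in sequentially. val_ge (f $ i) m" "\<forall>\<^sub>F i in sequentially. val_ge (g $ i) m"
    by (simp_all add: tate_algebra_iff)
  thus "\<forall>\<^sub>F i in sequentially. val_ge ((f + g) $ i) m"
    by eventually_elim (simp add: val_ge_add)
qed

lemma tate_algebra_const_mult:
  assumes "f \<in> tate_algebra"
  shows "fps_const c * f \<in> tate_algebra"
proof -
  have "fps_nth (fps_const c * f) = (\<lambda>i. c * f $ i)" by (rule ext) simp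
  thus ?thesis
    using assms tendsto_mult_left_fls[of "fps_nth f" 0 c] by (simp add: tate_algebra_def)
qed

lemma tate_algebra_X_mult:
  assumes "f \<in> tate_algebra"
  shows "fps_X * f \<in> tate_algebra"
proof -
  have "(\<lambda>i. (fps_X * f) $ Suc i) = fps_nth f" by (rule ext) simp
  thus ?thesis
    using assms filterlim_sequentially_Suc[of "fps_nth (fps_X * f)" "nhds 0"]
    by (simp only: tate_algebra_def mem_Collect_eq)
qed

lemma tate_algebra_series_of_poly_t_mult:
  "f \<in> tate_algebra \<Longrightarrow> series_of_poly_t a * f \<in> tate_algebra"
proof (induction a)
  case 0
  thus ?case using poly_theta_t_subset_tate_algebra poly_theta_t_0 by auto
next
  case (pCons c p)
  have "series_of_poly_t (pCons c p) * f = fps_const (fls_const c) * f + fps_X * (series_of_poly_t p * f)"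
    by (simp add: series_of_poly_t_pCons algebra_simps)
  with pCons show ?case
    by (simp add: tate_algebra_add tate_algebra_const_mult tate_algebra_X_mult)
qed

section \<open>Solutions of the difference equation\<close>

definition frob_defect :: "nat \<Rightarrow> 'a::field fls fps \<Rightarrow> 'a fls fps" where
  "frob_defect n f = frob_twist f - t_minus_theta ^ n * f"

lemma frob_defect_add: "frob_defect n (f + g) = frob_defect n f + frob_defect n g"
  for f g :: "'a::{field, finite} fls fps"
  by (simp add: frob_defect_def frob_twist_add algebra_simps)

lemma frob_defect_diff: "frob_defect n (f - g) = frob_defect n f - frob_defect n g"
  for f g :: "'a::{field, finite} fls fps"
  by (simp add: frob_defect_def frob_twist_diff algebra_simps)

lemma frob_defect_0 [simp]: "frob_defect n 0 = (0 :: 'a::{field, finite} fls fps)"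
  by (simp add: frob_defect_def)

lemma frob_defect_sum: "frob_defect n (\<Sum>i\<in>I. f i) = (\<Sum>i\<in>I. frob_defect n (f i))"
  for f :: "'b \<Rightarrow> 'a::{field, finite} fls fps"
  by (induction I rule: infinite_finite_induct) (simp_all add: frob_defect_add)

lemma frob_defect_series_of_poly_t_mult:
  "frob_defect n (series_of_poly_t a * f) = series_of_poly_t a * frob_defect n f"
  for f :: "'a::{field, finite} fls fps"
  by (simp add: frob_defect_def frob_twist_mult algebra_simps)

lemma frob_defect_poly_theta_t:
  "f \<in> poly_theta_t \<Longrightarrow> frob_defect n f \<in> poly_theta_t" for f :: "'a::{field, finite} fls fps"
  unfolding frob_defect_def by (intro poly_theta_t_diff poly_theta_t_mult frob_twist_poly_theta_t) simp_all

text \<open>The geometric series: coefficient \<open>j\<close> of the inverse is minus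
  \<open>\<theta>^(-j-1)\<close>.\<close>

lemma gauss_val_ge_inverse_t_minus_theta: "gauss_val_ge (inverse t_minus_theta) 1"
proof -
  have "(inverse (t_minus_theta :: 'a fls fps)) $ j = - (fls_X ^ (j + 1))" for j
  proof -
    have *: "t_minus_theta * Abs_fps (\<lambda>j. - (fls_X ^ (j + 1))) = (1 :: 'a fls fps)"
    proof (rule fps_ext)
      fix j
      have "theta * fls_X = (1 :: 'a fls)" by (subst fls_inverse_X[symmetric]) simp
      thus "(t_minus_theta * Abs_fps (\<lambda>j. - (fls_X ^ (j + 1)))) $ j = (1 :: 'a fls fps) $ j"
        by (cases j) (simp_all add: ring_distribs flip: mult.assoc)
    qed
    show ?thesis using fps_inverse_unique[OF *] by simp
  qed
  moreover have "val_ge (- (fls_X ^ (j + 1)) :: 'a fls) (1 + int j)" for j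
    by (auto simp: val_ge_def simp del: power_Suc)
  ultimately show ?thesis unfolding gauss_val_ge_def by simp
qed

lemma t_minus_theta_mult_inverse [simp]:
  "t_minus_theta * inverse t_minus_theta = (1 :: 'a::field fls fps)"
  by (rule inverse_mult_eq_1') simp

lemma t_minus_theta_power_mult_inverse [simp]:
  "t_minus_theta ^ k * inverse t_minus_theta ^ k = (1 :: 'a::field fls fps)"
  by (simp flip: power_mult_distrib)

lemma sup_val_ge_t_minus_theta: "sup_val_ge t_minus_theta (- 1)"
  by (auto simp: sup_val_ge_def fps_X_def intro!: val_ge_diff)
     (auto simp: val_ge_def)

lemma gauss_val_ge_imp_sup_val_ge: "gauss_val_ge f m \<Longrightarrow> sup_val_ge f m"
  unfolding gauss_val_ge_def sup_val_ge_def by (meson le_add_same_cancel1 of_nat_0_le_iff val_ge_mono)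

text \<open>The solution of \<open>f\<^sup>(\<^sup>1\<^sup>) - (t - \<theta>)\<^sup>n f = (t - \<theta>)\<^sup>d\<close> is the limit of the iterates
  of \<open>f \<mapsto> (t - \<theta>)\<^sup>-\<^sup>n (f\<^sup>(\<^sup>1\<^sup>) - (t - \<theta>)\<^sup>d)\<close>.\<close>

lemma frob_defect_solution_exists:
  assumes "d < n"
  shows "\<exists>f :: 'a::{field, finite} fls fps. gauss_val_ge f 1 \<and> frob_defect n f = t_minus_theta ^ d"
proof -
  define v where "v = inverse (t_minus_theta :: 'a fls fps)"
  define step where "step = (\<lambda>f. v ^ n * (frob_twist f - t_minus_theta ^ d))"
  have v: "gauss_val_ge v 1"
    using gauss_val_ge_inverse_t_minus_theta by (simp add: v_def)
  have vn: "gauss_val_ge (v ^ k) (int k)" for k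
    using gauss_val_ge_power[OF v, of k] by simp
  define S where "S = (\<lambda>N. (step ^^ N) 0)"
  have S_Suc: "S (Suc N) = v ^ n * (frob_twist (S N) - t_minus_theta ^ d)" for N
    by (simp add: S_def step_def)
  have S_0: "S 0 = 0" by (simp add: S_def)
  have "v ^ n * t_minus_theta ^ d = v ^ (n - d) * (t_minus_theta ^ d * v ^ d)"
    using assms by (simp add: mult_ac flip: power_add)
  also have "\<dots> = v ^ (n - d)" by (simp add: v_def)
  finally have vtd: "v ^ n * t_minus_theta ^ d = v ^ (n - d)" .
  \<comment> \<open>Since \<open>d < n\<close>, the first iterate \<open>- (v ^ (n - d))\<close> has
    valuation at least 1, the threshold from which the twist gains.\<close>
  have diff: "gauss_val_ge (S (Suc N) - S N) (int N + 1)" for N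
  proof (induction N)
    case 0
    have "gauss_val_ge (- (v ^ (n - d))) 1"
      using vn[of "n - d"] assms by (auto elim: gauss_val_ge_mono)
    thus ?case by (simp add: S_Suc S_0 vtd)
  next
    case (Suc N)
    have "S (Suc (Suc N)) - S (Suc N) = v ^ n * frob_twist (S (Suc N) - S N)"
    proof -
      have "S (Suc (Suc N)) - S (Suc N) = v ^ n * (frob_twist (S (Suc N)) - t_minus_theta ^ d)
              - v ^ n * (frob_twist (S N) - t_minus_theta ^ d)"
        by (metis S_Suc)
      thus ?thesis by (simp add: frob_twist_diff algebra_simps)
    qed
    moreover have "gauss_val_ge (v ^ n * frob_twist (S (Suc N) - S N)) (int n + (int N + 1 + 1))"
      by (intro gauss_val_ge_mult vn gauss_val_ge_frob_twist Suc.IH) simp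
    ultimately show ?case by (auto elim: gauss_val_ge_mono)
  qed
  have "\<exists>f. coeffwise_tendsto S f"
  proof (rule coeffwise_tendsto_ex)
    fix j m
    show "\<forall>\<^sub>F N in sequentially. val_ge ((S (Suc N) - S N) $ j) m"
      unfolding eventually_sequentially
    proof (intro exI allI impI)
      fix N assume "N \<ge> nat m"
      thus "val_ge ((S (Suc N) - S N) $ j) m"
        using diff[of N] unfolding gauss_val_ge_def by (auto elim!: allE[of _ j] val_ge_mono)
    qed
  qed
  then obtain f where f: "coeffwise_tendsto S f" ..
  have "gauss_val_ge (S N) 1" for N
  proof (induction N)
    case (Suc N)
    have "gauss_val_ge ((S (Suc N) - S N) + S N) 1"
      using diff[of N] Suc by (intro gauss_val_ge_add) (auto elim: gauss_val_ge_mono)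
    thus ?case by simp
  qed (simp add: S_0)
  hence val: "gauss_val_ge f 1" by (rule gauss_val_ge_lim[OF f])
  have "coeffwise_tendsto (\<lambda>N. frob_twist (S N) + (- (t_minus_theta ^ d))) (frob_twist f + (- (t_minus_theta ^ d)))"
    by (rule coeffwise_tendsto_add[OF coeffwise_tendsto_frob_twist[OF f] coeffwise_tendsto_const])
  from coeffwise_tendsto_mult_left[OF this, of "v ^ n"]
  have "coeffwise_tendsto (\<lambda>N. S (Suc N)) (v ^ n * (frob_twist f - t_minus_theta ^ d))"
    by (simp only: S_Suc add_uminus_conv_diff)
  hence "coeffwise_tendsto S (v ^ n * (frob_twist f - t_minus_theta ^ d))"
    by (simp only: coeffwise_tendsto_Suc)
  hence "f = v ^ n * (frob_twist f - t_minus_theta ^ d)"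
    by (rule coeffwise_tendsto_unique[OF f])
  hence "t_minus_theta ^ n * f = t_minus_theta ^ n * (v ^ n * (frob_twist f - t_minus_theta ^ d))"
    by (rule arg_cong)
  also have "\<dots> = frob_twist f - t_minus_theta ^ d"
    by (simp add: v_def flip: mult.assoc)
  finally have "frob_defect n f = t_minus_theta ^ d"
    by (simp add: frob_defect_def)
  with val show ?thesis by blast
qed

text \<open>The choice is immaterial: the difference of two candidates satisfies the hypotheses of
  \<open>frob_defect_eq_0_imp_eq_0\<close>.\<close>

definition basic_solution :: "nat \<Rightarrow> nat \<Rightarrow> 'a::{field, finite} fls fps" where
  "basic_solution n d = (SOME f. gauss_val_ge f 1 \<and> frob_defect n f = t_minus_theta ^ d)"

lemma basic_solution:
  assumes "d < n"
  shows "gauss_val_ge (basic_solution n d :: 'a::{field, finite} fls fps) 1"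
    and "frob_defect n (basic_solution n d :: 'a fls fps) = t_minus_theta ^ d"
  using someI_ex[OF frob_defect_solution_exists[OF assms]] by (auto simp: basic_solution_def)

text \<open>The equation reads \<open>f = v ^ n * frob_twist f\<close> with \<open>v\<close> the
  inverse of \<open>t_minus_theta\<close>. Multiplication by \<open>v ^ n\<close> does not lower the
  valuation and Frobenius at least doubles a positive one, so every bound holds. The supremum
  valuation is used because removing a polynomial part from a series gives no control in the Gauss
  valuation.\<close>

lemma frob_defect_eq_0_imp_eq_0:
  fixes f :: "'a::{field, finite} fls fps"
  assumes "sup_val_ge f 1" "frob_defect n f = 0"
  shows "f = 0"
proof -
  define v where "v = inverse (t_minus_theta :: 'a fls fps)"
  have v: "sup_val_ge (v ^ n) 0"
    using sup_val_ge_power[OF gauss_val_ge_imp_sup_val_ge[OF gauss_val_ge_inverse_t_minus_theta], of n]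
    by (auto simp: v_def elim: sup_val_ge_mono)
  have "v ^ n * frob_twist f = v ^ n * (t_minus_theta ^ n * f)"
    using assms(2) by (simp add: frob_defect_def)
  also have "\<dots> = f"
    by (simp add: v_def mult.commute[of "inverse _ ^ n"] flip: mult.assoc)
  finally have f_eq: "v ^ n * frob_twist f = f" .
  have "sup_val_ge f (int m + 1)" for m
  proof (induction m)
    case (Suc m)
    have "sup_val_ge (frob_twist f) (2 * (int m + 1))"
      using Suc unfolding sup_val_ge_def frob_twist_nth by (intro allI val_ge_power_card) auto
    from sup_val_ge_mult[OF v this] show ?case
      unfolding f_eq by (auto elim: sup_val_ge_mono)
  qed (use assms in simp)
  hence "val_ge (f $ j) (int m)" for j m
    unfolding sup_val_ge_def by (meson le_add_same_cancel1 val_ge_mono zero_le_one)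
  thus ?thesis by (intro fps_ext) (auto intro: eq_0_if_val_ge_all)
qed

text \<open>Up to sign \<open>t_minus_theta\<close> is monic in \<open>theta\<close> over F[t], so
  division with remainder by its powers is possible; each step of the induction removes the top
  degree in \<open>theta\<close>.\<close>

lemma poly_theta_t_degree_less_span:
  assumes "(f :: 'a::field fls fps) \<in> poly_theta_t" "sup_val_ge f (1 - int n)"
  shows "\<exists>a. f = (\<Sum>d<n. series_of_poly_t (a d) * t_minus_theta ^ d)"
  using assms
proof (induction n arbitrary: f)
  case 0
  have "f $ j = 0" for j
  proof (rule fls_eqI)
    fix k show "f $ j $$ k = 0 $$ k"
      using 0 by (cases "k > 0") (auto simp: mem_poly_theta_t_iff mem_range_inf_of_poly_iff sup_val_ge_def val_ge_def)
  qed
  hence "f = 0" by (intro fps_ext) simp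
  thus ?case by simp
next
  case (Suc n)
  have lead: "sup_val_ge (t_minus_theta ^ n - fps_const ((- theta) ^ n) :: 'a fls fps) (1 - int n)" for n
  proof (induction n)
    case (Suc n)
    have eq: "(t_minus_theta ^ Suc n - fps_const ((- theta) ^ Suc n) :: 'a fls fps)
      = t_minus_theta * (t_minus_theta ^ n - fps_const ((- theta) ^ n)) + fps_X * fps_const ((- theta) ^ n)"
    proof -
      have "(x - c) * a - (- c) * p = (x - c) * (a - p) + x * p" for x c a p :: "'a fls fps"
        by (simp add: algebra_simps)
      from this[of fps_X "fps_const theta" "t_minus_theta ^ n" "fps_const ((- theta) ^ n)"]
      show ?thesis by (simp only: power_Suc fps_const_mult[symmetric] fps_const_neg[symmetric])
    qed
    have "sup_val_ge (t_minus_theta * (t_minus_theta ^ n - fps_const ((- theta) ^ n)) :: 'a fls fps) (- 1 + (1 - int n))"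
      by (intro sup_val_ge_mult sup_val_ge_t_minus_theta Suc.IH)
    moreover have "sup_val_ge (fps_X * fps_const ((- theta) ^ n) :: 'a fls fps) (0 + - int n)"
    proof (rule sup_val_ge_mult)
      show "sup_val_ge (fps_X :: 'a fls fps) 0" by (auto simp: sup_val_ge_def fps_X_def)
      have "val_ge ((- theta) ^ n :: 'a fls) (int n * - 1)" by (rule val_ge_power) simp
      thus "sup_val_ge (fps_const ((- theta) ^ n) :: 'a fls fps) (- int n)" by (auto simp: sup_val_ge_def)
    qed
    ultimately show ?case
      unfolding eq by (intro sup_val_ge_add) (auto elim!: sup_val_ge_mono)
  qed (simp add: sup_val_ge_def)
  obtain N where N: "\<And>i. i \<ge> N \<Longrightarrow> f $ i = 0"
    using Suc.prems(1) by (auto simp: mem_poly_theta_t_iff eventually_sequentially)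
  \<comment> \<open>The coefficient of \<open>theta ^ n\<close> in \<open>f\<close>, as a polynomial
    in \<open>t\<close>; the sign cancels the one in \<open>(- theta) ^ n\<close>.\<close>
  define b where "b = Abs_poly (\<lambda>i. (- 1) ^ n * f $ i $$ (- int n))"
  have b: "coeff b = (\<lambda>i. (- 1) ^ n * f $ i $$ (- int n))"
    unfolding b_def by (rule coeff_Abs_poly[of N]) (simp add: N)
  define g where "g = f - series_of_poly_t b * t_minus_theta ^ n"
  have g1: "g \<in> poly_theta_t"
    unfolding g_def by (intro poly_theta_t_diff poly_theta_t_mult Suc.prems) simp_all
  have "sup_val_ge (f - series_of_poly_t b * fps_const ((- theta) ^ n)) (1 - int n)"
    unfolding sup_val_ge_def val_ge_def
  proof (intro allI impI)
    fix j k assume k: "k < 1 - int n"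
    have "(- theta) ^ n = fls_const ((- 1) ^ n) * (theta ^ n :: 'a fls)"
      by (subst power_minus) (simp add: fls_const_power fls_const_uminus[symmetric])
    hence eq: "(f - series_of_poly_t b * fps_const ((- theta) ^ n)) $ j $$ k
      = f $ j $$ k - (if k = - int n then f $ j $$ (- int n) else 0)"
      by (simp add: b mult.assoc flip: power_mult_distrib)
    show "(f - series_of_poly_t b * fps_const ((- theta) ^ n)) $ j $$ k = 0"
    proof (cases "k = - int n")
      case False
      with k have "k < 1 - int (Suc n)" by simp
      hence "f $ j $$ k = 0"
        using Suc.prems(2) by (simp add: sup_val_ge_def val_ge_def)
      with False show ?thesis unfolding eq by simp
    next
      case True
      thus ?thesis unfolding eq by simp
    qed
  qed
  moreover have "sup_val_ge (series_of_poly_t b * (t_minus_theta ^ n - fps_const ((- theta) ^ n))) (0 + (1 - int n))"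
    by (intro sup_val_ge_mult lead sup_val_ge_series_of_poly_t)
  hence "sup_val_ge (series_of_poly_t b * (t_minus_theta ^ n - fps_const ((- theta) ^ n))) (1 - int n)"
    by (simp only: add_0)
  ultimately have "sup_val_ge ((f - series_of_poly_t b * fps_const ((- theta) ^ n))
      - series_of_poly_t b * (t_minus_theta ^ n - fps_const ((- theta) ^ n))) (1 - int n)"
    by (rule sup_val_ge_diff)
  moreover have "(f - s * p) - s * (t - p) = f - s * t" for s p t
    by (simp add: algebra_simps)
  ultimately have "sup_val_ge g (1 - int n)"
    by (simp only: g_def)
  from Suc.IH[OF g1 this] obtain a where a: "g = (\<Sum>d<n. series_of_poly_t (a d) * t_minus_theta ^ d)" ..
  have "f = (\<Sum>d<Suc n. series_of_poly_t ((a(n := b)) d) * t_minus_theta ^ d)"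
    using a by (simp add: g_def algebra_simps)
  thus ?case by (rule exI[of _ "a(n := b)"])
qed

text \<open>The coefficients of \<open>\<xi>\<close> minus its polynomial part in \<open>\<theta>\<close> have negative degree in \<open>\<theta>\<close>; such a
  series is determined by its defect, which is of degree less than \<open>n\<close> in \<open>\<theta>\<close>.\<close>

lemma ext_numerator_span:
  fixes \<xi> :: "'a::{field, finite} fls fps"
  assumes "\<xi> \<in> tate_algebra" "frob_defect n \<xi> \<in> poly_theta_t"
  shows "\<exists>g a. g \<in> poly_theta_t \<and> \<xi> = g + (\<Sum>d<n. series_of_poly_t (a d) * basic_solution n d)"
proof -
  define g where "g = Abs_fps (\<lambda>i. Abs_fls (\<lambda>k. if k \<le> 0 then \<xi> $ i $$ k else 0))"
  have g_nth: "g $ i $$ k = (if k \<le> 0 then \<xi> $ i $$ k else 0)" for i k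
    unfolding g_def fps_nth_Abs_fps
    by (rule nth_Abs_fls_lower_bound[of "fls_subdegree (\<xi> $ i)"]) auto
  have g: "g \<in> poly_theta_t"
    unfolding mem_poly_theta_t_iff
  proof
    \<comment> \<open>Here the Tate condition enters: almost all coefficients have negative degree
      in \<open>theta\<close>, so \<open>g\<close> is a polynomial in \<open>t\<close> too.\<close>
    have "\<forall>\<^sub>F i in sequentially. val_ge (\<xi> $ i) 1"
      using assms(1) by (simp add: tate_algebra_iff)
    thus "\<forall>\<^sub>F i in sequentially. g $ i = 0"
      by eventually_elim (auto intro!: fls_eqI simp: g_nth val_ge_def)
  qed (simp add: mem_range_inf_of_poly_iff g_nth)
  define \<eta> where "\<eta> = \<xi> - g"
  have \<eta>: "sup_val_ge \<eta> 1"
    by (auto simp: sup_val_ge_def val_ge_def \<eta>_def g_nth)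
  have "sup_val_ge (frob_defect n \<eta>) (1 - int n)"
    unfolding frob_defect_def
  proof (rule sup_val_ge_diff)
    have "val_ge ((\<eta> $ j) ^ CARD('a)) (1 - int n)" for j
      using \<eta> by (intro val_ge_mono[OF val_ge_power_card[of _ 1]]) (auto simp: sup_val_ge_def)
    thus "sup_val_ge (frob_twist \<eta>) (1 - int n)"
      by (simp add: sup_val_ge_def)
    have "sup_val_ge (t_minus_theta ^ n * \<eta>) (int n * - 1 + 1)"
      by (intro sup_val_ge_mult sup_val_ge_power sup_val_ge_t_minus_theta \<eta>)
    thus "sup_val_ge (t_minus_theta ^ n * \<eta>) (1 - int n)" by (simp add: algebra_simps)
  qed
  moreover have "frob_defect n \<eta> \<in> poly_theta_t"
    unfolding \<eta>_def frob_defect_diff by (intro poly_theta_t_diff assms frob_defect_poly_theta_t g)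
  ultimately obtain a where a: "frob_defect n \<eta> = (\<Sum>d<n. series_of_poly_t (a d) * t_minus_theta ^ d)"
    using poly_theta_t_degree_less_span by blast
  define \<zeta> where "\<zeta> = (\<Sum>d<n. series_of_poly_t (a d) * basic_solution n d)"
  have "sup_val_ge \<zeta> (0 + 1)"
    unfolding \<zeta>_def
    by (intro sup_val_ge_sum sup_val_ge_mult sup_val_ge_series_of_poly_t gauss_val_ge_imp_sup_val_ge)
       (simp add: basic_solution)
  hence "sup_val_ge (\<eta> - \<zeta>) 1" using \<eta> by (intro sup_val_ge_diff) simp_all
  moreover have "frob_defect n (\<eta> - \<zeta>) = 0"
    by (simp add: frob_defect_diff a \<zeta>_def frob_defect_sum frob_defect_series_of_poly_t_mult basic_solution)
  ultimately have "\<eta> = \<zeta>" using frob_defect_eq_0_imp_eq_0 by fastforce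
  hence "\<xi> = g + (\<Sum>d<n. series_of_poly_t (a d) * basic_solution n d)"
    by (simp add: \<eta>_def \<zeta>_def algebra_simps)
  with g show ?thesis by blast
qed

text \<open>Continuation by the functional equation: \<open>(t - \<theta>)^n\<close> times the
  solution is its twist minus a polynomial, and the twist converges at
  \<open>\<theta>\<close>.\<close>

lemma laurent_convergent_basic_solution:
  assumes "d < n"
  shows "laurent_convergent n (basic_solution n d :: 'a::{field, finite} fls fps)"
proof -
  let ?f = "basic_solution n d :: 'a fls fps"
  have "t_minus_theta ^ n * ?f = frob_twist ?f - t_minus_theta ^ d"
    using basic_solution(2)[OF assms, where ?'a = 'a] by (simp add: frob_defect_def algebra_simps)
  thus ?thesis
    unfolding laurent_convergent_def
    using taylor_convergent_diff[OF taylor_convergent_frob_twist[OF basic_solution(1)[OF assms]]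
        taylor_convergent_poly_theta_t[OF poly_theta_t_t_minus_theta_power]] by simp
qed

lemma laurent_convergent_sum:
  fixes f :: "'b \<Rightarrow> 'a::field fls fps"
  assumes "\<And>i. i \<in> I \<Longrightarrow> laurent_convergent n (f i)"
  shows "laurent_convergent n (\<Sum>i\<in>I. f i) \<and>
    laurent_at_theta n (\<Sum>i\<in>I. f i) = (\<Sum>i\<in>I. laurent_at_theta n (f i))"
  using assms
proof (induction I rule: infinite_finite_induct)
  case (insert i I)
  hence "laurent_convergent n (f i)" "laurent_convergent n (\<Sum>i\<in>I. f i)" by simp_all
  from laurent_add[OF this] insert show ?case by simp
qed (simp_all add: laurent_eq_taylor)

section \<open>Expansions of the basic solutions at \<open>t = \<theta>\<close>\<close>

text \<open>Since the constant term of \<open>expand_at_theta b\<close> is \<open>b\<close>, the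
  coefficient of \<open>X^n\<close> can be corrected by a multiple of \<open>fps_X ^ n\<close>
  without touching the lower ones.\<close>

lemma expand_at_theta_combination_exists:
  "\<exists>a. \<forall>j<n. (P - (\<Sum>k<n. expand_at_theta (a k) * fps_X ^ k)) $ j = 0"
proof (induction n)
  case (Suc n)
  then obtain a where a: "\<forall>j<n. (P - (\<Sum>k<n. expand_at_theta (a k) * fps_X ^ k)) $ j = 0" ..
  define b where "b = (P - (\<Sum>k<n. expand_at_theta (a k) * fps_X ^ k)) $ n"
  have "(P - (\<Sum>k<Suc n. expand_at_theta ((a(n := b)) k) * fps_X ^ k)) $ j
    = (P - (\<Sum>k<n. expand_at_theta (a k) * fps_X ^ k)) $ j - (if j < n then 0 else expand_at_theta b $ (j - n))" for j
    by (simp add: fps_X_power_mult_right_nth)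
  hence "\<forall>j<Suc n. (P - (\<Sum>k<Suc n. expand_at_theta ((a(n := b)) k) * fps_X ^ k)) $ j = 0"
    using a by (auto simp: less_Suc_eq b_def)
  thus ?case by blast
qed simp

text \<open>The same triangular system solved quantitatively: \<open>a k\<close> is coefficient
  \<open>k\<close> of the sum minus contributions of earlier \<open>a i\<close>, and these keep
  their bounds under the embedding.\<close>

lemma expand_at_theta_combination_val_ge:
  assumes "\<And>j. j < n \<Longrightarrow> val_ge ((\<Sum>k<n. expand_at_theta (a k) * fps_X ^ k) $ j) (m + int j)"
  shows "k < n \<Longrightarrow> val_ge (a k) (m + int k)"
proof (induction k rule: less_induct)
  case (less k)
  have "(\<Sum>i<n. expand_at_theta (a i) * fps_X ^ i) $ k = (\<Sum>i<n. if i \<le> k then expand_at_theta (a i) $ (k - i) else 0)"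
    by (auto simp: fps_sum_nth fps_X_power_mult_right_nth intro!: sum.cong)
  also have "\<dots> = (\<Sum>i\<in>{..<k} \<union> {k}. expand_at_theta (a i) $ (k - i))"
    using less.prems by (intro sum.mono_neutral_cong_right) auto
  also have "\<dots> = (\<Sum>i<k. expand_at_theta (a i) $ (k - i)) + a k"
    by (subst sum.union_disjoint) auto
  finally have "a k = (\<Sum>i<n. expand_at_theta (a i) * fps_X ^ i) $ k - (\<Sum>i<k. expand_at_theta (a i) $ (k - i))"
    by simp
  moreover have "val_ge (expand_at_theta (a i) $ (k - i)) (m + int k)" if "i < k" for i
  proof -
    have "val_ge (a i) (m + int i)" using less that by simp
    hence "val_ge (expand_at_theta (a i) $ (k - i)) (m + int i + int (k - i))"
      using gauss_val_ge_expand_at_theta unfolding gauss_val_ge_def by blast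
    with that show ?thesis by (simp add: of_nat_diff)
  qed
  ultimately show ?case
    using assms[OF less.prems] by (auto intro!: val_ge_diff val_ge_sum)
qed

text \<open>Its coefficients below degree \<open>n\<close> are the polar part of the basic solution
  at \<open>\<theta>\<close>.\<close>

definition solution_numerator :: "nat \<Rightarrow> nat \<Rightarrow> 'a::{field, finite} fls fps" where
  "solution_numerator n d = taylor_at_theta (t_minus_theta ^ n * basic_solution n d)"

text \<open>By its equation the numerator is the expansion of the twist minus
  \<open>fps_X ^ d\<close>; the twist has positive valuation, whereas \<open>fps_X ^ d\<close> only
  has the bound \<open>- int d\<close>.\<close>

lemma solution_numerator:
  assumes "d < n"
  shows "gauss_val_ge (solution_numerator n d + fps_X ^ d :: 'a::{field, finite} fls fps) 1"
proof -
  let ?f = "basic_solution n d :: 'a fls fps"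
  have "t_minus_theta ^ n * ?f = frob_twist ?f - t_minus_theta ^ d"
    using basic_solution(2)[OF assms, where ?'a = 'a] by (simp add: frob_defect_def algebra_simps)
  moreover have conv: "taylor_convergent (frob_twist ?f)"
    using taylor_convergent_frob_twist basic_solution(1)[OF assms] by blast
  moreover have "taylor_at_theta (t_minus_theta ^ d * 1) = (fps_X ^ d * 1 :: 'a fls fps)"
    using taylor_t_minus_theta_power_mult[of 1 d] by (metis taylor_convergent_1 taylor_at_theta_1)
  ultimately have "solution_numerator n d = taylor_at_theta (frob_twist ?f) - fps_X ^ d"
    using taylor_at_theta_diff[OF conv taylor_convergent_poly_theta_t[OF poly_theta_t_t_minus_theta_power[of d]]]
    by (simp only: solution_numerator_def mult_1_right)
  moreover have "gauss_val_ge (taylor_at_theta (frob_twist ?f)) 1"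
    using gauss_val_ge_frob_twist[OF basic_solution(1)[OF assms]]
    by (intro gauss_val_ge_taylor_at_theta conv) (auto elim: gauss_val_ge_mono)
  ultimately show ?thesis by simp
qed

text \<open>Up to a term that is smaller for the Gauss valuation, \<open>solution_numerator n d\<close> is \<open>- (t - \<theta>)\<^sup>d\<close>.\<close>

lemma solution_numerator_combination_inj:
  fixes c :: "nat \<Rightarrow> 'a::{field, finite} fls"
  assumes "\<And>j. j < n \<Longrightarrow> (\<Sum>d<n. expand_at_theta (c d) * solution_numerator n d) $ j = 0"
  assumes "d < n"
  shows "c d = 0"
proof -
  \<comment> \<open>The weight \<open>int d\<close> offsets the valuation of
    \<open>fps_X ^ d\<close>, so that all terms of the leading sum obey one bound. The inserted 0
    only keeps the set nonempty.\<close>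
  define m0 where "m0 = Min (insert 0 ((\<lambda>d. fls_subdegree (c d) - int d) ` {..<n}))"
  have m0: "val_ge (c d) (m0 + int d)" if "d < n" for d
  proof -
    have "m0 \<le> fls_subdegree (c d) - int d"
      unfolding m0_def using that by (intro Min_le) auto
    thus ?thesis by (auto intro: val_ge_mono[OF val_ge_subdegree])
  qed
  \<comment> \<open>Below degree \<open>n\<close> the leading sum equals the perturbation
    \<open>R\<close>, whose bound is better by 1; inverting the triangular system passes this gain
    on to the \<open>c d\<close>.\<close>
  have "\<forall>d<n. val_ge (c d) (m0 + int m + int d)" for m
  proof (induction m)
    case (Suc m)
    define R where "R = (\<Sum>d<n. expand_at_theta (c d) * (solution_numerator n d + fps_X ^ d))"
    have "gauss_val_ge (expand_at_theta (c d) * (solution_numerator n d + fps_X ^ d)) (m0 + int m + int d + 1)"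
      if "d < n" for d
      using Suc that by (intro gauss_val_ge_mult gauss_val_ge_expand_at_theta solution_numerator) auto
    hence "gauss_val_ge R (m0 + int m + 1)"
      unfolding R_def by (intro gauss_val_ge_sum) (force elim: gauss_val_ge_mono)
    moreover have "(\<Sum>d<n. expand_at_theta (c d) * fps_X ^ d) $ j = R $ j" if "j < n" for j
      using assms(1)[OF that] by (simp add: R_def ring_distribs sum.distrib)
    ultimately have "val_ge ((\<Sum>d<n. expand_at_theta (c d) * fps_X ^ d) $ j) (m0 + int m + 1 + int j)" if "j < n" for j
      using that by (simp add: gauss_val_ge_def)
    from expand_at_theta_combination_val_ge[of n c, OF this] show ?case
      by (auto simp: algebra_simps)
  qed (use m0 in simp)
  hence *: "val_ge (c d) (m0 + int m + int d)" for m using assms(2) by blast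
  have "val_ge (c d) (int m)" for m
    using *[of "nat (int m - m0)"] by (rule val_ge_mono) simp
  thus ?thesis by (rule eq_0_if_val_ge_all)
qed

text \<open>Modulo \<open>X^n\<close> the numerators are given by an \<open>n\<close> by
  \<open>n\<close> matrix over \<open>K_infty\<close> in the basis of powers of \<open>X\<close>.
  Independence makes its kernel trivial, hence its determinant nonzero.\<close>

lemma solution_numerator_combination_surj:
  fixes P :: "'a::{field, finite} fls fps"
  shows "\<exists>c. \<forall>j<n. (P - (\<Sum>d<n. expand_at_theta (c d) * solution_numerator n d)) $ j = 0"
proof -
  have "\<exists>a. \<forall>j<n. (solution_numerator n d - (\<Sum>k<n. expand_at_theta (a k) * fps_X ^ k)) $ j = (0 :: 'a fls)" for d
    by (rule expand_at_theta_combination_exists)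
  then obtain M where M: "\<And>d j. j < n \<Longrightarrow>
      (solution_numerator n d - (\<Sum>k<n. expand_at_theta (M d k) * fps_X ^ k)) $ j = (0 :: 'a fls)"
    by metis
  obtain b where b: "\<And>j. j < n \<Longrightarrow> (P - (\<Sum>k<n. expand_at_theta (b k) * fps_X ^ k)) $ j = 0"
    using expand_at_theta_combination_exists by blast
  define A where "A = Matrix.mat n n (\<lambda>(k, d). M d k)"
  have A: "A \<in> carrier_mat n n" by (simp add: A_def)
  have comb: "(\<Sum>d<n. expand_at_theta (c d) * solution_numerator n d) $ j
      = (\<Sum>k<n. expand_at_theta (\<Sum>d<n. c d * M d k) * fps_X ^ k) $ j" if "j < n" for c j
  proof -
    have "(F * solution_numerator n d) $ j = (F * (\<Sum>k<n. expand_at_theta (M d k) * fps_X ^ k)) $ j" for F d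
    proof -
      \<comment> \<open>Coefficient \<open>j\<close> of a product involves only coefficients up to
        \<open>j\<close> of the factors, so congruence modulo \<open>X^n\<close> may be used under
        the product.\<close>
      have "solution_numerator n d $ i = (\<Sum>k<n. expand_at_theta (M d k) * fps_X ^ k) $ i" if "i \<le> j" for i
        using M[of i d] that \<open>j < n\<close> by simp
      thus ?thesis by (simp add: fps_mult_nth)
    qed
    hence "(\<Sum>d<n. expand_at_theta (c d) * solution_numerator n d) $ j
      = (\<Sum>d<n. expand_at_theta (c d) * (\<Sum>k<n. expand_at_theta (M d k) * fps_X ^ k)) $ j"
      by (simp add: fps_sum_nth)
    also have "(\<Sum>d<n. expand_at_theta (c d) * (\<Sum>k<n. expand_at_theta (M d k) * fps_X ^ k))
      = (\<Sum>k<n. expand_at_theta (\<Sum>d<n. c d * M d k) * fps_X ^ k)"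
      unfolding expand_at_theta_sum expand_at_theta_mult sum_distrib_left sum_distrib_right mult.assoc
      by (rule sum.swap)
    finally show ?thesis .
  qed
  have A_vec: "Matrix.vec_index (A *\<^sub>v Matrix.vec n c) k = (\<Sum>d<n. c d * M d k)" if "k < n" for c k
    using that by (simp add: A_def scalar_prod_def lessThan_atLeast0 mult.commute)
  have "det A \<noteq> 0"
  proof
    assume "det A = 0"
    then obtain v where v: "v \<in> carrier_vec n" "v \<noteq> 0\<^sub>v n" "A *\<^sub>v v = 0\<^sub>v n"
      using det_0_iff_vec_prod_zero_field[OF A] by blast
    define c where "c = Matrix.vec_index v"
    have vc: "v = Matrix.vec n c" using v(1) by (auto simp: c_def)
    have "(\<Sum>d<n. c d * M d k) = 0" if "k < n" for k
      using A_vec[OF that, of c] v(3) that by (simp add: vc[symmetric])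
    hence "(\<Sum>d<n. expand_at_theta (c d) * solution_numerator n d) $ j = 0" if "j < n" for j
      using that by (simp add: comb)
    from solution_numerator_combination_inj[OF this] have "c d = 0" if "d < n" for d using that by blast
    hence "v = 0\<^sub>v n" unfolding vc by (intro eq_vecI) auto
    with v(2) show False by simp
  qed
  then obtain B where B: "B \<in> carrier_mat n n" "A * B = 1\<^sub>m n"
    using det_non_zero_imp_unit[OF A] unfolding Units_def ring_mat_def by auto
  define c where "c = Matrix.vec_index (B *\<^sub>v Matrix.vec n b)"
  have "A *\<^sub>v Matrix.vec n c = Matrix.vec n b"
  proof -
    have "Matrix.vec n c = B *\<^sub>v Matrix.vec n b" using B(1) by (auto simp: c_def)
    hence "A *\<^sub>v Matrix.vec n c = (A * B) *\<^sub>v Matrix.vec n b"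
      using A B(1) by (simp add: assoc_mult_mat_vec[of _ n n _ n])
    thus ?thesis by (simp add: B(2))
  qed
  hence "(\<Sum>d<n. c d * M d k) = b k" if "k < n" for k
    using A_vec[OF that, of c] that by simp
  hence "(P - (\<Sum>d<n. expand_at_theta (c d) * solution_numerator n d)) $ j = 0" if "j < n" for j
    using b[OF that] by (simp add: comb[OF that])
  thus ?thesis by blast
qed

section \<open>The Anderson--Thakur function\<close>

definition omega_partial :: "nat \<Rightarrow> 'a::field fls fps" where
  "omega_partial N = (\<Prod>i<N. inverse (1 - fps_const (inverse (theta ^ (CARD('a) ^ i))) * fps_X))"

lemma inverse_theta_power: "inverse (theta ^ e) = (fls_X ^ e :: 'a::field fls)"
  by (simp add: power_inverse fls_inverse_X_inv flip: power_inverse)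

lemma geometric_fps:
  "inverse (1 - fps_const c * fps_X) = Abs_fps (\<lambda>j. c ^ j :: 'b::field)"
proof -
  have "(1 - fps_const c * fps_X) * Abs_fps (\<lambda>j. c ^ j) = 1"
  proof (rule fps_ext)
    fix j show "((1 - fps_const c * fps_X) * Abs_fps (\<lambda>j. c ^ j)) $ j = (1 :: 'b fps) $ j"
      by (cases j) (simp_all add: left_diff_distrib mult.assoc)
  qed
  thus ?thesis by (rule fps_inverse_unique)
qed

lemma gauss_val_ge_omega_partial: "gauss_val_ge (omega_partial N :: 'a::{field, finite} fls fps) 0"
proof (induction N)
  case (Suc N)
  have "val_ge ((fls_X ^ e) ^ j :: 'a fls) (int j)" if "e \<ge> 1" for e j
  proof -
    have "val_ge ((fls_X ^ e) ^ j :: 'a fls) (int (e * j))"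
      by (auto simp: val_ge_def simp flip: power_mult)
    moreover have "int j \<le> int (e * j)" using that by (cases e) simp_all
    ultimately show ?thesis by (rule val_ge_mono)
  qed
  hence "gauss_val_ge (inverse (1 - fps_const (fls_X ^ (CARD('a) ^ N)) * fps_X) :: 'a fls fps) 0"
    by (simp add: geometric_fps gauss_val_ge_def)
  from gauss_val_ge_mult[OF Suc this] show ?case
    by (simp add: omega_partial_def inverse_theta_power)
qed (simp add: omega_partial_def)

text \<open>Consecutive partial products differ by the factor \<open>1 - t / \<theta>^(q^N)\<close>,
  which tends to 1.\<close>

lemma coeffwise_tendsto_omega:
  "coeffwise_tendsto omega_partial (omega_product :: 'a::{field, finite} fls fps)"
proof -
  have "\<exists>f. coeffwise_tendsto (omega_partial :: nat \<Rightarrow> 'a fls fps) f"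
  proof (rule coeffwise_tendsto_ex)
    fix j m
    show "\<forall>\<^sub>F N in sequentially. val_ge ((omega_partial (Suc N) - omega_partial N :: 'a fls fps) $ j) m"
      unfolding eventually_sequentially
    proof (intro exI allI impI)
      fix N assume N: "N \<ge> nat m"
      define u :: "'a fls fps" where "u = 1 - fps_const (fls_X ^ (CARD('a) ^ N)) * fps_X"
      have "omega_partial N = (omega_partial (Suc N) :: 'a fls fps) * u"
      proof -
        have "inverse u * u = 1" by (rule inverse_mult_eq_1) (simp add: u_def)
        thus ?thesis by (simp add: omega_partial_def inverse_theta_power u_def mult.assoc)
      qed
      hence "omega_partial (Suc N) - omega_partial N
          = (fps_const (fls_X ^ (CARD('a) ^ N)) * (fps_X * omega_partial (Suc N)) :: 'a fls fps)"
        by (simp add: u_def algebra_simps)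
      moreover have "gauss_val_ge (fps_const (fls_X ^ (CARD('a) ^ N)) * (fps_X * omega_partial (Suc N)) :: 'a fls fps)
          (int (CARD('a) ^ N) + (- 1 + 0))"
        by (intro gauss_val_ge_mult gauss_val_ge_const gauss_val_ge_X gauss_val_ge_omega_partial) (simp add: val_ge_def)
      \<comment> \<open>The strict inequality \<open>N < q^N\<close> absorbs the \<open>- 1\<close>
        contributed by \<open>fps_X\<close>.\<close>
      moreover have "m \<le> int (CARD('a) ^ N) + (- 1 + 0) + int j"
      proof -
        have "N < CARD('a) ^ N"
          using less_exp[of N] power_mono[OF card_field_ge_2[where ?'a = 'a], of N] by linarith
        thus ?thesis using N by linarith
      qed
      ultimately show "val_ge ((omega_partial (Suc N) - omega_partial N :: 'a fls fps) $ j) m"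
        unfolding gauss_val_ge_def by (metis val_ge_mono)
    qed
  qed
  then obtain f where f: "coeffwise_tendsto (omega_partial :: nat \<Rightarrow> 'a fls fps) f" ..
  from coeffwise_lim_eq[OF f] have "omega_product = f"
    by (simp add: omega_product_def omega_partial_def[abs_def])
  with f show ?thesis by simp
qed

lemma gauss_val_ge_omega_product: "gauss_val_ge (omega_product :: 'a::{field, finite} fls fps) 0"
  using gauss_val_ge_lim[OF coeffwise_tendsto_omega gauss_val_ge_omega_partial] .

text \<open>The twist moves each factor to the next one, so only the factor with index 0 is lost,
  and \<open>1 - t / \<theta>\<close> accounts for it.\<close>

lemma frob_twist_omega_product:
  "frob_twist omega_product = (1 - fps_const fls_X * fps_X) * (omega_product :: 'a::{field, finite} fls fps)"
proof -
  let ?g = "\<lambda>i. 1 - fps_const (fls_X ^ (CARD('a) ^ i)) * fps_X :: 'a fls fps"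
  have frob_g: "frob_twist (inverse (?g i)) = inverse (?g (Suc i))" for i
    by (subst frob_twist_inverse)
       (simp_all add: frob_twist_diff frob_twist_mult frob_twist_const mult.commute flip: power_mult)
  have "frob_twist (omega_partial N) = (\<Prod>i<N. inverse (?g (Suc i)))" for N
    by (induction N) (simp_all add: omega_partial_def inverse_theta_power frob_twist_mult frob_g)
  moreover have "?g 0 * (inverse (?g 0) * p) = p" for p
    by (subst mult.assoc[symmetric], subst inverse_mult_eq_1') simp_all
  hence "(\<Prod>i<N. inverse (?g (Suc i))) = ?g 0 * omega_partial (Suc N)" for N
    by (simp only: omega_partial_def inverse_theta_power prod.lessThan_Suc_shift)
  ultimately have "coeffwise_tendsto (\<lambda>N. ?g 0 * omega_partial (Suc N)) (frob_twist omega_product)"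
    using coeffwise_tendsto_frob_twist[OF coeffwise_tendsto_omega[where ?'a = 'a]] by simp
  moreover have "coeffwise_tendsto (\<lambda>N. ?g 0 * omega_partial (Suc N)) (?g 0 * omega_product)"
    by (intro coeffwise_tendsto_mult_left) (simp only: coeffwise_tendsto_Suc coeffwise_tendsto_omega)
  ultimately show ?thesis using coeffwise_tendsto_unique by fastforce
qed

section \<open>A generator of \<open>B^+\<close> over F[t]\<close>

lemma series_to_ac_mult: "series_to_ac (f * g) = series_to_ac f * series_to_ac g"
  by (rule fps_ext) (simp add: series_to_ac_def fps_mult_nth to_ac_sum)

lemma series_to_ac_inject: "series_to_ac f = series_to_ac g \<longleftrightarrow> f = g"
  by (auto simp: series_to_ac_def fps_eq_iff)

lemma series_to_ac_power: "series_to_ac (f ^ k) = series_to_ac f ^ k"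
proof (induction k)
  case 0
  show ?case by (rule fps_ext) (simp add: series_to_ac_def)
qed (simp add: series_to_ac_mult)

lemma series_to_ac_const: "series_to_ac (fps_const c) = fps_const (to_ac c)"
  by (rule fps_ext) (simp add: series_to_ac_def)

text \<open>Although \<open>lam\<close> need not lie in the base field, \<open>lam ^ n\<close> does
  when \<open>n = (q - 1) m\<close>: it is \<open>(- theta) ^ m\<close>. So the generator
  \<open>omega lam ^ n\<close> is a series over the base field. In the other case the generator is
  0.\<close>

lemma B_plus_cyclic:
  fixes lam :: "'a::{field, finite} fls alg_closure"
  assumes "lam ^ (CARD('a) - 1) = to_ac (- theta)"
  shows "\<exists>w. B_plus lam n = range (\<lambda>a. series_of_poly_t a * w) \<and>
    w \<in> tate_algebra \<and> frob_defect n w = 0"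
proof (cases "(CARD('a) - 1) dvd n")
  case True
  then obtain m where m: "n = (CARD('a) - 1) * m" by (elim dvdE)
  define w where "w = fps_const ((- theta) ^ m) * (omega_product :: 'a fls fps) ^ n"
  have "omega lam ^ n = fps_const (lam ^ n) * series_to_ac omega_product ^ n"
    by (simp add: omega_def power_mult_distrib fps_const_power)
  also have "lam ^ n = to_ac ((- theta) ^ m)"
    unfolding m by (simp only: power_mult assms to_ac_power)
  finally have "omega lam ^ n = series_to_ac w"
    by (simp add: w_def series_to_ac_mult series_to_ac_power series_to_ac_const)
  hence "B_plus lam n = range (\<lambda>a. series_of_poly_t a * w)"
    using True by (auto simp: B_plus_def series_to_ac_inject simp flip: series_to_ac_mult)
  moreover have "w \<in> tate_algebra"
  proof -
    have val: "val_ge ((- theta) ^ m :: 'a fls) (int m * - 1)" by (rule val_ge_power) simp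
    have "gauss_val_ge w (int m * - 1 + int n * 0)"
      unfolding w_def
      by (intro gauss_val_ge_mult gauss_val_ge_const gauss_val_ge_power gauss_val_ge_omega_product val)
    hence "val_ge (w $ i) (int i - int m)" for i by (simp add: gauss_val_ge_def algebra_simps)
    hence "val_ge (w $ i) k" if "i \<ge> nat (k + int m)" for i k
      by (rule val_ge_mono) (use that in linarith)
    thus ?thesis
      unfolding tate_algebra_iff eventually_sequentially by blast
  qed
  moreover have "frob_defect n w = 0"
  proof -
    have "frob_twist w = fps_const (((- theta) ^ m) ^ CARD('a)) * (1 - fps_const fls_X * fps_X) ^ n * omega_product ^ n"
      by (simp add: w_def frob_twist_mult frob_twist_const frob_twist_power frob_twist_omega_product
          power_mult_distrib mult.assoc)
    \<comment> \<open>From \<open>n = (q - 1) m\<close> the twist multiplies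
      \<open>(- theta) ^ m\<close> by \<open>(- theta) ^ n\<close>, which combines with
      \<open>(1 - t / \<theta>)^n\<close> to \<open>(t - \<theta>)^n\<close>.\<close>
    also have "((- theta) ^ m) ^ CARD('a) = (- theta) ^ m * (- theta :: 'a fls) ^ n"
    proof -
      have "m * CARD('a) = m + n"
        unfolding m using card_field_ge_2[where ?'a = 'a] by (cases "CARD('a)") (simp_all add: algebra_simps)
      thus ?thesis by (simp only: flip: power_mult power_add)
    qed
    also have "fps_const ((- theta) ^ m * (- theta) ^ n) * (1 - fps_const fls_X * fps_X) ^ n
        = fps_const ((- theta) ^ m) * (fps_const (- theta) * (1 - fps_const fls_X * fps_X :: 'a fls fps)) ^ n"
      by (simp only: fps_const_mult[symmetric] fps_const_power[symmetric] power_mult_distrib mult.assoc)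
    also have "fps_const (- theta) * (1 - fps_const fls_X * fps_X) = (t_minus_theta :: 'a fls fps)"
    proof -
      have "theta * fls_X = (1 :: 'a fls)" by (subst fls_inverse_X[symmetric]) simp
      thus ?thesis
        by (intro fps_ext) (auto simp: fps_X_def)
    qed
    finally show ?thesis by (simp only: frob_defect_def w_def mult_ac diff_self)
  qed
  ultimately show ?thesis by blast
next
  case False
  thus ?thesis
    using poly_theta_t_subset_tate_algebra poly_theta_t_0
    by (intro exI[of _ 0]) (auto simp: B_plus_def)
qed

section \<open>Quotients of submodules of a ring\<close>

text \<open>Used twice, for the motivic cohomology over F[t] and for the Hodge-Pink side over
  \<open>K_infty\<close>. In both the addition is that of a ring type, so cosets can be handled by
  ordinary subtraction.\<close>

locale type_module_quotient =
  fixes M :: "('k::comm_ring_1, 'b::comm_ring_1) module" and N :: "'b set"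
  assumes add_M: "add M = (+)" and zero_M: "zero M = 0"
    and M_diff: "\<And>x y. x \<in> carrier M \<Longrightarrow> y \<in> carrier M \<Longrightarrow> x - y \<in> carrier M"
    and M_smult: "\<And>c x. x \<in> carrier M \<Longrightarrow> c \<odot>\<^bsub>M\<^esub> x \<in> carrier M"
    and smult_diff: "\<And>c x y. x \<in> carrier M \<Longrightarrow> y \<in> carrier M \<Longrightarrow> c \<odot>\<^bsub>M\<^esub> (x - y) = c \<odot>\<^bsub>M\<^esub> x - c \<odot>\<^bsub>M\<^esub> y"
    and N_subset: "N \<subseteq> carrier M" and N_0: "0 \<in> N"
    and N_diff: "\<And>x y. x \<in> N \<Longrightarrow> y \<in> N \<Longrightarrow> x - y \<in> N"
    and N_smult: "\<And>c x. x \<in> N \<Longrightarrow> c \<odot>\<^bsub>M\<^esub> x \<in> N"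
begin

abbreviation coset :: "'b \<Rightarrow> 'b set" where
  "coset x \<equiv> N +>\<^bsub>M\<^esub> x"

abbreviation Q :: "('k, 'b set) module" where
  "Q \<equiv> quot_module M N"

lemma M_0: "0 \<in> carrier M"
  using N_0 N_subset by blast

lemma M_uminus: "x \<in> carrier M \<Longrightarrow> - x \<in> carrier M"
  using M_diff[OF M_0, of x] by simp

lemma M_add: "x \<in> carrier M \<Longrightarrow> y \<in> carrier M \<Longrightarrow> x + y \<in> carrier M"
  using M_diff[OF _ M_uminus, of x y] by simp

lemma N_uminus: "x \<in> N \<Longrightarrow> - x \<in> N"
  using N_diff[OF N_0, of x] by simp

lemma N_add: "x \<in> N \<Longrightarrow> y \<in> N \<Longrightarrow> x + y \<in> N"
  using N_diff[OF _ N_uminus, of x y] by simp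

lemma M_of_int_mult:
  assumes "x \<in> carrier M"
  shows "of_int k * x \<in> carrier M"
proof (induction k rule: int_induct[of _ 0])
  case (step1 i)
  thus ?case using M_add[OF _ assms] by (simp add: ring_distribs)
next
  case (step2 i)
  thus ?case using M_diff[OF _ assms] by (simp add: ring_distribs)
qed (simp add: M_0)

lemma M_sum: "(\<And>i. i \<in> I \<Longrightarrow> f i \<in> carrier M) \<Longrightarrow> (\<Sum>i\<in>I. f i) \<in> carrier M"
  by (induction I rule: infinite_finite_induct) (auto intro: M_add M_0)

lemma N_sum: "(\<And>i. i \<in> I \<Longrightarrow> f i \<in> N) \<Longrightarrow> (\<Sum>i\<in>I. f i) \<in> N"
  by (induction I rule: infinite_finite_induct) (auto intro: N_add N_0)

lemma coset_def: "coset x = (\<lambda>b. b + x) ` N"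
  by (auto simp: a_r_coset_def r_coset_def add_M)

lemma coset_0: "coset 0 = N"
  by (simp add: coset_def)

lemma mem_coset_iff: "y \<in> coset x \<longleftrightarrow> y - x \<in> N"
proof
  assume "y - x \<in> N"
  thus "y \<in> coset x" unfolding coset_def by (intro image_eqI[of _ _ "y - x"]) simp_all
qed (auto simp: coset_def)

lemma coset_eq_iff: "coset x = coset y \<longleftrightarrow> x - y \<in> N"
proof
  assume "coset x = coset y"
  moreover have "x \<in> coset x" by (simp add: mem_coset_iff N_0)
  ultimately show "x - y \<in> N" by (simp add: mem_coset_iff)
next
  assume *: "x - y \<in> N"
  show "coset x = coset y"
  proof (intro Set.set_eqI iffI)
    fix z assume "z \<in> coset x"
    with N_add[OF _ *, of "z - x"] show "z \<in> coset y" by (simp add: mem_coset_iff)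
  next
    fix z assume "z \<in> coset y"
    with N_diff[OF _ *, of "z - y"] show "z \<in> coset x" by (simp add: mem_coset_iff)
  qed
qed

lemma carrier_Q: "carrier Q = coset ` carrier M"
  by (auto simp: quot_module_def A_RCOSETS_def RCOSETS_def a_r_coset_def)

lemma zero_Q: "\<zero>\<^bsub>Q\<^esub> = N"
  by (simp add: quot_module_def)

lemma add_Q: "coset x \<oplus>\<^bsub>Q\<^esub> coset y = coset (x + y)"
proof -
  have "coset x \<oplus>\<^bsub>Q\<^esub> coset y = {a + b | a b. a \<in> coset x \<and> b \<in> coset y}"
    by (auto simp: quot_module_def set_add_def set_mult_def add_M)
  also have "\<dots> = coset (x + y)"
  proof (intro Set.set_eqI iffI)
    fix z assume "z \<in> {a + b | a b. a \<in> coset x \<and> b \<in> coset y}"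
    then obtain a b where "z = a + b" "a - x \<in> N" "b - y \<in> N" by (auto simp: mem_coset_iff)
    with N_add[of "a - x" "b - y"] show "z \<in> coset (x + y)" by (simp add: mem_coset_iff algebra_simps)
  next
    fix z assume "z \<in> coset (x + y)"
    hence "z - y \<in> coset x" "y \<in> coset y" by (simp_all add: mem_coset_iff algebra_simps N_0)
    thus "z \<in> {a + b | a b. a \<in> coset x \<and> b \<in> coset y}"
      by (intro CollectI exI[of _ "z - y"] exI[of _ y]) simp
  qed
  finally show ?thesis .
qed

text \<open>The union that defines the action collapses because scalars preserve \<open>N\<close>,
  so that all members of a coset give the same coset.\<close>

lemma smult_Q:
  assumes "x \<in> carrier M"
  shows "c \<odot>\<^bsub>Q\<^esub> coset x = coset (c \<odot>\<^bsub>M\<^esub> x)"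
proof -
  have *: "coset (c \<odot>\<^bsub>M\<^esub> y) = coset (c \<odot>\<^bsub>M\<^esub> x)" if "y \<in> coset x" for y
  proof -
    have y: "y - x \<in> N" using that by (simp add: mem_coset_iff)
    hence "y \<in> carrier M" using M_add[OF _ assms, of "y - x"] N_subset by auto
    with N_smult[OF y, of c] smult_diff[of y x c] assms show ?thesis by (simp add: coset_eq_iff)
  qed
  have "x \<in> coset x" by (simp add: mem_coset_iff N_0)
  hence "coset x \<noteq> {}" by blast
  hence "(\<Union>y\<in>coset x. coset (c \<odot>\<^bsub>M\<^esub> y)) = coset (c \<odot>\<^bsub>M\<^esub> x)"
    using * by (rule SUP_eq_const)
  thus ?thesis by (simp add: quot_module_def)
qed

lemma comm_group_Q: "comm_group (add_monoid Q)"
proof (rule comm_groupI)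
  fix C assume "C \<in> carrier (add_monoid Q)"
  then obtain x where x: "C = coset x" "x \<in> carrier M" by (auto simp: carrier_Q)
  show "\<one>\<^bsub>add_monoid Q\<^esub> \<otimes>\<^bsub>add_monoid Q\<^esub> C = C"
    using add_Q[of 0 x] by (simp add: x zero_Q coset_0)
  show "\<exists>D\<in>carrier (add_monoid Q). D \<otimes>\<^bsub>add_monoid Q\<^esub> C = \<one>\<^bsub>add_monoid Q\<^esub>"
    using M_uminus[OF x(2)] by (intro bexI[of _ "coset (- x)"]) (auto simp: x add_Q zero_Q coset_0 carrier_Q)
next
  show "\<one>\<^bsub>add_monoid Q\<^esub> \<in> carrier (add_monoid Q)"
    using M_0 by (auto simp: carrier_Q zero_Q intro!: image_eqI[of _ _ 0] simp: coset_0)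
qed (auto simp: carrier_Q add_Q add_ac intro: M_add)

lemma add_pow_Q:
  assumes "x \<in> carrier M"
  shows "add_pow Q (k :: int) (coset x) = coset (of_int k * x)"
proof -
  interpret comm_group "add_monoid Q" by (rule comm_group_Q)
  have nat: "add_pow Q (int k) (coset x) = coset (of_nat k * x)" for k
  proof (induction k)
    case 0
    show ?case using zero_Q by (simp add: add_pow_def coset_0)
  next
    case (Suc k)
    have "add_pow Q (int (Suc k)) (coset x) = add_pow Q (int k) (coset x) \<oplus>\<^bsub>Q\<^esub> coset x"
      unfolding add_pow_def int_pow_int by simp
    thus ?case by (simp only: Suc add_Q) (simp add: algebra_simps)
  qed
  show ?thesis
  proof (cases k)
    case (nonneg m)
    thus ?thesis using nat[of m] by simp
  next
    case (neg m)
    have c: "coset x \<in> carrier (add_monoid Q)" "coset (of_int k * x) \<in> carrier (add_monoid Q)"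
      "coset (of_nat (Suc m) * x) \<in> carrier (add_monoid Q)"
      using assms M_of_int_mult[OF assms, of k] M_of_int_mult[OF assms, of "int (Suc m)"] by (auto simp: carrier_Q)
    have "coset (of_int k * x) \<otimes>\<^bsub>add_monoid Q\<^esub> coset (of_nat (Suc m) * x) = \<one>\<^bsub>add_monoid Q\<^esub>"
      by (simp add: add_Q zero_Q coset_0 neg algebra_simps)
    hence "inv\<^bsub>add_monoid Q\<^esub> coset (of_nat (Suc m) * x) = coset (of_int k * x)"
      by (rule inv_equality) (use c in auto)
    moreover have "add_pow Q k (coset x) = inv\<^bsub>add_monoid Q\<^esub> add_pow Q (int (Suc m)) (coset x)"
      using int_pow_neg[OF c(1), of "int (Suc m)"] by (simp only: neg add_pow_def)
    ultimately show ?thesis by (simp only: nat)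
  qed
qed

lemma finsum_Q:
  assumes "finite I" "\<And>i. i \<in> I \<Longrightarrow> h i \<in> carrier M"
  shows "finsum Q (\<lambda>i. coset (h i)) I = coset (\<Sum>i\<in>I. h i)"
proof -
  interpret comm_group "add_monoid Q" by (rule comm_group_Q)
  show ?thesis
    using assms
  proof (induction I rule: finite_induct)
    case empty
    have "finprod (add_monoid Q) (\<lambda>i. coset (h i)) {} = \<one>\<^bsub>add_monoid Q\<^esub>"
      by (rule finprod_empty)
    hence "finsum Q (\<lambda>i. coset (h i)) {} = \<zero>\<^bsub>Q\<^esub>"
      by (simp only: finsum_def monoid.select_convs)
    thus ?case by (simp only: zero_Q coset_0 sum.empty)
  next
    case (insert i I)
    have "finprod (add_monoid Q) (\<lambda>i. coset (h i)) (insert i I)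
      = coset (h i) \<otimes>\<^bsub>add_monoid Q\<^esub> finprod (add_monoid Q) (\<lambda>i. coset (h i)) I"
      using insert by (intro finprod_insert) (auto simp: carrier_Q)
    with insert show ?case by (simp add: finsum_def add_Q)
  qed
qed

end

section \<open>Maps out of a base change\<close>

text \<open>The map \<open>f\<close> takes cosets as values; \<open>h\<close> picks representatives
  of them, so that formal sums can be evaluated in \<open>M\<close> itself. Being built from
  choices, \<open>h\<close> is additive and linear only modulo \<open>N\<close>.\<close>

locale base_change_map = type_module_quotient M N
  for M :: "('k::comm_ring_1, 'b::comm_ring_1) module" and N +
  fixes E :: "('r::comm_ring_1, 'm) module" and \<phi> :: "'r \<Rightarrow> 'k"
    and f :: "'m \<Rightarrow> 'b set" and h :: "'m \<Rightarrow> 'b"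
  assumes smult_mult: "\<And>c d x. x \<in> carrier M \<Longrightarrow> (c * d) \<odot>\<^bsub>M\<^esub> x = c \<odot>\<^bsub>M\<^esub> (d \<odot>\<^bsub>M\<^esub> x)"
    and smult_add_left: "\<And>c d x. x \<in> carrier M \<Longrightarrow> (c + d) \<odot>\<^bsub>M\<^esub> x = c \<odot>\<^bsub>M\<^esub> x + d \<odot>\<^bsub>M\<^esub> x"
    and E_add: "\<And>x y. x \<in> carrier E \<Longrightarrow> y \<in> carrier E \<Longrightarrow> x \<oplus>\<^bsub>E\<^esub> y \<in> carrier E"
    and E_smult: "\<And>r x. x \<in> carrier E \<Longrightarrow> r \<odot>\<^bsub>E\<^esub> x \<in> carrier E"
    and h_M: "\<And>x. x \<in> carrier E \<Longrightarrow> h x \<in> carrier M"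
    and f_eq: "\<And>x. x \<in> carrier E \<Longrightarrow> f x = N +>\<^bsub>M\<^esub> h x"
    and h_add: "\<And>x y. x \<in> carrier E \<Longrightarrow> y \<in> carrier E \<Longrightarrow> h (x \<oplus>\<^bsub>E\<^esub> y) - h x - h y \<in> N"
    and h_smult: "\<And>r x. x \<in> carrier E \<Longrightarrow> h (r \<odot>\<^bsub>E\<^esub> x) - \<phi> r \<odot>\<^bsub>M\<^esub> h x \<in> N"
begin

abbreviation R :: "'r ring" where "R \<equiv> ring_of_type_algebra"
abbreviation K :: "'k ring" where "K \<equiv> ring_of_type_algebra"

definition G :: "('m \<times> 'k \<Rightarrow>\<^sub>0 int) monoid" where
  "G = free_Abelian_group (carrier E \<times> UNIV)"

definition T :: "('m \<times> 'k \<Rightarrow>\<^sub>0 int) set" where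
  "T = generate G (tensor_relations R \<phi> K E)"

lemma carrier_K [simp]: "carrier K = UNIV" and carrier_R [simp]: "carrier R = UNIV"
  and add_K [simp]: "a \<oplus>\<^bsub>K\<^esub> b = a + b" and mult_K [simp]: "a \<otimes>\<^bsub>K\<^esub> b = a * b"
  by (simp_all add: ring_of_type_algebra_def)

lemma carrier_G: "u \<in> carrier G \<longleftrightarrow> Poly_Mapping.keys u \<subseteq> carrier E \<times> UNIV"
  by (simp add: G_def)

lemma mult_G [simp]: "u \<otimes>\<^bsub>G\<^esub> v = u + v" and one_G [simp]: "\<one>\<^bsub>G\<^esub> = 0"
  by (simp_all add: G_def)

lemma group_G: "group G"
  by (simp add: G_def)

lemma inv_G: "u \<in> carrier G \<Longrightarrow> inv\<^bsub>G\<^esub> u = - u"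
  by (simp add: G_def)

lemma G_diff: "u \<in> carrier G \<Longrightarrow> v \<in> carrier G \<Longrightarrow> u - v \<in> carrier G"
  unfolding carrier_G using keys_diff[of u v] by blast

lemma G_add: "u \<in> carrier G \<Longrightarrow> v \<in> carrier G \<Longrightarrow> u + v \<in> carrier G"
  using group.subgroup_self[OF group_G] subgroup.m_closed mult_G by metis

lemma frag_of_G: "x \<in> carrier E \<Longrightarrow> frag_of (x, a) \<in> carrier G"
  by (simp add: carrier_G)

lemma relations_G: "tensor_relations R \<phi> K E \<subseteq> carrier G"
  unfolding tensor_relations_def by (auto intro!: G_diff frag_of_G E_add E_smult)

lemma subgroup_T: "subgroup T G"
  unfolding T_def by (rule group.generate_is_subgroup[OF group_G relations_G])

lemma T_G: "u \<in> T \<Longrightarrow> u \<in> carrier G"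
  using subgroup.subset[OF subgroup_T] by blast

lemma T_0: "0 \<in> T"
  using subgroup.one_closed[OF subgroup_T] by simp

lemma T_add: "u \<in> T \<Longrightarrow> v \<in> T \<Longrightarrow> u + v \<in> T"
  using subgroup.m_closed[OF subgroup_T] by fastforce

lemma T_uminus: "u \<in> T \<Longrightarrow> - u \<in> T"
  using subgroup.m_inv_closed[OF subgroup_T, of u] by (simp add: inv_G T_G)

lemma T_diff: "u \<in> T \<Longrightarrow> v \<in> T \<Longrightarrow> u - v \<in> T"
  using T_add[OF _ T_uminus, of u v] by simp

text \<open>Closure under differences covers sums and inverses at once, which leaves the three
  bilinearity relations to be checked.\<close>

lemma T_induct [consumes 1, case_names zero diff add_left add_right smult]:
  assumes "u \<in> T" "P 0" "\<And>u v. u \<in> T \<Longrightarrow> v \<in> T \<Longrightarrow> P u \<Longrightarrow> P v \<Longrightarrow> P (u - v)"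
    "\<And>x y a. x \<in> carrier E \<Longrightarrow> y \<in> carrier E \<Longrightarrow> P (frag_of (x \<oplus>\<^bsub>E\<^esub> y, a) - frag_of (x, a) - frag_of (y, a))"
    "\<And>x a b. x \<in> carrier E \<Longrightarrow> P (frag_of (x, a + b) - frag_of (x, a) - frag_of (x, b))"
    "\<And>r x a. x \<in> carrier E \<Longrightarrow> P (frag_of (r \<odot>\<^bsub>E\<^esub> x, a) - frag_of (x, \<phi> r * a))"
  shows "P u"
proof -
  have rel: "P u" if "u \<in> tensor_relations R \<phi> K E" for u
    using that assms(4-6) unfolding tensor_relations_def by auto
  have rel_T: "u \<in> T" if "u \<in> tensor_relations R \<phi> K E" for u
    unfolding T_def using that by (rule generate.incl)
  have uminus: "P (- u)" if "u \<in> T" "P u" for u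
    using assms(3)[OF T_0 that(1) assms(2) that(2)] by simp
  from assms(1)[unfolded T_def] show ?thesis
  proof (induction u rule: generate.induct)
    case (inv u)
    thus ?case using relations_G uminus[OF rel_T rel] by (auto simp: inv_G)
  next
    case (eng u v)
    hence "P (u - - v)"
      by (intro assms(3) uminus T_uminus) (simp_all add: T_def)
    thus ?case by simp
  qed (use assms(2) rel in simp_all)
qed

lemma T_add_left: "x \<in> carrier E \<Longrightarrow> y \<in> carrier E \<Longrightarrow> frag_of (x \<oplus>\<^bsub>E\<^esub> y, a) - frag_of (x, a) - frag_of (y, a) \<in> T"
  unfolding T_def by (rule generate.incl) (force simp: tensor_relations_def)

lemma T_add_right: "x \<in> carrier E \<Longrightarrow> frag_of (x, a + b) - frag_of (x, a) - frag_of (x, b) \<in> T"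
  unfolding T_def by (rule generate.incl) (force simp: tensor_relations_def)

lemma T_smult: "x \<in> carrier E \<Longrightarrow> frag_of (r \<odot>\<^bsub>E\<^esub> x, a) - frag_of (x, \<phi> r * a) \<in> T"
  unfolding T_def by (rule generate.incl) (force simp: tensor_relations_def)

lemma T_diff_right:
  assumes "x \<in> carrier E"
  shows "frag_of (x, a - b) - (frag_of (x, a) - frag_of (x, b)) \<in> T"
  using T_uminus[OF T_add_right[OF assms, of "a - b" b]] by (simp add: algebra_simps)

text \<open>The lift to \<open>M\<close> of the map on formal sums. It is exactly additive, unlike
  \<open>h\<close>, and by \<open>\<Phi>_T\<close> it descends to the tensor product modulo
  \<open>N\<close>.\<close>

definition \<Phi> :: "('m \<times> 'k \<Rightarrow>\<^sub>0 int) \<Rightarrow> 'b" where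
  "\<Phi> u = (\<Sum>(x, a)\<in>Poly_Mapping.keys u. of_int (Poly_Mapping.lookup u (x, a)) * (a \<odot>\<^bsub>M\<^esub> h x))"

lemma \<Phi>_eq_sum:
  assumes "finite S" "Poly_Mapping.keys u \<subseteq> S"
  shows "\<Phi> u = (\<Sum>(x, a)\<in>S. of_int (Poly_Mapping.lookup u (x, a)) * (a \<odot>\<^bsub>M\<^esub> h x))"
  unfolding \<Phi>_def using assms
  by (intro sum.mono_neutral_left) (auto simp: in_keys_iff)

lemma \<Phi>_0 [simp]: "\<Phi> 0 = 0"
  by (simp add: \<Phi>_def)

lemma \<Phi>_diff: "\<Phi> (u - v) = \<Phi> u - \<Phi> v"
proof -
  let ?S = "Poly_Mapping.keys u \<union> Poly_Mapping.keys v"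
  have "Poly_Mapping.keys (u - v) \<subseteq> ?S" by (rule keys_diff)
  thus ?thesis
    by (simp add: \<Phi>_eq_sum[of ?S] lookup_minus sum_subtractf[symmetric] algebra_simps case_prod_unfold)
qed

lemma \<Phi>_add: "\<Phi> (u + v) = \<Phi> u + \<Phi> v"
  using \<Phi>_diff[of "u + v" v] by simp

lemma \<Phi>_sum: "\<Phi> (\<Sum>i\<in>I. u i) = (\<Sum>i\<in>I. \<Phi> (u i))"
  by (induction I rule: infinite_finite_induct) (simp_all add: \<Phi>_add)

lemma \<Phi>_frag_of [simp]: "\<Phi> (frag_of (x, a)) = a \<odot>\<^bsub>M\<^esub> h x"
  by (simp add: \<Phi>_def)

lemma \<Phi>_M: "u \<in> carrier G \<Longrightarrow> \<Phi> u \<in> carrier M"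
  unfolding \<Phi>_def carrier_G by (intro M_sum) (auto intro!: M_of_int_mult M_smult h_M)

lemma \<Phi>_T: "u \<in> T \<Longrightarrow> \<Phi> u \<in> N"
proof (induction u rule: T_induct)
  case (add_left x y a)
  have "a \<odot>\<^bsub>M\<^esub> (h (x \<oplus>\<^bsub>E\<^esub> y) - h x - h y) = a \<odot>\<^bsub>M\<^esub> h (x \<oplus>\<^bsub>E\<^esub> y) - a \<odot>\<^bsub>M\<^esub> h x - a \<odot>\<^bsub>M\<^esub> h y"
    using add_left by (simp add: smult_diff h_M E_add M_diff)
  thus ?case using N_smult[OF h_add[OF add_left], of a] by (simp add: \<Phi>_diff)
next
  case (smult r x a)
  have "a \<odot>\<^bsub>M\<^esub> (h (r \<odot>\<^bsub>E\<^esub> x) - \<phi> r \<odot>\<^bsub>M\<^esub> h x) = a \<odot>\<^bsub>M\<^esub> h (r \<odot>\<^bsub>E\<^esub> x) - (\<phi> r * a) \<odot>\<^bsub>M\<^esub> h x"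
    using smult by (simp add: smult_diff smult_mult h_M E_smult M_smult mult.commute)
  thus ?case using N_smult[OF h_smult[OF smult], of a r] by (simp add: \<Phi>_diff)
qed (auto simp: \<Phi>_diff smult_add_left h_M N_0 intro: N_diff)

definition scale :: "'k \<Rightarrow> ('m \<times> 'k \<Rightarrow>\<^sub>0 int) \<Rightarrow> ('m \<times> 'k \<Rightarrow>\<^sub>0 int)" where
  "scale c = frag_extend (\<lambda>(x, a). frag_of (x, c * a))"

lemma scale_simps: "scale c 0 = 0" "scale c (u - v) = scale c u - scale c v" "scale c (u + v) = scale c u + scale c v"
  "scale c (frag_of (x, a)) = frag_of (x, c * a)"
  by (simp_all add: scale_def frag_extend_diff frag_extend_add)

text \<open>Both sides are additive in \<open>u\<close>, so generators suffice; there the claim is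
  associativity of the scalar action.\<close>

lemma scale_G_\<Phi>:
  assumes "u \<in> carrier G"
  shows "scale c u \<in> carrier G \<and> \<Phi> (scale c u) = c \<odot>\<^bsub>M\<^esub> \<Phi> u"
  using assms[unfolded carrier_G]
proof (rule free_Abelian_group_induct)
  show "scale c 0 \<in> carrier G \<and> \<Phi> (scale c 0) = c \<odot>\<^bsub>M\<^esub> \<Phi> 0"
    using smult_diff[OF M_0 M_0, of c] by (simp add: scale_simps carrier_G)
next
  fix u v
  assume "Poly_Mapping.keys u \<subseteq> carrier E \<times> UNIV" "Poly_Mapping.keys v \<subseteq> carrier E \<times> UNIV"
    and "scale c u \<in> carrier G \<and> \<Phi> (scale c u) = c \<odot>\<^bsub>M\<^esub> \<Phi> u"
    and "scale c v \<in> carrier G \<and> \<Phi> (scale c v) = c \<odot>\<^bsub>M\<^esub> \<Phi> v"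
  thus "scale c (u - v) \<in> carrier G \<and> \<Phi> (scale c (u - v)) = c \<odot>\<^bsub>M\<^esub> \<Phi> (u - v)"
    using G_diff[of "scale c u" "scale c v"] smult_diff[OF \<Phi>_M \<Phi>_M, of u v c]
    by (simp add: scale_simps \<Phi>_diff carrier_G)
next
  fix p :: "'m \<times> 'k" assume "p \<in> carrier E \<times> UNIV"
  then obtain x a where "p = (x, a)" "x \<in> carrier E" by auto
  thus "scale c (frag_of p) \<in> carrier G \<and> \<Phi> (scale c (frag_of p)) = c \<odot>\<^bsub>M\<^esub> \<Phi> (frag_of p)"
    by (simp add: scale_simps smult_mult h_M frag_of_G)
qed

lemma scale_T: "u \<in> T \<Longrightarrow> scale c u \<in> T"
proof (induction u rule: T_induct)
  case (smult r x a)
  thus ?case using T_smult[of x r "c * a"] by (simp add: scale_simps mult_ac)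
qed (simp_all add: scale_simps T_0 T_diff T_add_left T_add_right ring_distribs)

abbreviation tcoset :: "('m \<times> 'k \<Rightarrow>\<^sub>0 int) \<Rightarrow> ('m \<times> 'k \<Rightarrow>\<^sub>0 int) set" where
  "tcoset u \<equiv> T #>\<^bsub>G\<^esub> u"

lemma tcoset_def: "tcoset u = (\<lambda>r. r + u) ` T"
  by (auto simp: r_coset_def)

lemma mem_tcoset_iff: "v \<in> tcoset u \<longleftrightarrow> v - u \<in> T"
proof
  assume "v - u \<in> T"
  thus "v \<in> tcoset u" unfolding tcoset_def by (intro image_eqI[of _ _ "v - u"]) simp_all
qed (auto simp: tcoset_def)

lemma tcoset_eqI: "u - v \<in> T \<Longrightarrow> tcoset u = tcoset v"
proof (intro Set.set_eqI iffI)
  fix w assume *: "u - v \<in> T"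
  {
    assume "w \<in> tcoset u"
    with T_add[OF _ *, of "w - u"] show "w \<in> tcoset v" by (simp add: mem_tcoset_iff)
  }
  {
    assume "w \<in> tcoset v"
    with T_diff[OF _ *, of "w - v"] show "w \<in> tcoset u" by (simp add: mem_tcoset_iff)
  }
qed

lemma base_change_eq:
  "carrier (base_change R \<phi> K E) = tcoset ` carrier G"
  "add (base_change R \<phi> K E) = set_mult G"
  "C \<in> carrier (base_change R \<phi> K E) \<Longrightarrow>
    c \<odot>\<^bsub>base_change R \<phi> K E\<^esub> C = (\<Union>u\<in>C. tcoset (scale c u))"
  unfolding base_change_def Let_def carrier_K carrier_R
  by (auto simp: T_def G_def scale_def FactGroup_def RCOSETS_def)

lemma add_tcoset: "tcoset u <#>\<^bsub>G\<^esub> tcoset v = tcoset (u + v)"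
proof (intro Set.set_eqI iffI)
  fix w assume "w \<in> tcoset u <#>\<^bsub>G\<^esub> tcoset v"
  then obtain a b where "w = a + b" "a - u \<in> T" "b - v \<in> T"
    by (auto simp: set_mult_def mem_tcoset_iff)
  with T_add[of "a - u" "b - v"] show "w \<in> tcoset (u + v)" by (simp add: mem_tcoset_iff algebra_simps)
next
  fix w assume "w \<in> tcoset (u + v)"
  hence "w - v \<in> tcoset u" "v \<in> tcoset v" by (simp_all add: mem_tcoset_iff algebra_simps T_0)
  thus "w \<in> tcoset u <#>\<^bsub>G\<^esub> tcoset v"
    unfolding set_mult_def by (intro UN_I[of "w - v"] UN_I[of v]) simp_all
qed

lemma smult_tcoset:
  assumes "u \<in> carrier G"
  shows "c \<odot>\<^bsub>base_change R \<phi> K E\<^esub> tcoset u = tcoset (scale c u)"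
proof -
  have *: "tcoset (scale c v) = tcoset (scale c u)" if "v \<in> tcoset u" for v
    using scale_T[of "v - u" c] that by (intro tcoset_eqI) (simp add: mem_tcoset_iff scale_simps)
  have "u \<in> tcoset u" by (simp add: mem_tcoset_iff T_0)
  hence "tcoset u \<noteq> {}" by blast
  hence "(\<Union>v\<in>tcoset u. tcoset (scale c v)) = tcoset (scale c u)"
    using * by (rule SUP_eq_const)
  thus ?thesis using assms by (simp add: base_change_eq)
qed

text \<open>Links the finite sum of cosets in the definition to a sum in \<open>M\<close>; it is
  constant on a coset because \<open>\<Phi>\<close> maps relations into \<open>N\<close>.\<close>

lemma base_change_lift_tcoset:
  assumes "u \<in> carrier G"
  shows "base_change_lift Q f (tcoset u) = coset (\<Phi> u)"
proof -
  have *: "finsum Q (\<lambda>(x, a). add_pow Q (Poly_Mapping.lookup v (x, a)) (a \<odot>\<^bsub>Q\<^esub> f x)) (Poly_Mapping.keys v)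
      = coset (\<Phi> v)" if v: "v \<in> carrier G" for v
  proof -
    let ?t = "\<lambda>(x, a). of_int (Poly_Mapping.lookup v (x, a)) * (a \<odot>\<^bsub>M\<^esub> h x)"
    have t: "?t p \<in> carrier M" if "p \<in> Poly_Mapping.keys v" for p
      using v that unfolding carrier_G by (auto intro!: M_of_int_mult M_smult h_M)
    have "(\<lambda>(x, a). add_pow Q (Poly_Mapping.lookup v (x, a)) (a \<odot>\<^bsub>Q\<^esub> f x)) p = coset (?t p)"
      if "p \<in> Poly_Mapping.keys v" for p
    proof (cases p)
      case (Pair x a)
      with v that have "x \<in> carrier E" by (auto simp: carrier_G)
      with Pair show ?thesis by (simp add: f_eq smult_Q h_M add_pow_Q M_smult)
    qed
    hence "finsum Q (\<lambda>(x, a). add_pow Q (Poly_Mapping.lookup v (x, a)) (a \<odot>\<^bsub>Q\<^esub> f x)) (Poly_Mapping.keys v)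
        = finsum Q (\<lambda>p. coset (?t p)) (Poly_Mapping.keys v)"
      unfolding finsum_def using t
      by (intro comm_monoid.finprod_cong comm_group.axioms(1)[OF comm_group_Q])
         (auto simp: carrier_Q simp_implies_def)
    also have "\<dots> = coset (\<Phi> v)"
      using t by (subst finsum_Q) (auto simp: \<Phi>_def)
    finally show ?thesis .
  qed
  let ?F = "\<lambda>v. finsum Q (\<lambda>(x, a). add_pow Q (Poly_Mapping.lookup v (x, a)) (a \<odot>\<^bsub>Q\<^esub> f x)) (Poly_Mapping.keys v)"
  have const: "?F v = ?F u" if "v \<in> tcoset u" for v
  proof -
    have v: "v - u \<in> T" using that by (simp add: mem_tcoset_iff)
    have "coset (\<Phi> v) = coset (\<Phi> u)" using \<Phi>_T[OF v] by (simp add: coset_eq_iff \<Phi>_diff)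
    moreover have vG: "v \<in> carrier G" using G_add[OF T_G[OF v] assms] by simp
    ultimately show ?thesis by (simp only: *[OF vG] *[OF assms])
  qed
  have "tcoset u \<noteq> {}" using T_0 by (auto simp: tcoset_def)
  hence "the_elem (?F ` tcoset u) = ?F u"
    using const by (rule the_elem_image_unique)
  thus ?thesis using *[OF assms] by (simp only: base_change_lift_def quot_lift_def)
qed

text \<open>Bijectivity on cosets is restated for formal sums and their values modulo
  \<open>N\<close>, with no cosets left in the two conditions.\<close>

theorem base_change_lift_iso:
  assumes inj: "\<And>u. u \<in> carrier G \<Longrightarrow> \<Phi> u \<in> N \<Longrightarrow> u \<in> T"
    and surj: "\<And>y. y \<in> carrier M \<Longrightarrow> \<exists>u\<in>carrier G. y - \<Phi> u \<in> N"
  shows "base_change_lift Q f \<in> module_iso K (base_change R \<phi> K E) Q"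
proof -
  let ?B = "base_change R \<phi> K E" and ?l = "base_change_lift Q f"
  have hom: "?l \<in> hom (add_monoid ?B) (add_monoid Q)"
  proof (rule homI)
    fix C D assume "C \<in> carrier (add_monoid ?B)" "D \<in> carrier (add_monoid ?B)"
    then obtain u v where "C = tcoset u" "D = tcoset v" "u \<in> carrier G" "v \<in> carrier G"
      by (auto simp: base_change_eq)
    thus "?l (C \<otimes>\<^bsub>add_monoid ?B\<^esub> D) = ?l C \<otimes>\<^bsub>add_monoid Q\<^esub> ?l D"
      by (simp add: base_change_eq add_tcoset base_change_lift_tcoset G_add add_Q \<Phi>_add)
  qed (auto simp: base_change_eq base_change_lift_tcoset carrier_Q \<Phi>_M)
  have "inj_on ?l (carrier ?B)"
  proof (rule inj_onI)
    fix C D assume CD: "C \<in> carrier ?B" "D \<in> carrier ?B" "?l C = ?l D"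
    then obtain u v where uv: "C = tcoset u" "D = tcoset v" "u \<in> carrier G" "v \<in> carrier G"
      by (auto simp: base_change_eq)
    with CD(3) have "\<Phi> (u - v) \<in> N"
      by (simp add: base_change_lift_tcoset coset_eq_iff \<Phi>_diff)
    with uv show "C = D" by (auto intro!: tcoset_eqI inj G_diff)
  qed
  moreover have "?l ` carrier ?B = carrier Q"
  proof
    show "carrier Q \<subseteq> ?l ` carrier ?B"
    proof
      fix C assume "C \<in> carrier Q"
      then obtain y where y: "C = coset y" "y \<in> carrier M" by (auto simp: carrier_Q)
      from surj[OF y(2)] obtain u where u: "u \<in> carrier G" "y - \<Phi> u \<in> N" by blast
      hence "C = ?l (tcoset u)" by (simp add: y base_change_lift_tcoset coset_eq_iff)
      with u show "C \<in> ?l ` carrier ?B" by (auto simp: base_change_eq)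
    qed
  qed (auto simp: base_change_eq base_change_lift_tcoset carrier_Q \<Phi>_M)
  moreover have "?l (c \<odot>\<^bsub>?B\<^esub> C) = c \<odot>\<^bsub>Q\<^esub> ?l C" if "C \<in> carrier ?B" for c C
  proof -
    from that obtain u where u: "C = tcoset u" "u \<in> carrier G" by (auto simp: base_change_eq)
    thus ?thesis
      using scale_G_\<Phi>[OF u(2), of c]
      by (simp add: smult_tcoset base_change_lift_tcoset smult_Q \<Phi>_M)
  qed
  ultimately show ?thesis
    using hom unfolding module_iso_def iso_def bij_betw_def by simp
qed

end

section \<open>The regulator\<close>

lemma gauss_val_ge_imp_tate_algebra:
  assumes "gauss_val_ge f m"
  shows "f \<in> tate_algebra"
  unfolding tate_algebra_iff eventually_sequentially
proof (intro allI exI impI)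
  fix k i assume "i \<ge> nat (k - m)"
  hence "k \<le> m + int i" by linarith
  with assms show "val_ge (f $ i) k" unfolding gauss_val_ge_def by (metis val_ge_mono)
qed

lemma carrier_ext_numerator:
  "\<xi> \<in> carrier (ext_numerator n) \<longleftrightarrow> \<xi> \<in> tate_algebra \<and> frob_defect n \<xi> \<in> poly_theta_t"
  by (simp add: ext_numerator_def frob_defect_def)

lemma basic_solution_in_ext_numerator:
  "d < n \<Longrightarrow> basic_solution n d \<in> carrier (ext_numerator n)"
  using basic_solution gauss_val_ge_imp_tate_algebra unfolding carrier_ext_numerator
  by (metis poly_theta_t_t_minus_theta_power)

text \<open>Continuation past \<open>\<theta>\<close> is inherited from the basic solutions, which
  together with the polynomials span the numerator.\<close>

lemma laurent_convergent_ext_numerator: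
  fixes \<xi> :: "'a::{field, finite} fls fps"
  assumes "\<xi> \<in> carrier (ext_numerator n)"
  shows "laurent_convergent n \<xi>"
proof -
  obtain g a where g: "g \<in> poly_theta_t"
    and \<xi>: "\<xi> = g + (\<Sum>d<n. series_of_poly_t (a d) * basic_solution n d)"
    using ext_numerator_span assms unfolding carrier_ext_numerator by blast
  have "laurent_convergent n (\<Sum>d<n. series_of_poly_t (a d) * basic_solution n d :: 'a fls fps)"
    by (intro conjunct1[OF laurent_convergent_sum] conjunct1[OF laurent_series_of_poly_t_mult]
        laurent_convergent_basic_solution) simp
  moreover have "laurent_convergent n g"
    using laurent_eq_taylor taylor_convergent_poly_theta_t[OF g] by blast
  ultimately show ?thesis unfolding \<xi> using laurent_add by blast
qed

lemma carrier_hodge_pink_numerator: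
  "y \<in> carrier (hodge_pink_numerator n) \<longleftrightarrow> (\<exists>g. y = fls_X_intpow (- int n) * fps_to_fls g)"
  by (auto simp: hodge_pink_numerator_def)

locale carlitz_twist =
  fixes n :: nat and lam :: "'a::{field, finite} fls alg_closure"
  assumes lam: "lam ^ (CARD('a) - 1) = to_ac (- theta)"
begin

text \<open>A generator of \<open>B^+\<close>; it is 0 when \<open>q - 1\<close> does not divide
  \<open>n\<close>, so the two cases of \<open>B_plus\<close> need no further distinction.\<close>

definition w :: "'a fls fps" where
  "w = (SOME w. B_plus lam n = range (\<lambda>a. series_of_poly_t a * w) \<and> w \<in> tate_algebra \<and> frob_defect n w = 0)"

lemma w: "B_plus lam n = range (\<lambda>a. series_of_poly_t a * w)" "w \<in> carrier (ext_numerator n)"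
  and frob_defect_w: "frob_defect n w = 0"
  using someI_ex[OF B_plus_cyclic[OF lam, of n]] unfolding w_def[symmetric] carrier_ext_numerator
  by auto

lemma laurent_w: "laurent_convergent n w"
  using laurent_convergent_ext_numerator[OF w(2)] .

lemma mem_ext_denominator_iff:
  "\<xi> \<in> ext_denominator lam n \<longleftrightarrow> (\<exists>a r. \<xi> = series_of_poly_t a * w + r \<and> r \<in> poly_theta_t)"
  by (auto simp: ext_denominator_def w)

text \<open>The factor from F[t] in an element of \<open>B^+\<close> is absorbed into the
  coefficient from \<open>K_infty\<close>.\<close>

lemma mem_hodge_pink_denominator_iff:
  "y \<in> hodge_pink_denominator lam n \<longleftrightarrow>
    (\<exists>c g. y = fps_to_fls (expand_at_theta c) * laurent_at_theta n w + fps_to_fls g)"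
proof
  assume "y \<in> hodge_pink_denominator lam n"
  then obtain c a g where "y = fps_to_fls (expand_at_theta c) * laurent_at_theta n (series_of_poly_t a * w) + fps_to_fls g"
    by (auto simp: hodge_pink_denominator_def w)
  hence "y = fps_to_fls (expand_at_theta (c * inf_of_poly a)) * laurent_at_theta n w + fps_to_fls g"
    using laurent_series_of_poly_t_mult[OF laurent_w, of a]
    by (simp add: expand_at_theta_mult fls_times_fps_to_fls mult.assoc)
  thus "\<exists>c g. y = fps_to_fls (expand_at_theta c) * laurent_at_theta n w + fps_to_fls g" by blast
next
  assume "\<exists>c g. y = fps_to_fls (expand_at_theta c) * laurent_at_theta n w + fps_to_fls g"
  moreover have "w \<in> B_plus lam n" unfolding w by (rule range_eqI[of _ _ 1]) simp
  ultimately show "y \<in> hodge_pink_denominator lam n"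
    by (auto simp: hodge_pink_denominator_def)
qed

sublocale ext: type_module_quotient "ext_numerator n" "ext_denominator lam n"
proof
  fix x y :: "'a fls fps" and c
  assume x: "x \<in> carrier (ext_numerator n)"
  show "c \<odot>\<^bsub>ext_numerator n\<^esub> x \<in> carrier (ext_numerator n)"
    using x unfolding carrier_ext_numerator
    by (simp add: ext_numerator_def tate_algebra_series_of_poly_t_mult frob_defect_series_of_poly_t_mult
        poly_theta_t_mult)
  assume y: "y \<in> carrier (ext_numerator n)"
  show "x - y \<in> carrier (ext_numerator n)"
  proof -
    have "fps_const (- 1) * y \<in> tate_algebra"
      using y by (intro tate_algebra_const_mult) (simp add: carrier_ext_numerator)
    hence "x + fps_const (- 1) * y \<in> tate_algebra"
      using x by (intro tate_algebra_add) (simp_all add: carrier_ext_numerator)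
    moreover have "x + fps_const (- 1) * y = x - y"
      by (simp flip: fps_const_neg)
    ultimately show ?thesis
      using x y by (simp add: carrier_ext_numerator frob_defect_diff poly_theta_t_diff)
  qed
  show "c \<odot>\<^bsub>ext_numerator n\<^esub> (x - y) = c \<odot>\<^bsub>ext_numerator n\<^esub> x - c \<odot>\<^bsub>ext_numerator n\<^esub> y"
    by (simp add: ext_numerator_def ring_distribs)
next
  show "ext_denominator lam n \<subseteq> carrier (ext_numerator n)"
  proof
    fix x assume "x \<in> ext_denominator lam n"
    then obtain a r where "x = series_of_poly_t a * w + r" "r \<in> poly_theta_t"
      by (auto simp: mem_ext_denominator_iff)
    thus "x \<in> carrier (ext_numerator n)"
      using w(2) poly_theta_t_subset_tate_algebra unfolding carrier_ext_numerator
      by (auto simp: frob_defect_add frob_defect_series_of_poly_t_mult frob_defect_w frob_defect_poly_theta_t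
          intro: tate_algebra_add tate_algebra_series_of_poly_t_mult)
  qed
  show "0 \<in> ext_denominator lam n"
    unfolding mem_ext_denominator_iff by (intro exI[of _ 0] conjI) simp_all
next
  fix x y assume "x \<in> ext_denominator lam n" "y \<in> ext_denominator lam n"
  then obtain a r b s where *: "x = series_of_poly_t a * w + r" "r \<in> poly_theta_t"
    "y = series_of_poly_t b * w + s" "s \<in> poly_theta_t"
    by (auto simp: mem_ext_denominator_iff)
  have "series_of_poly_t (a - b) = series_of_poly_t a - (series_of_poly_t b :: 'a fls fps)"
    using series_of_poly_t_add[of "a - b" b] by simp
  hence "x - y = series_of_poly_t (a - b) * w + (r - s)"
    by (simp add: * ring_distribs)
  with * show "x - y \<in> ext_denominator lam n"
    unfolding mem_ext_denominator_iff by (blast intro: poly_theta_t_diff)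
next
  fix x c assume "x \<in> ext_denominator lam n"
  then obtain a r where *: "x = series_of_poly_t a * w + r" "r \<in> poly_theta_t"
    by (auto simp: mem_ext_denominator_iff)
  have "c \<odot>\<^bsub>ext_numerator n\<^esub> x = series_of_poly_t (c * a) * w + series_of_poly_t c * r"
    by (simp add: ext_numerator_def * series_of_poly_t_mult ring_distribs mult.assoc)
  with * show "c \<odot>\<^bsub>ext_numerator n\<^esub> x \<in> ext_denominator lam n"
    unfolding mem_ext_denominator_iff using poly_theta_t_mult[OF series_of_poly_t_in_poly_theta_t *(2), of c] by blast
qed (simp_all add: ext_numerator_def)

sublocale hp: type_module_quotient "hodge_pink_numerator n" "hodge_pink_denominator lam n"
proof
  fix x y :: "'a fls fls" and c
  assume "x \<in> carrier (hodge_pink_numerator n)"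
  then obtain g where x: "x = fls_X_intpow (- int n) * fps_to_fls g"
    by (auto simp: hodge_pink_numerator_def)
  have "c \<odot>\<^bsub>hodge_pink_numerator n\<^esub> x = fls_X_intpow (- int n) * fps_to_fls (expand_at_theta c * g)"
    unfolding x fls_times_fps_to_fls by (simp add: hodge_pink_numerator_def mult_ac)
  thus "c \<odot>\<^bsub>hodge_pink_numerator n\<^esub> x \<in> carrier (hodge_pink_numerator n)"
    unfolding carrier_hodge_pink_numerator by blast
  assume "y \<in> carrier (hodge_pink_numerator n)"
  then obtain h where y: "y = fls_X_intpow (- int n) * fps_to_fls h"
    by (auto simp: hodge_pink_numerator_def)
  have "x - y = fls_X_intpow (- int n) * fps_to_fls (g - h)"
    unfolding x y fps_to_fls_minus by (simp only: right_diff_distrib)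
  thus "x - y \<in> carrier (hodge_pink_numerator n)"
    unfolding carrier_hodge_pink_numerator by blast
  show "c \<odot>\<^bsub>hodge_pink_numerator n\<^esub> (x - y)
      = c \<odot>\<^bsub>hodge_pink_numerator n\<^esub> x - c \<odot>\<^bsub>hodge_pink_numerator n\<^esub> y"
    by (simp add: hodge_pink_numerator_def right_diff_distrib)
next
  show "hodge_pink_denominator lam n \<subseteq> carrier (hodge_pink_numerator n)"
  proof
    fix x assume "x \<in> hodge_pink_denominator lam n"
    then obtain c g where x: "x = fps_to_fls (expand_at_theta c) * laurent_at_theta n w + fps_to_fls g"
      by (auto simp: mem_hodge_pink_denominator_iff)
    have "fps_to_fls g = fls_X_intpow (- int n) * fps_to_fls (fps_X ^ n * g)"
      by (simp add: fls_times_fps_to_fls fps_to_fls_power fls_X_power_times_conv_shift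
          fls_shifted_times_simps)
    hence "x = fls_X_intpow (- int n) * fps_to_fls
        (expand_at_theta c * taylor_at_theta (t_minus_theta ^ n * w) + fps_X ^ n * g)"
      unfolding x laurent_at_theta_def fps_to_fls_plus fls_times_fps_to_fls
      by (simp only: distrib_left mult_ac)
    thus "x \<in> carrier (hodge_pink_numerator n)"
      unfolding carrier_hodge_pink_numerator by blast
  qed
  show "0 \<in> hodge_pink_denominator lam n"
    unfolding mem_hodge_pink_denominator_iff by (intro exI[of _ 0]) simp
next
  fix x y assume "x \<in> hodge_pink_denominator lam n" "y \<in> hodge_pink_denominator lam n"
  then obtain c g d h where *: "x = fps_to_fls (expand_at_theta c) * laurent_at_theta n w + fps_to_fls g"
    "y = fps_to_fls (expand_at_theta d) * laurent_at_theta n w + fps_to_fls h"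
    by (auto simp: mem_hodge_pink_denominator_iff)
  have "x - y = fps_to_fls (expand_at_theta (c - d)) * laurent_at_theta n w + fps_to_fls (g - h)"
    by (simp add: * expand_at_theta_diff ring_distribs)
  thus "x - y \<in> hodge_pink_denominator lam n"
    unfolding mem_hodge_pink_denominator_iff by blast
next
  fix x c assume "x \<in> hodge_pink_denominator lam n"
  then obtain d g where *: "x = fps_to_fls (expand_at_theta d) * laurent_at_theta n w + fps_to_fls g"
    by (auto simp: mem_hodge_pink_denominator_iff)
  have "c \<odot>\<^bsub>hodge_pink_numerator n\<^esub> x
      = fps_to_fls (expand_at_theta (c * d)) * laurent_at_theta n w + fps_to_fls (expand_at_theta c * g)"
    by (simp add: hodge_pink_numerator_def * expand_at_theta_mult fls_times_fps_to_fls ring_distribs mult.assoc)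
  thus "c \<odot>\<^bsub>hodge_pink_numerator n\<^esub> x \<in> hodge_pink_denominator lam n"
    unfolding mem_hodge_pink_denominator_iff by blast
qed (simp_all add: hodge_pink_numerator_def)

lemma fps_to_fls_in_hodge_pink_denominator: "fps_to_fls g \<in> hodge_pink_denominator lam n"
  unfolding mem_hodge_pink_denominator_iff by (rule exI[of _ 0]) simp

lemma poly_theta_t_in_ext_denominator: "g \<in> poly_theta_t \<Longrightarrow> g \<in> ext_denominator lam n"
  unfolding mem_ext_denominator_iff by (intro exI[of _ 0] exI[of _ g]) simp

lemma w_in_ext_denominator: "w \<in> ext_denominator lam n"
  unfolding mem_ext_denominator_iff by (intro exI[of _ 1] exI[of _ 0]) simp

text \<open>Well-definedness of the regulator: polynomials are regular at \<open>\<theta>\<close>,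
  and multiples of \<open>w\<close> expand to multiples of its expansion.\<close>

lemma laurent_ext_denominator:
  assumes "\<xi> \<in> ext_denominator lam n"
  shows "laurent_at_theta n \<xi> \<in> hodge_pink_denominator lam n"
proof -
  from assms obtain a r where *: "\<xi> = series_of_poly_t a * w + r" "r \<in> poly_theta_t"
    by (auto simp: mem_ext_denominator_iff)
  note aw = laurent_series_of_poly_t_mult[OF laurent_w, of a]
    and r = laurent_eq_taylor[OF taylor_convergent_poly_theta_t[OF *(2)], of n]
  have "laurent_at_theta n \<xi> = laurent_at_theta n (series_of_poly_t a * w) + laurent_at_theta n r"
    unfolding * using laurent_add aw r by blast
  hence "laurent_at_theta n \<xi>
      = fps_to_fls (expand_at_theta (inf_of_poly a)) * laurent_at_theta n w + fps_to_fls (taylor_at_theta r)"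
    using aw r by simp
  thus ?thesis unfolding mem_hodge_pink_denominator_iff by blast
qed

section \<open>The induced map on the tensor product\<close>

definition rep :: "'a fls fps set \<Rightarrow> 'a fls fps" where
  "rep C = (SOME \<xi>. \<xi> \<in> carrier (ext_numerator n) \<and> ext.coset \<xi> = C)"

lemma rep:
  assumes "C \<in> carrier (ext_reg lam n)"
  shows "rep C \<in> carrier (ext_numerator n)" "ext.coset (rep C) = C"
proof -
  have "\<exists>\<xi>. \<xi> \<in> carrier (ext_numerator n) \<and> ext.coset \<xi> = C"
    using assms by (auto simp: ext_reg_def ext.carrier_Q)
  from someI_ex[OF this] show "rep C \<in> carrier (ext_numerator n)" "ext.coset (rep C) = C"
    by (auto simp: rep_def)
qed

text \<open>Makes the choices in \<open>rep\<close> harmless: two representatives of a class expand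
  to series that agree modulo the Hodge-Pink denominator.\<close>

lemma laurent_coset_cong:
  assumes "\<xi> \<in> carrier (ext_numerator n)" "\<eta> \<in> carrier (ext_numerator n)" "ext.coset \<xi> = ext.coset \<eta>"
  shows "laurent_at_theta n \<xi> - laurent_at_theta n \<eta> \<in> hodge_pink_denominator lam n"
proof -
  have "laurent_at_theta n (\<xi> - \<eta>) \<in> hodge_pink_denominator lam n"
    using assms(3) by (intro laurent_ext_denominator) (simp add: ext.coset_eq_iff)
  thus ?thesis
    using laurent_diff assms(1,2)[THEN laurent_convergent_ext_numerator] by metis
qed

lemma coset_in_ext_reg: "\<xi> \<in> carrier (ext_numerator n) \<Longrightarrow> ext.coset \<xi> \<in> carrier (ext_reg lam n)"
  by (simp add: ext_reg_def ext.carrier_Q)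

lemma smult_ext_numerator: "\<xi> \<in> carrier (ext_numerator n) \<Longrightarrow>
    series_of_poly_t a * \<xi> \<in> carrier (ext_numerator n)" for \<xi> :: "'a fls fps"
  using ext.M_smult[of \<xi> a] by (simp add: ext_numerator_def)

lemma add_ext_reg: "ext.coset \<xi> \<oplus>\<^bsub>ext_reg lam n\<^esub> ext.coset \<eta> = ext.coset (\<xi> + \<eta>)"
  by (simp add: ext_reg_def ext.add_Q)

lemma smult_ext_reg: "\<xi> \<in> carrier (ext_numerator n) \<Longrightarrow>
    a \<odot>\<^bsub>ext_reg lam n\<^esub> ext.coset \<xi> = ext.coset (series_of_poly_t a * \<xi>)"
  by (simp add: ext_reg_def ext.smult_Q) (simp add: ext_numerator_def)

lemma smult_hp: "c \<odot>\<^bsub>hodge_pink_numerator n\<^esub> x = fps_to_fls (expand_at_theta c) * x"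
  by (simp add: hodge_pink_numerator_def)

sublocale bc: base_change_map "hodge_pink_numerator n" "hodge_pink_denominator lam n" "ext_reg lam n" inf_of_poly
  "quot_lift (\<lambda>\<xi>. hp.coset (laurent_at_theta n \<xi>))" "\<lambda>C. laurent_at_theta n (rep C)"
proof
  fix c d and x :: "'a fls fls"
  show "(c * d) \<odot>\<^bsub>hodge_pink_numerator n\<^esub> x = c \<odot>\<^bsub>hodge_pink_numerator n\<^esub> (d \<odot>\<^bsub>hodge_pink_numerator n\<^esub> x)"
    by (simp add: smult_hp expand_at_theta_mult fls_times_fps_to_fls mult.assoc)
  show "(c + d) \<odot>\<^bsub>hodge_pink_numerator n\<^esub> x = c \<odot>\<^bsub>hodge_pink_numerator n\<^esub> x + d \<odot>\<^bsub>hodge_pink_numerator n\<^esub> x"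
    by (simp add: smult_hp expand_at_theta_add ring_distribs)
next
  fix C assume C: "C \<in> carrier (ext_reg lam n)"
  note repC = rep[OF C]
  show "laurent_at_theta n (rep C) \<in> carrier (hodge_pink_numerator n)"
    unfolding carrier_hodge_pink_numerator laurent_at_theta_def by blast
  have const: "hp.coset (laurent_at_theta n \<xi>) = hp.coset (laurent_at_theta n (rep C))" if "\<xi> \<in> C" for \<xi>
  proof -
    have "\<xi> \<in> ext.coset (rep C)" using that repC by simp
    hence 1: "\<xi> - rep C \<in> ext_denominator lam n" by (simp add: ext.mem_coset_iff)
    hence "\<xi> \<in> carrier (ext_numerator n)"
      using ext.M_add[of "\<xi> - rep C" "rep C"] repC(1) ext.N_subset by auto
    thus ?thesis using 1 laurent_coset_cong[of \<xi> "rep C"] repC(1)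
      by (simp add: hp.coset_eq_iff ext.coset_eq_iff)
  qed
  have "rep C \<in> ext.coset (rep C)" by (simp add: ext.mem_coset_iff ext.N_0)
  hence "C \<noteq> {}" using repC(2) by blast
  thus "quot_lift (\<lambda>\<xi>. hp.coset (laurent_at_theta n \<xi>)) C = hp.coset (laurent_at_theta n (rep C))"
    unfolding quot_lift_def using const by (rule the_elem_image_unique)
  fix r
  have rC: "r \<odot>\<^bsub>ext_reg lam n\<^esub> C = ext.coset (series_of_poly_t r * rep C)"
    using smult_ext_reg[OF repC(1), of r] repC(2) by simp
  thus rC': "r \<odot>\<^bsub>ext_reg lam n\<^esub> C \<in> carrier (ext_reg lam n)"
    using repC by (simp add: coset_in_ext_reg smult_ext_numerator)
  show "laurent_at_theta n (rep (r \<odot>\<^bsub>ext_reg lam n\<^esub> C)) - inf_of_poly r \<odot>\<^bsub>hodge_pink_numerator n\<^esub> laurent_at_theta n (rep C)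
      \<in> hodge_pink_denominator lam n"
    using laurent_coset_cong[OF rep(1)[OF rC'] smult_ext_numerator[OF repC(1), of r]] rep(2)[OF rC'] rC
      laurent_series_of_poly_t_mult[OF laurent_convergent_ext_numerator[OF repC(1)], of r]
    by (simp add: smult_hp)
  fix D assume D: "D \<in> carrier (ext_reg lam n)"
  note repD = rep[OF D]
  have CD: "C \<oplus>\<^bsub>ext_reg lam n\<^esub> D = ext.coset (rep C + rep D)"
    using add_ext_reg[of "rep C" "rep D"] repC(2) repD(2) by simp
  thus CD': "C \<oplus>\<^bsub>ext_reg lam n\<^esub> D \<in> carrier (ext_reg lam n)"
    using repC repD by (simp add: coset_in_ext_reg ext.M_add)
  show "laurent_at_theta n (rep (C \<oplus>\<^bsub>ext_reg lam n\<^esub> D)) - laurent_at_theta n (rep C) - laurent_at_theta n (rep D)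
      \<in> hodge_pink_denominator lam n"
    using laurent_coset_cong[OF rep(1)[OF CD'] ext.M_add[OF repC(1) repD(1)]] rep(2)[OF CD'] CD
      laurent_add[OF laurent_convergent_ext_numerator[OF repC(1)] laurent_convergent_ext_numerator[OF repD(1)]]
    by (simp add: diff_diff_eq)
qed

section \<open>A normal form for elements of the source\<close>

abbreviation e :: "nat \<Rightarrow> 'a fls fps set" where
  "e d \<equiv> ext.coset (basic_solution n d)"

text \<open>Formal sums of this shape stand for the tensors \<open>\<Sum> e_d \<otimes> c_d\<close>.
  Different \<open>c\<close> may give the same tensor, because of \<open>B^+\<close>.\<close>

definition U :: "(nat \<Rightarrow> 'a fls) \<Rightarrow> ('a fls fps set \<times> 'a fls \<Rightarrow>\<^sub>0 int)" where
  "U c = (\<Sum>d<n. frag_of (e d, c d))"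

lemma e_in_ext_reg: "d < n \<Longrightarrow> e d \<in> carrier (ext_reg lam n)"
  by (intro coset_in_ext_reg basic_solution_in_ext_numerator)

lemma G_sum: "(\<And>i. i \<in> I \<Longrightarrow> u i \<in> carrier bc.G) \<Longrightarrow> (\<Sum>i\<in>I. u i) \<in> carrier bc.G"
  unfolding bc.G_def by (rule sum_closed_free_Abelian_group)

lemma T_sum: "(\<And>i. i \<in> I \<Longrightarrow> u i \<in> bc.T) \<Longrightarrow> (\<Sum>i\<in>I. u i) \<in> bc.T"
  by (induction I rule: infinite_finite_induct) (auto intro: bc.T_add bc.T_0)

lemma U_G: "U c \<in> carrier bc.G"
  unfolding U_def by (intro G_sum bc.frag_of_G e_in_ext_reg) simp

lemma U_diff: "U (\<lambda>d. b d - c d) - (U b - U c) \<in> bc.T"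
proof -
  have "U (\<lambda>d. b d - c d) - (U b - U c)
      = (\<Sum>d<n. frag_of (e d, b d - c d) - (frag_of (e d, b d) - frag_of (e d, c d)))"
    by (simp add: U_def sum_subtractf)
  also have "\<dots> \<in> bc.T"
    by (intro T_sum bc.T_diff_right e_in_ext_reg) simp
  finally show ?thesis .
qed

text \<open>Additivity in the left factor for \<open>0 + 0 = 0\<close> leaves minus this
  generator.\<close>

lemma frag_of_0_left: "frag_of (ext.coset 0, c) \<in> bc.T"
  using bc.T_add_left[OF coset_in_ext_reg[OF ext.M_0] coset_in_ext_reg[OF ext.M_0], of c]
    bc.T_uminus by (fastforce simp: add_ext_reg)

text \<open>Coefficients from F[t] cross the tensor sign:
  \<open>(\<Sum> a_d e_d) \<otimes> c = \<Sum> e_d \<otimes> a_d c\<close>. This serves both to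
  reach the normal form and to recognise the relation coming from \<open>B^+\<close>.\<close>

lemma U_combination:
  "U (\<lambda>d. inf_of_poly (a d) * c)
    - frag_of (ext.coset (\<Sum>d<n. series_of_poly_t (a d) * basic_solution n d), c) \<in> bc.T"
proof -
  \<comment> \<open>Partial sums up to \<open>m \<le> n\<close> are used so that the induction does
    not change \<open>n\<close>, on which the basic solutions depend.\<close>
  have "(\<Sum>d<m. frag_of (e d, inf_of_poly (a d) * c))
      - frag_of (ext.coset (\<Sum>d<m. series_of_poly_t (a d) * basic_solution n d), c) \<in> bc.T" if "m \<le> n" for m
    using that
  proof (induction m)
    case 0
    thus ?case using bc.T_uminus[OF frag_of_0_left] by simp
  next
    case (Suc m)
    let ?s = "\<Sum>d<m. series_of_poly_t (a d) * basic_solution n d :: 'a fls fps"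
    let ?b = "basic_solution n m :: 'a fls fps"
    have b: "?b \<in> carrier (ext_numerator n)" "e m \<in> carrier (ext_reg lam n)"
      using Suc.prems by (simp_all add: basic_solution_in_ext_numerator e_in_ext_reg)
    have s: "?s \<in> carrier (ext_numerator n)"
      using Suc.prems by (intro ext.M_sum smult_ext_numerator basic_solution_in_ext_numerator) simp
    have 1: "frag_of (ext.coset (?s + series_of_poly_t (a m) * ?b), c) - frag_of (ext.coset ?s, c)
        - frag_of (ext.coset (series_of_poly_t (a m) * ?b), c) \<in> bc.T"
      using bc.T_add_left[OF coset_in_ext_reg[OF s] coset_in_ext_reg[OF smult_ext_numerator[OF b(1)]], of "a m" c]
      by (simp add: add_ext_reg)
    have 2: "frag_of (ext.coset (series_of_poly_t (a m) * ?b), c) - frag_of (e m, inf_of_poly (a m) * c) \<in> bc.T"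
      using bc.T_smult[OF b(2), of "a m" c] by (simp add: smult_ext_reg b(1))
    have "(\<Sum>d<m. frag_of (e d, inf_of_poly (a d) * c)) - frag_of (ext.coset ?s, c) \<in> bc.T"
      using Suc by simp
    from bc.T_diff[OF bc.T_diff[OF this 1] 2]
    show ?case by (simp add: algebra_simps)
  qed
  thus ?thesis by (simp add: U_def)
qed

text \<open>On a generator, the class is written through the basic solutions modulo polynomials, and
  the coefficients are moved to the right factor.\<close>

lemma U_spans:
  assumes "u \<in> carrier bc.G"
  shows "\<exists>c. u - U c \<in> bc.T"
  using assms[unfolded bc.carrier_G]
proof (rule free_Abelian_group_induct)
  have "0 - U (\<lambda>d. 0) \<in> bc.T"
    using bc.T_uminus[OF U_diff[of "\<lambda>d. 0" "\<lambda>d. 0"]] by simp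
  thus "\<exists>c. 0 - U c \<in> bc.T" by blast
next
  fix u v assume "\<exists>c. u - U c \<in> bc.T" "\<exists>c. v - U c \<in> bc.T"
  then obtain b c where "u - U b \<in> bc.T" "v - U c \<in> bc.T" by blast
  from bc.T_diff[OF bc.T_diff[OF this] U_diff[of b c]]
  have "u - v - U (\<lambda>d. b d - c d) \<in> bc.T" by (simp add: algebra_simps)
  thus "\<exists>c. u - v - U c \<in> bc.T" by blast
next
  fix p :: "'a fls fps set \<times> 'a fls" assume "p \<in> carrier (ext_reg lam n) \<times> UNIV"
  then obtain C c where p: "p = (C, c)" "C \<in> carrier (ext_reg lam n)" by auto
  note repC = rep[OF p(2)]
  obtain g a where g: "g \<in> poly_theta_t"
    and rep_eq: "rep C = g + (\<Sum>d<n. series_of_poly_t (a d) * basic_solution n d)"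
    using ext_numerator_span repC(1) unfolding carrier_ext_numerator by blast
  have "ext.coset (rep C) = ext.coset (\<Sum>d<n. series_of_poly_t (a d) * basic_solution n d)"
    unfolding ext.coset_eq_iff using g by (simp add: rep_eq poly_theta_t_in_ext_denominator)
  hence "C = ext.coset (\<Sum>d<n. series_of_poly_t (a d) * basic_solution n d)"
    by (simp only: repC(2))
  hence "frag_of p - U (\<lambda>d. inf_of_poly (a d) * c) \<in> bc.T"
    using bc.T_uminus[OF U_combination[of a c]] by (simp add: p)
  thus "\<exists>c. frag_of p - U c \<in> bc.T" by blast
qed

lemma sum_laurent_basic_solution:
  "(\<Sum>d<n. fps_to_fls (expand_at_theta (c d)) * laurent_at_theta n (basic_solution n d))
    = fls_X_intpow (- int n) * fps_to_fls (\<Sum>d<n. expand_at_theta (c d) * solution_numerator n d :: 'a fls fps)"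
proof -
  have "fps_to_fls (\<Sum>d\<in>I. f d) = (\<Sum>d\<in>I. fps_to_fls (f d))" for f :: "nat \<Rightarrow> 'a fls fps" and I
    by (induction I rule: infinite_finite_induct) simp_all
  thus ?thesis
    by (simp only: laurent_at_theta_def solution_numerator_def fls_times_fps_to_fls sum_distrib_left mult_ac)
qed

text \<open>The representative chosen for \<open>e d\<close> need not be the basic solution; the
  discrepancy lies in the denominator.\<close>

lemma \<Phi>_U: "bc.\<Phi> (U c) - (\<Sum>d<n. fps_to_fls (expand_at_theta (c d)) * laurent_at_theta n (basic_solution n d))
    \<in> hodge_pink_denominator lam n"
proof -
  have "bc.\<Phi> (U c) - (\<Sum>d<n. fps_to_fls (expand_at_theta (c d)) * laurent_at_theta n (basic_solution n d))
    = (\<Sum>d<n. c d \<odot>\<^bsub>hodge_pink_numerator n\<^esub> (laurent_at_theta n (rep (e d)) - laurent_at_theta n (basic_solution n d)))"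
    by (simp add: U_def bc.\<Phi>_sum smult_hp sum_subtractf right_diff_distrib)
  also have "\<dots> \<in> hodge_pink_denominator lam n"
    using rep[OF e_in_ext_reg] basic_solution_in_ext_numerator
    by (intro hp.N_sum hp.N_smult laurent_coset_cong) simp_all
  finally show ?thesis .
qed

theorem regulator_iso: "regulator lam n \<in> module_iso K_infty (regulator_source lam n) (ext_hodge_pink lam n)"
  unfolding regulator_def regulator_source_def ext_hodge_pink_def
proof (rule bc.base_change_lift_iso)
  fix y :: "'a fls fls" assume "y \<in> carrier (hodge_pink_numerator n)"
  then obtain P where y: "y = fls_X_intpow (- int n) * fps_to_fls P"
    by (auto simp: hodge_pink_numerator_def)
  obtain c where c: "\<forall>j<n. (P - (\<Sum>d<n. expand_at_theta (c d) * solution_numerator n d)) $ j = 0"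
    using solution_numerator_combination_surj by blast
  let ?s = "\<Sum>d<n. expand_at_theta (c d) * solution_numerator n d :: 'a fls fps"
  let ?l = "\<Sum>d<n. fps_to_fls (expand_at_theta (c d)) * laurent_at_theta n (basic_solution n d)"
  \<comment> \<open>The first \<open>n\<close> coefficients of \<open>P - ?s\<close> vanish, so
    dividing by \<open>X^n\<close> leaves a regular series: \<open>y\<close> and the combination
    have equal polar parts.\<close>
  define g where "g = fps_shift n (P - ?s)"
  have "P - ?s = fps_X ^ n * g"
    by (rule fps_ext) (use c in \<open>auto simp: g_def fps_X_power_mult_nth\<close>)
  hence "fls_X_intpow (- int n) * fps_to_fls (P - ?s) = fps_to_fls g"
    by (simp add: fls_times_fps_to_fls fps_to_fls_power fls_X_power_times_conv_shift fls_shifted_times_simps)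
  hence yl: "y - ?l = fps_to_fls g"
    unfolding y sum_laurent_basic_solution fps_to_fls_minus by (simp only: right_diff_distrib)
  have "y - ?l \<in> hodge_pink_denominator lam n"
    unfolding yl by (rule fps_to_fls_in_hodge_pink_denominator)
  from hp.N_diff[OF this \<Phi>_U[of c]] have "y - bc.\<Phi> (U c) \<in> hodge_pink_denominator lam n" by simp
  thus "\<exists>u\<in>carrier bc.G. y - bc.\<Phi> u \<in> hodge_pink_denominator lam n"
    using U_G by blast
next
  fix u assume u: "u \<in> carrier bc.G" "bc.\<Phi> u \<in> hodge_pink_denominator lam n"
  obtain b where b: "u - U b \<in> bc.T" using U_spans[OF u(1)] by blast
  let ?l = "\<lambda>b. \<Sum>d<n. fps_to_fls (expand_at_theta (b d)) * laurent_at_theta n (basic_solution n d)"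
  have "bc.\<Phi> u - bc.\<Phi> (u - U b) - (bc.\<Phi> (U b) - ?l b) \<in> hodge_pink_denominator lam n"
    by (intro hp.N_diff u bc.\<Phi>_T b \<Phi>_U)
  hence "?l b \<in> hodge_pink_denominator lam n" by (simp add: bc.\<Phi>_diff)
  then obtain c g where lb: "?l b = fps_to_fls (expand_at_theta c) * laurent_at_theta n w + fps_to_fls g"
    by (auto simp: mem_hodge_pink_denominator_iff)
  \<comment> \<open>Since \<open>w\<close> lies in the numerator, the contribution of
    \<open>B^+\<close> to \<open>?l b\<close> is itself a combination of the basic expansions, up to
    a regular series.\<close>
  obtain r a where r: "r \<in> poly_theta_t"
    and w_eq: "w = r + (\<Sum>d<n. series_of_poly_t (a d) * basic_solution n d)"
    using ext_numerator_span w(2) unfolding carrier_ext_numerator by blast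
  let ?s = "\<Sum>d<n. series_of_poly_t (a d) * basic_solution n d :: 'a fls fps"
  have basic: "laurent_convergent n (series_of_poly_t (a d) * basic_solution n d)"
    "laurent_at_theta n (series_of_poly_t (a d) * basic_solution n d)
      = fps_to_fls (expand_at_theta (inf_of_poly (a d))) * laurent_at_theta n (basic_solution n d)" if "d < n" for d
    using laurent_series_of_poly_t_mult[OF laurent_convergent_basic_solution[OF that, where ?'a = 'a], of "a d"] by blast+
  have lr: "laurent_convergent n r" "laurent_at_theta n r = fps_to_fls (taylor_at_theta r)"
    using laurent_eq_taylor[OF taylor_convergent_poly_theta_t[OF r]] by blast+
  have ls: "laurent_convergent n ?s" "laurent_at_theta n ?s = ?l (\<lambda>d. inf_of_poly (a d))"
    using laurent_convergent_sum[of "{..<n}" n "\<lambda>d. series_of_poly_t (a d) * basic_solution n d"] basic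
    by simp_all
  have "laurent_at_theta n w = fps_to_fls (taylor_at_theta r) + ?l (\<lambda>d. inf_of_poly (a d))"
    unfolding w_eq using laurent_add[OF lr(1) ls(1)] lr(2) ls(2) by simp
  moreover define g' where "g' = expand_at_theta c * taylor_at_theta r + g"
  ultimately have "?l b = fps_to_fls (expand_at_theta c) * ?l (\<lambda>d. inf_of_poly (a d)) + fps_to_fls g'"
    unfolding lb by (simp add: fls_times_fps_to_fls ring_distribs)
  moreover have "fps_to_fls (expand_at_theta c) * ?l (\<lambda>d. inf_of_poly (a d)) = ?l (\<lambda>d. inf_of_poly (a d) * c)"
    by (simp add: sum_distrib_left expand_at_theta_mult fls_times_fps_to_fls mult_ac)
  moreover have "?l (\<lambda>d. b d - inf_of_poly (a d) * c) = ?l b - ?l (\<lambda>d. inf_of_poly (a d) * c)"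
    by (simp add: expand_at_theta_diff left_diff_distrib sum_subtractf)
  ultimately have "?l (\<lambda>d. b d - inf_of_poly (a d) * c) = fps_to_fls g'" by simp
  hence "fls_X_intpow (- int n) * fps_to_fls (\<Sum>d<n. expand_at_theta (b d - inf_of_poly (a d) * c) * solution_numerator n d)
      = fps_to_fls g'"
    by (simp only: sum_laurent_basic_solution)
  \<comment> \<open>Multiplication by \<open>X^n\<close> turns equality with a regular series into
    vanishing of all coefficients below \<open>n\<close>, as independence of the numerators
    requires.\<close>
  hence "fls_X_intpow (int n) * (fls_X_intpow (- int n) * fps_to_fls (\<Sum>d<n. expand_at_theta (b d - inf_of_poly (a d) * c) * solution_numerator n d))
      = fls_X ^ n * fps_to_fls g'"
    by (simp only: fls_X_power_conv_shift_1)
  hence "fps_to_fls (\<Sum>d<n. expand_at_theta (b d - inf_of_poly (a d) * c) * solution_numerator n d) = fps_to_fls (fps_X ^ n * g')"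
    by (simp add: fls_times_fps_to_fls fps_to_fls_power fls_shifted_times_simps)
  hence "(\<Sum>d<n. expand_at_theta (b d - inf_of_poly (a d) * c) * solution_numerator n d) = fps_X ^ n * g'"
    by (simp only: fps_to_fls_eq_iff)
  hence "b d - inf_of_poly (a d) * c = 0" if "d < n" for d
    using that by (intro solution_numerator_combination_inj[of n "\<lambda>d. b d - inf_of_poly (a d) * c"])
      (simp_all add: fps_X_power_mult_nth)
  \<comment> \<open>Thus \<open>U b\<close> represents the class of \<open>?s\<close> tensored with
    \<open>c\<close>, and that class is zero because \<open>?s = w - r\<close>.\<close>
  hence "U b = U (\<lambda>d. inf_of_poly (a d) * c)"
    by (auto simp: U_def intro!: sum.cong)
  moreover have "ext.coset ?s = ext.coset 0"
  proof -
    have "?s = w - r" by (simp add: w_eq)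
    thus ?thesis
      using ext.N_diff[OF w_in_ext_denominator poly_theta_t_in_ext_denominator[OF r]] by (simp add: ext.coset_eq_iff)
  qed
  ultimately have "U b \<in> bc.T"
    using bc.T_add[OF U_combination[of a c] frag_of_0_left[of c]] by simp
  with bc.T_add[OF b this] show "u \<in> bc.T" by simp
qed

end

theorem mainTheorem8:
  fixes n :: nat and lam :: "'a::{field, finite} fls alg_closure"
  assumes "n \<ge> 1"
    and "\<not> CHAR('a) dvd n"
    and "lam ^ (CARD('a) - 1) = to_ac (- theta)"
  shows "regulator lam n \<in> module_iso K_infty (regulator_source lam n) (ext_hodge_pink lam n)"
proof -
  interpret carlitz_twist n lam using assms(3) by unfold_locales
  show ?thesis by (rule regulator_iso)
qed

end
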